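(* For every $\eta\in(0,1)$ there are constants $C_1,C_2>0$ depending only on $\eta$ such that the following holds. Let $\delta\in(0,1)$, let $E\subset\mathbb{R}^n$ be a finite set of cardinality $|E|=p$, let $m\le n$ satisfy $$m\ge C_1\delta^{-2}\log(C_2p)\,(\log\log(C_2p))^2(\log n)^2,$$ and let $\Omega\subset\{1,\dots,n\}$ be an arbitrary fixed set with $|\Omega|=m$. Let $\epsilon$ be a Rademacher vector of length $n$, let $\Phi=\frac1{\sqrt m}R_\Omega H_\epsilon\in\mathbb{C}^{m\times n}$ be the partial circulant matrix generated by $\epsilon$, let $\epsilon'\in\mathbb{R}^n$ be a Rademacher vector independent of $\epsilon$, and let $D_{\epsilon'}$ be the diagonal matrix with diagonal $\epsilon'$. Then with probability exceeding $1-\eta$, for every $x\in E$, $$(1-\delta)\|x\|_2^2\le\|\Phi D_{\epsilon'}x\|_2^2\le(1+\delta)\|x\|_2^2 .$$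
   Context: A Rademacher vector is a random vector with independent entries taking the values $\pm1$ with probability $1/2$ each. For $z,x\in\mathbb{C}^n$ the circular convolution is $(z*x)_j=\sum_{k=1}^n z_{j\ominus k}x_k$, $j=1,\dots,n$, where $j\ominus k=j-k\bmod n$ is cyclic subtraction (indices taken in $\{1,\dots,n\}$). The circulant matrix $H_z\in\mathbb{C}^{n\times n}$ is defined by $H_zx=z*x$. The operator $R_\Omega:\mathbb{C}^n\to\mathbb{C}^m$ restricts a vector to its entries indexed by $\Omega$. Thus $\Phi x=\frac1{\sqrt m}R_\Omega(\epsilon*x)$. *)

theory Defs
  imports
    "HOL-Probability.Probability"
    "Jordan_Normal_Form.Matrix"
    "Jordan_Normal_Form.DL_Submatrix"
begin

unbundle no vec_syntax

text \<open>
  The dimension $n$ varies inside the statement, so vectors and matrices are those of the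
  carrier-based matrix library.  Coordinates are indexed by the residues $0,\dots,n-1$ modulo $n$;
  the index $n$ of the index set $\{1,\dots,n\}$ is represented by $0$, so that cyclic subtraction
  is subtraction modulo $n$.
\<close>

definition cyc_sub :: "nat \<Rightarrow> nat \<Rightarrow> nat \<Rightarrow> nat" where
  "cyc_sub n j k = nat ((int j - int k) mod int n)"

definition circ_conv :: "complex vec \<Rightarrow> complex vec \<Rightarrow> complex vec" where
  "circ_conv z x = vec (dim_vec x) (\<lambda>j. \<Sum>k<dim_vec x. z $ cyc_sub (dim_vec x) j k * x $ k)"

definition circulant_mat :: "complex vec \<Rightarrow> complex mat" where
  "circulant_mat z = mat (dim_vec z) (dim_vec z) (\<lambda>(j, k). z $ cyc_sub (dim_vec z) j k)"

lemma circulant_mat_carrier [simp]: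
  "z \<in> carrier_vec n \<Longrightarrow> circulant_mat z \<in> carrier_mat n n"
  by (auto simp: circulant_mat_def)

lemma circulant_mat_mult_vec:
  assumes "z \<in> carrier_vec n" "x \<in> carrier_vec n"
  shows "circulant_mat z *\<^sub>v x = circ_conv z x"
proof -
  have n: "dim_vec z = n" "dim_vec x = n" using assms by (simp_all only: carrier_vecD)
  show ?thesis
    by (rule eq_vecI)
      (simp_all add: n circulant_mat_def circ_conv_def scalar_prod_def atLeast0LessThan)
qed

text \<open>
  The matrix of the operator $R_\Omega$: the rows of the identity matrix with index in $\Omega$,
  in increasing order.
\<close>

definition restriction_mat :: "nat \<Rightarrow> nat set \<Rightarrow> complex mat" where
  "restriction_mat n \<Omega> = submatrix (1\<^sub>m n) \<Omega> UNIV"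

lemma restriction_mat_carrier:
  assumes "\<Omega> \<subseteq> {..<n}"
  shows "restriction_mat n \<Omega> \<in> carrier_mat (card \<Omega>) n"
proof -
  have "{i. i < n \<and> i \<in> \<Omega>} = \<Omega>" using assms by auto
  then show ?thesis
    by (intro carrier_matI) (simp_all add: restriction_mat_def dim_submatrix)
qed

lemma restriction_mat_mult_vec:
  assumes "\<Omega> \<subseteq> {..<n}" "v \<in> carrier_vec n"
  shows "restriction_mat n \<Omega> *\<^sub>v v = vec (card \<Omega>) (\<lambda>i. v $ pick \<Omega> i)"
proof (rule eq_vecI)
  have \<Omega>: "{i. i < n \<and> i \<in> \<Omega>} = \<Omega>" using assms by auto
  show "dim_vec (restriction_mat n \<Omega> *\<^sub>v v) = dim_vec (vec (card \<Omega>) (\<lambda>i. v $ pick \<Omega> i))"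
    using restriction_mat_carrier[OF assms(1)] by simp
  fix i assume "i < dim_vec (vec (card \<Omega>) (\<lambda>i. v $ pick \<Omega> i))"
  then have i: "i < card \<Omega>" by simp
  then have pick: "pick \<Omega> i < n"
    using pick_in_set_le[OF i] assms(1) by blast
  have "(restriction_mat n \<Omega> *\<^sub>v v) $ i = scalar_prod (row (restriction_mat n \<Omega>) i) v"
    using i restriction_mat_carrier[OF assms(1)] by simp
  also have "\<dots> = (\<Sum>k<n. (1\<^sub>m n :: complex mat) $$ (pick \<Omega> i, k) * v $ k)"
    unfolding scalar_prod_def using i assms(2) \<Omega>
    by (simp add: restriction_mat_def submatrix_def atLeast0LessThan pick_UNIV)
  also have "\<dots> = (\<Sum>k<n. if k = pick \<Omega> i then v $ k else 0)"
    using pick by (intro sum.cong refl) simp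
  also have "\<dots> = v $ pick \<Omega> i" using pick by simp
  finally show "(restriction_mat n \<Omega> *\<^sub>v v) $ i = vec (card \<Omega>) (\<lambda>i. v $ pick \<Omega> i) $ i"
    using i by simp
qed

definition partial_circulant :: "nat set \<Rightarrow> complex vec \<Rightarrow> complex mat" where
  "partial_circulant \<Omega> z =
     complex_of_real (1 / sqrt (real (card \<Omega>))) \<cdot>\<^sub>m
       (restriction_mat (dim_vec z) \<Omega> * circulant_mat z)"

definition diag_of_vec :: "'a::zero vec \<Rightarrow> 'a mat" where
  "diag_of_vec v = mat_diag (dim_vec v) (\<lambda>i. v $ i)"

definition vec_l2norm :: "'a::real_normed_vector vec \<Rightarrow> real" where
  "vec_l2norm v = L2_set (\<lambda>i. norm (v $ i)) {..<dim_vec v}"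

text \<open>
  The law of a Rademacher vector of length $n$.  Two independent Rademacher vectors are
  distributed according to the product of two copies of this law.
\<close>

definition rademacher_vec :: "nat \<Rightarrow> real vec pmf" where
  "rademacher_vec n = map_pmf (vec n) (Pi_pmf {..<n} 0 (\<lambda>_. pmf_of_set {-1, 1}))"

end

theory Submission
  imports Defs
begin

text \<open>
  The two random vectors play different roles.  Let \<open>G\<close> be the Gram matrix of the columns of the
  partial circulant matrix minus the identity.  It depends on \<open>\<epsilon>\<close> only and has zero diagonal, and
  the quantity to be bounded for a unit vector \<open>x\<close> is the quadratic form of \<open>G\<close> at \<open>\<epsilon>' x\<close>.  Let \<open>s\<close>
  be of the order of \<open>ln (C\<^sub>2 p)\<close>.

  The vector \<open>\<epsilon>\<close> is used once for all points of \<open>E\<close>.  Outside an event of probability at most \<open>\<eta> /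
  2\<close> the matrix has the restricted isometry property of order \<open>2 s\<close> with constant of the order of
  \<open>\<delta>\<close>. Equivalently, up to constants, the form of \<open>G\<close> is bounded by \<open>\<delta>\<close> times the product of the
  gauges \<open>|u|\<^sub>2 + |u|\<^sub>1 / sqrt s\<close> of its arguments (lemma \<open>bform_le_gauge\<close>).  The vector \<open>\<epsilon>'\<close> is
  used for each point separately, as in the theorem of Krahmer and Ward.  Split \<open>x\<close> into its entries
  above and below \<open>1 / sqrt s\<close>.  The large entries form a vector with bounded gauge for every choice
  of signs.  The small entries give a Rademacher chaos whose matrix has small operator and Frobenius
  norms, by the same gauge bound.  A Hanson--Wright inequality shows that the form exceeds \<open>\<delta>\<close> with
  probability at most \<open>4 exp (- 2 s / 9)\<close> (lemma \<open>sign_flipped_form_tail\<close>), which is small enough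
  for a union bound over \<open>p\<close> points.

  The restricted isometry property is a bound on the supremum of a second order Rademacher chaos in
  \<open>\<epsilon>\<close>, indexed by sparse unit vectors \<open>x\<close>.  Following Krahmer, Mendelson and Rauhut, the chaos is
  decoupled and then chained.  The increments are measured by the operator norm of convolution by
  \<open>x\<close>, which is the largest modulus of a Fourier coefficient of \<open>x\<close>.  The chain runs through
  averages of \<open>2\<^sup>i\<close> signed unit vectors.  Such an average is halved by keeping one vector of each
  pair, and a random choice does this with all Fourier coefficients small (lemma \<open>grid_halving\<close>).
  There are of the order of \<open>ln s\<close> levels before the grid is fine enough to be a net, and each
  contributes \<open>sqrt s ln n\<close> (lemma \<open>mesh_entropy_product\<close>).  The weights in the chaining are again
  bounded by the chaos, and the resulting quadratic inequality shows that the mean deviation,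
  relative to \<open>m\<close>, is of the order of \<open>sqrt (s / m) ln s ln n\<close> (lemma \<open>ravg_deviation_le\<close>).  This is
  at most a small multiple of \<open>\<delta> \<eta>\<close> under the hypothesis on \<open>m\<close>, and Markov's inequality finishes
  the argument.
\<close>

section \<open>Averages over sign vectors\<close>

text \<open>
  Sign vectors vanish outside the index set, so that a sign vector on a disjoint union is the sum of
  its two restrictions; this is what makes conditioning on part of the signs a matter of addition.
\<close>
definition sign_vecs :: "'a set \<Rightarrow> ('a \<Rightarrow> real) set" where
  "sign_vecs I = PiE_dflt I 0 (\<lambda>_. {-1, 1})"

definition ravg :: "'a set \<Rightarrow> (('a \<Rightarrow> real) \<Rightarrow> real) \<Rightarrow> real" where
  "ravg I f = (\<Sum>\<epsilon>\<in>sign_vecs I. f \<epsilon>) / 2 ^ card I"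

lemma finite_sign_vecs [simp]: "finite I \<Longrightarrow> finite (sign_vecs I)"
  by (auto simp: sign_vecs_def)

lemma card_sign_vecs: "finite I \<Longrightarrow> card (sign_vecs I) = 2 ^ card I"
  by (simp add: sign_vecs_def card_PiE_dflt numeral_2_eq_2)

lemma sign_vecs_sq: "\<epsilon> \<in> sign_vecs I \<Longrightarrow> i \<in> I \<Longrightarrow> (\<epsilon> i)\<^sup>2 = 1"
  by (auto simp: sign_vecs_def PiE_dflt_def power2_eq_1_iff)

lemma sign_vecs_outside: "\<epsilon> \<in> sign_vecs I \<Longrightarrow> i \<notin> I \<Longrightarrow> \<epsilon> i = 0"
  by (auto simp: sign_vecs_def PiE_dflt_def)

lemma sign_vecs_cases: "\<epsilon> \<in> sign_vecs I \<Longrightarrow> i \<in> I \<Longrightarrow> \<epsilon> i = -1 \<or> \<epsilon> i = 1"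
  by (auto simp: sign_vecs_def PiE_dflt_def)

lemma sign_vecs_nonempty [simp]: "sign_vecs I \<noteq> {}"
  by (auto simp: sign_vecs_def)

lemma ravg_mono:
  assumes "\<And>\<epsilon>. \<epsilon> \<in> sign_vecs I \<Longrightarrow> f \<epsilon> \<le> g \<epsilon>"
  shows "ravg I f \<le> ravg I g"
  unfolding ravg_def by (intro divide_right_mono sum_mono assms) auto

lemma ravg_cong:
  assumes "\<And>\<epsilon>. \<epsilon> \<in> sign_vecs I \<Longrightarrow> f \<epsilon> = g \<epsilon>"
  shows "ravg I f = ravg I g"
  unfolding ravg_def by (simp cong: sum.cong add: assms)

lemma ravg_const [simp]: "finite I \<Longrightarrow> ravg I (\<lambda>_. c) = c"
  by (simp add: ravg_def card_sign_vecs)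

lemma ravg_add: "ravg I (\<lambda>\<epsilon>. f \<epsilon> + g \<epsilon>) = ravg I f + ravg I g"
  by (simp add: ravg_def sum.distrib add_divide_distrib)

lemma ravg_diff: "ravg I (\<lambda>\<epsilon>. f \<epsilon> - g \<epsilon>) = ravg I f - ravg I g"
  by (simp add: ravg_def sum_subtractf diff_divide_distrib)

lemma ravg_cmult: "ravg I (\<lambda>\<epsilon>. c * f \<epsilon>) = c * ravg I f"
  by (simp add: ravg_def sum_distrib_left)

lemma ravg_sum: "ravg I (\<lambda>\<epsilon>. \<Sum>j\<in>J. f j \<epsilon>) = (\<Sum>j\<in>J. ravg I (f j))"
  unfolding ravg_def sum_divide_distrib[symmetric] by (subst sum.swap) simp

lemma ravg_swap: "ravg I (\<lambda>\<epsilon>. ravg J (f \<epsilon>)) = ravg J (\<lambda>\<epsilon>'. ravg I (\<lambda>\<epsilon>. f \<epsilon> \<epsilon>'))"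
  unfolding ravg_def sum_divide_distrib[symmetric] by (subst sum.swap) (simp add: mult.commute)

lemma ravg_nonneg:
  assumes "\<And>\<epsilon>. \<epsilon> \<in> sign_vecs I \<Longrightarrow> f \<epsilon> \<ge> 0"
  shows "ravg I f \<ge> 0"
  unfolding ravg_def by (intro divide_nonneg_nonneg sum_nonneg assms) auto

lemma ravg_abs_le: "\<bar>ravg I f\<bar> \<le> ravg I (\<lambda>\<epsilon>. \<bar>f \<epsilon>\<bar>)"
  unfolding ravg_def by (simp add: divide_right_mono)

text \<open>
  The probabilistic method: some choice is at most the average.
\<close>
lemma ravg_exists_ge:
  assumes "finite I"
  obtains \<epsilon> where "\<epsilon> \<in> sign_vecs I" "f \<epsilon> \<le> ravg I f"
proof -
  have "\<exists>\<epsilon>\<in>sign_vecs I. f \<epsilon> \<le> ravg I f"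
  proof (rule ccontr)
    assume "\<not> ?thesis"
    then have "(\<Sum>\<epsilon>\<in>sign_vecs I. ravg I f) < (\<Sum>\<epsilon>\<in>sign_vecs I. f \<epsilon>)"
      using assms by (intro sum_strict_mono) (auto simp: not_le)
    then show False using assms by (simp add: card_sign_vecs ravg_def)
  qed
  then show ?thesis using that by blast
qed

text \<open>
  Jensen's inequality for the exponential, from its tangent at the mean.
\<close>
lemma exp_ravg_le:
  assumes "finite I"
  shows "exp (ravg I f) \<le> ravg I (\<lambda>\<epsilon>. exp (f \<epsilon>))"
proof -
  let ?\<mu> = "ravg I f"
  have "exp ?\<mu> = ravg I (\<lambda>\<epsilon>. exp ?\<mu> * (1 + (f \<epsilon> - ?\<mu>)))"
    unfolding ravg_cmult ravg_add ravg_diff using assms by simp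
  also have "\<dots> \<le> ravg I (\<lambda>\<epsilon>. exp (f \<epsilon>))"
  proof (rule ravg_mono)
    fix \<epsilon>
    have "exp ?\<mu> * (1 + (f \<epsilon> - ?\<mu>)) \<le> exp ?\<mu> * exp (f \<epsilon> - ?\<mu>)"
      by (intro mult_left_mono exp_ge_add_one_self) auto
    then show "exp ?\<mu> * (1 + (f \<epsilon> - ?\<mu>)) \<le> exp (f \<epsilon>)"
      by (simp flip: exp_add)
  qed
  finally show ?thesis .
qed

lemma ravg_square_le:
  assumes "finite I"
  shows "(ravg I f)\<^sup>2 \<le> ravg I (\<lambda>\<epsilon>. (f \<epsilon>)\<^sup>2)"
proof -
  let ?\<mu> = "ravg I f"
  have "0 \<le> ravg I (\<lambda>\<epsilon>. (f \<epsilon> - ?\<mu>)\<^sup>2)" by (rule ravg_nonneg) simp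
  also have "\<dots> = ravg I (\<lambda>\<epsilon>. (f \<epsilon>)\<^sup>2 - (2 * ?\<mu>) * f \<epsilon> + ?\<mu>\<^sup>2)"
    by (rule ravg_cong) (simp add: power2_diff)
  also have "\<dots> = ravg I (\<lambda>\<epsilon>. (f \<epsilon>)\<^sup>2) - ?\<mu>\<^sup>2"
    unfolding ravg_add ravg_diff ravg_cmult using assms by (simp add: power2_eq_square)
  finally show ?thesis by simp
qed

lemma ravg_markov:
  assumes "finite I" "t > 0" "\<And>\<epsilon>. \<epsilon> \<in> sign_vecs I \<Longrightarrow> f \<epsilon> \<ge> 0"
  shows "ravg I (\<lambda>\<epsilon>. of_bool (f \<epsilon> \<ge> t)) \<le> ravg I f / t"
proof -
  have "ravg I (\<lambda>\<epsilon>. of_bool (f \<epsilon> \<ge> t)) \<le> ravg I (\<lambda>\<epsilon>. (1 / t) * f \<epsilon>)"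
    using assms by (intro ravg_mono) (auto simp: field_simps)
  then show ?thesis unfolding ravg_cmult by simp
qed

lemma ravg_chernoff:
  assumes "l \<ge> 0"
  shows "ravg I (\<lambda>\<epsilon>. of_bool (f \<epsilon> \<ge> t)) \<le> exp (- (l * t)) * ravg I (\<lambda>\<epsilon>. exp (l * f \<epsilon>))"
proof -
  have "ravg I (\<lambda>\<epsilon>. of_bool (f \<epsilon> \<ge> t)) \<le> ravg I (\<lambda>\<epsilon>. exp (- (l * t)) * exp (l * f \<epsilon>))"
    by (intro ravg_mono) (auto simp flip: exp_add simp: assms mult_left_mono)
  then show ?thesis by (simp add: ravg_cmult)
qed

lemma sign_vecs_Un_bij:
  assumes "I \<inter> J = {}"
  shows "bij_betw (\<lambda>(\<alpha>, \<beta>) i. \<alpha> i + \<beta> i) (sign_vecs I \<times> sign_vecs J) (sign_vecs (I \<union> J))"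
proof (rule bij_betwI[where g = "\<lambda>\<epsilon>. (\<lambda>i. if i \<in> I then \<epsilon> i else 0, \<lambda>i. if i \<in> J then \<epsilon> i else 0)"])
  show "(\<lambda>(\<alpha>, \<beta>) i. \<alpha> i + \<beta> i) \<in> sign_vecs I \<times> sign_vecs J \<rightarrow> sign_vecs (I \<union> J)"
    using assms unfolding sign_vecs_def PiE_dflt_def by fastforce
  show "(\<lambda>\<epsilon>. (\<lambda>i. if i \<in> I then \<epsilon> i else 0, \<lambda>i. if i \<in> J then \<epsilon> i else 0))
      \<in> sign_vecs (I \<union> J) \<rightarrow> sign_vecs I \<times> sign_vecs J"
    unfolding sign_vecs_def PiE_dflt_def by auto
  fix \<epsilon> assume "\<epsilon> \<in> sign_vecs (I \<union> J)"
  then show "(\<lambda>(\<alpha>, \<beta>) i. \<alpha> i + \<beta> i) (\<lambda>i. if i \<in> I then \<epsilon> i else 0, \<lambda>i. if i \<in> J then \<epsilon> i else 0) = \<epsilon>"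
    using assms unfolding sign_vecs_def PiE_dflt_def by fastforce
next
  fix p assume p: "p \<in> sign_vecs I \<times> sign_vecs J"
  obtain \<alpha> \<beta> where [simp]: "p = (\<alpha>, \<beta>)" by (cases p)
  have "\<alpha> i = 0" if "i \<notin> I" for i using p that by (auto intro: sign_vecs_outside)
  moreover have "\<beta> i = 0" if "i \<notin> J" for i using p that by (auto intro: sign_vecs_outside)
  ultimately show "(\<lambda>i. if i \<in> I then (\<lambda>(\<alpha>, \<beta>) i. \<alpha> i + \<beta> i) p i else 0,
       \<lambda>i. if i \<in> J then (\<lambda>(\<alpha>, \<beta>) i. \<alpha> i + \<beta> i) p i else 0) = p"
    using assms by (auto simp: fun_eq_iff)
qed

lemma ravg_Un:
  assumes "finite I" "finite J" "I \<inter> J = {}"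
  shows "ravg (I \<union> J) f = ravg I (\<lambda>\<alpha>. ravg J (\<lambda>\<beta>. f (\<lambda>i. \<alpha> i + \<beta> i)))"
proof -
  have "(\<Sum>\<epsilon>\<in>sign_vecs (I \<union> J). f \<epsilon>)
      = (\<Sum>p\<in>sign_vecs I \<times> sign_vecs J. f ((\<lambda>(\<alpha>, \<beta>) i. \<alpha> i + \<beta> i) p))"
    by (rule sum.reindex_bij_betw[OF sign_vecs_Un_bij[OF assms(3)], symmetric])
  also have "\<dots> = (\<Sum>\<alpha>\<in>sign_vecs I. \<Sum>\<beta>\<in>sign_vecs J. f (\<lambda>i. \<alpha> i + \<beta> i))"
    by (simp add: sum.cartesian_product case_prod_unfold)
  finally show ?thesis using assms
    by (simp add: ravg_def card_Un_disjoint power_add sum_divide_distrib[symmetric] mult.commute)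
qed

text \<open>
  Fubini: the signs in \<open>S\<close> are independent of those outside.
\<close>
lemma ravg_split:
  assumes "finite I" "S \<subseteq> I"
  shows "ravg I f = ravg S (\<lambda>\<alpha>. ravg (I - S) (\<lambda>\<beta>. f (\<lambda>i. \<alpha> i + \<beta> i)))"
  using ravg_Un[of S "I - S" f] assms finite_subset[of S I] by (simp add: Un_absorb1)

lemma sign_vecs_singleton: "sign_vecs {i} = {(\<lambda>j. if j = i then -1 else 0), (\<lambda>j. if j = i then 1 else 0)}"
  unfolding sign_vecs_def PiE_dflt_def by (auto simp: fun_eq_iff) metis+

lemma ravg_singleton: "ravg {i} f = (f (\<lambda>j. if j = i then -1 else 0) + f (\<lambda>j. if j = i then 1 else 0)) / 2"
proof -
  have "(\<lambda>j. if j = i then -1 else 0) \<noteq> (\<lambda>j. if j = i then 1 else (0::real))"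
    by (auto simp: fun_eq_iff)
  then show ?thesis by (simp add: ravg_def sign_vecs_singleton)
qed

text \<open>
  A symmetric sign is the case \<open>p = 1/2\<close> of Hoeffding's lemma.
\<close>
lemma cosh_le_exp: "(exp (-x) + exp x) / 2 \<le> exp (x\<^sup>2 / 2)" for x :: real
proof -
  have *: "(exp (-x) + exp x) / 2 \<le> exp (x\<^sup>2 / 2)" if "x \<ge> 0" for x :: real
  proof -
    have "- x + ln (1 + (exp (2 * x) - 1) / 2) \<le> x\<^sup>2 / 2"
      using Hoeffdings_lemma_aux[of "2 * x" "1/2"] that by (simp add: power2_eq_square)
    then have "ln (1 + (exp (2 * x) - 1) / 2) \<le> x\<^sup>2 / 2 + x" by simp
    moreover have "1 + (exp (2 * x) - 1) / 2 > 0" by (simp add: field_simps add_pos_pos)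
    ultimately have "1 + (exp (2 * x) - 1) / 2 \<le> exp (x\<^sup>2 / 2 + x)"
      by (metis exp_ln exp_le_cancel_iff)
    then have "exp (-x) * (1 + (exp (2 * x) - 1) / 2) \<le> exp (-x) * exp (x\<^sup>2 / 2 + x)"
      by (intro mult_left_mono) auto
    then show ?thesis by (simp add: algebra_simps flip: exp_add) (simp add: field_simps)
  qed
  show ?thesis using *[of x] *[of "-x"] by (cases "x \<ge> 0") (auto simp: add.commute)
qed

text \<open>
  A Rademacher sum is subgaussian with variance proxy the sum of the squared coefficients.
\<close>
lemma ravg_mgf:
  assumes "finite I"
  shows "ravg I (\<lambda>\<epsilon>. exp (\<Sum>i\<in>I. a i * \<epsilon> i)) \<le> exp ((\<Sum>i\<in>I. (a i)\<^sup>2) / 2)"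
  using assms
proof (induction I)
  case empty
  then show ?case by simp
next
  case (insert k I)
  have "ravg (insert k I) (\<lambda>\<epsilon>. exp (\<Sum>i\<in>insert k I. a i * \<epsilon> i))
      = ravg {k} (\<lambda>\<alpha>. ravg I (\<lambda>\<beta>. exp (\<Sum>i\<in>insert k I. a i * (\<alpha> i + \<beta> i))))"
    using ravg_Un[of "{k}" I] insert by simp
  also have "\<dots> = ravg {k} (\<lambda>\<alpha>. ravg I (\<lambda>\<beta>. exp (a k * \<alpha> k) * exp (\<Sum>i\<in>I. a i * \<beta> i)))"
  proof (intro ravg_cong)
    fix \<alpha> \<beta> assume "\<alpha> \<in> sign_vecs {k}" "\<beta> \<in> sign_vecs I"
    then have "\<beta> k = 0" "\<And>i. i \<in> I \<Longrightarrow> \<alpha> i = 0" using insert by (auto intro: sign_vecs_outside)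
    then show "exp (\<Sum>i\<in>insert k I. a i * (\<alpha> i + \<beta> i)) = exp (a k * \<alpha> k) * exp (\<Sum>i\<in>I. a i * \<beta> i)"
      using insert by (simp add: exp_add)
  qed
  also have "\<dots> = (exp (- a k) + exp (a k)) / 2 * ravg I (\<lambda>\<beta>. exp (\<Sum>i\<in>I. a i * \<beta> i))"
    by (simp add: ravg_cmult ravg_singleton algebra_simps)
  also have "\<dots> \<le> exp ((a k)\<^sup>2 / 2) * exp ((\<Sum>i\<in>I. (a i)\<^sup>2) / 2)"
    using insert by (intro mult_mono cosh_le_exp ravg_nonneg) auto
  also have "\<dots> = exp ((\<Sum>i\<in>insert k I. (a i)\<^sup>2) / 2)"
    using insert by (simp add: add_divide_distrib exp_add)
  finally show ?case .
qed

text \<open>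
  The maximal inequality behind every step of the chaining.  Exponentiating with parameter \<open>t\<close> turns
  the maximum into a sum over \<open>J\<close> and the two signs, so the average of the maximum is at most \<open>ln (2
  |J|) / t + t \<sigma>\<^sup>2 / 2\<close>; the \<open>t\<close> chosen in the proof is the minimiser.
\<close>
lemma ravg_Max_le:
  fixes a :: "'j \<Rightarrow> 'i \<Rightarrow> real"
  assumes I: "finite I" and J: "finite J" "J \<noteq> {}" and "\<sigma> \<ge> 0"
    and a: "\<And>j. j \<in> J \<Longrightarrow> (\<Sum>i\<in>I. (a j i)\<^sup>2) \<le> \<sigma>\<^sup>2"
  shows "ravg I (\<lambda>\<epsilon>. Max ((\<lambda>j. \<bar>\<Sum>i\<in>I. a j i * \<epsilon> i\<bar>) ` J)) \<le> \<sigma> * sqrt (2 * ln (2 * real (card J)))"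
    (is "ravg I ?M \<le> _")
proof (cases "\<sigma> = 0")
  case True
  have "a j i = 0" if "j \<in> J" "i \<in> I" for i j
  proof -
    have "(\<Sum>i\<in>I. (a j i)\<^sup>2) = 0" using a[OF that(1)] True by (simp add: sum_nonneg order_antisym)
    then show ?thesis using that I by (simp add: sum_nonneg_eq_0_iff)
  qed
  then have "(\<lambda>j. \<bar>\<Sum>i\<in>I. a j i * \<epsilon> i\<bar>) ` J = {0}" for \<epsilon>
    using J by (auto simp: image_iff)
  then show ?thesis using True I by simp
next
  case False
  then have \<sigma>: "\<sigma> > 0" using assms by simp
  have cJ: "card J \<ge> 1" using J by (simp add: Suc_le_eq card_gt_0_iff)
  define L where "L = ln (2 * real (card J))"
  have "L > 0" unfolding L_def using cJ by (intro ln_gt_zero) linarith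
  define t where "t = sqrt (2 * L) / \<sigma>"
  have t: "t > 0" using \<open>L > 0\<close> \<sigma> by (simp add: t_def)
  have "exp (t * ravg I ?M) \<le> ravg I (\<lambda>\<epsilon>. exp (t * ?M \<epsilon>))"
    using exp_ravg_le[OF I, of "\<lambda>\<epsilon>. t * ?M \<epsilon>"] by (simp add: ravg_cmult)
  also have "\<dots> \<le> ravg I (\<lambda>\<epsilon>. \<Sum>j\<in>J. exp (\<Sum>i\<in>I. (t * a j i) * \<epsilon> i) + exp (\<Sum>i\<in>I. (- t * a j i) * \<epsilon> i))"
  proof (rule ravg_mono)
    fix \<epsilon>
    have "?M \<epsilon> \<in> (\<lambda>j. \<bar>\<Sum>i\<in>I. a j i * \<epsilon> i\<bar>) ` J"
      using J by (intro Max_in) auto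
    then obtain j where j: "j \<in> J" "?M \<epsilon> = \<bar>\<Sum>i\<in>I. a j i * \<epsilon> i\<bar>" by auto
    have "exp (t * ?M \<epsilon>) \<le> exp (t * (\<Sum>i\<in>I. a j i * \<epsilon> i)) + exp (- t * (\<Sum>i\<in>I. a j i * \<epsilon> i))"
      unfolding j(2) by (cases "(\<Sum>i\<in>I. a j i * \<epsilon> i) \<ge> 0") (auto intro: add_increasing add_increasing2)
    also have "\<dots> = exp (\<Sum>i\<in>I. (t * a j i) * \<epsilon> i) + exp (\<Sum>i\<in>I. (- t * a j i) * \<epsilon> i)"
      by (simp add: sum_distrib_left mult.assoc)
    also have "\<dots> \<le> (\<Sum>j\<in>J. exp (\<Sum>i\<in>I. (t * a j i) * \<epsilon> i) + exp (\<Sum>i\<in>I. (- t * a j i) * \<epsilon> i))"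
      using j(1) J by (intro member_le_sum) auto
    finally show "exp (t * ?M \<epsilon>) \<le> \<dots>" .
  qed
  also have "\<dots> = (\<Sum>j\<in>J. ravg I (\<lambda>\<epsilon>. exp (\<Sum>i\<in>I. (t * a j i) * \<epsilon> i))
        + ravg I (\<lambda>\<epsilon>. exp (\<Sum>i\<in>I. (- t * a j i) * \<epsilon> i)))"
    by (simp add: ravg_sum ravg_add)
  also have "\<dots> \<le> (\<Sum>j\<in>J. 2 * exp (t\<^sup>2 * \<sigma>\<^sup>2 / 2))"
  proof (rule sum_mono)
    fix j assume j: "j \<in> J"
    have "(\<Sum>i\<in>I. (t * a j i)\<^sup>2) \<le> t\<^sup>2 * \<sigma>\<^sup>2" "(\<Sum>i\<in>I. (- t * a j i)\<^sup>2) \<le> t\<^sup>2 * \<sigma>\<^sup>2"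
      using a[OF j] by (simp_all add: power_mult_distrib mult_left_mono flip: sum_distrib_left)
    then have "exp ((\<Sum>i\<in>I. (t * a j i)\<^sup>2) / 2) \<le> exp (t\<^sup>2 * \<sigma>\<^sup>2 / 2)"
      "exp ((\<Sum>i\<in>I. (- t * a j i)\<^sup>2) / 2) \<le> exp (t\<^sup>2 * \<sigma>\<^sup>2 / 2)" by simp_all
    then show "ravg I (\<lambda>\<epsilon>. exp (\<Sum>i\<in>I. (t * a j i) * \<epsilon> i))
        + ravg I (\<lambda>\<epsilon>. exp (\<Sum>i\<in>I. (- t * a j i) * \<epsilon> i)) \<le> 2 * exp (t\<^sup>2 * \<sigma>\<^sup>2 / 2)"
      using ravg_mgf[OF I, of "\<lambda>i. t * a j i"] ravg_mgf[OF I, of "\<lambda>i. - t * a j i"] by linarith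
  qed
  also have "\<dots> = exp (L + t\<^sup>2 * \<sigma>\<^sup>2 / 2)"
    using cJ by (simp add: exp_add L_def)
  finally have "t * ravg I ?M \<le> L + t\<^sup>2 * \<sigma>\<^sup>2 / 2" by simp
  also have "\<dots> = t * (\<sigma> * sqrt (2 * L))"
    using \<sigma> \<open>L > 0\<close> by (simp add: t_def power_divide field_simps)
  finally show ?thesis using t by (simp add: L_def)
qed

section \<open>Decoupling and exponential moments of Rademacher chaos\<close>

lemma ravg_coord:
  assumes "finite I" "k \<in> I"
  shows "ravg I (\<lambda>\<epsilon>. \<epsilon> k) = 0"
proof -
  have "ravg I (\<lambda>\<epsilon>. \<epsilon> k) = ravg {k} (\<lambda>\<alpha>. ravg (I - {k}) (\<lambda>\<beta>. \<alpha> k + \<beta> k))"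
    using assms by (intro ravg_split) auto
  also have "\<dots> = ravg {k} (\<lambda>\<alpha>. ravg (I - {k}) (\<lambda>\<beta>. \<alpha> k))"
    by (intro ravg_cong) (auto simp: sign_vecs_outside)
  also have "\<dots> = 0" using assms by (simp add: ravg_singleton)
  finally show ?thesis .
qed

lemma ravg_coord_mult:
  assumes "finite I" "k \<in> I" "l \<in> I"
  shows "ravg I (\<lambda>\<epsilon>. \<epsilon> k * \<epsilon> l) = of_bool (k = l)"
proof (cases "k = l")
  case True
  have "ravg I (\<lambda>\<epsilon>. \<epsilon> k * \<epsilon> l) = ravg I (\<lambda>\<epsilon>. 1)"
    using True assms sign_vecs_sq by (intro ravg_cong) (auto simp: power2_eq_square)
  then show ?thesis using True assms by simp
next
  case False
  have "ravg I (\<lambda>\<epsilon>. \<epsilon> k * \<epsilon> l) = ravg {k} (\<lambda>\<alpha>. ravg (I - {k}) (\<lambda>\<beta>. (\<alpha> k + \<beta> k) * (\<alpha> l + \<beta> l)))"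
    using assms by (intro ravg_split) auto
  also have "\<dots> = ravg {k} (\<lambda>\<alpha>. ravg (I - {k}) (\<lambda>\<beta>. \<alpha> k * \<beta> l))"
    using False by (intro ravg_cong) (auto simp: sign_vecs_outside)
  also have "\<dots> = 0" by (simp add: ravg_singleton ravg_cmult)
  finally show ?thesis using False by simp
qed

text \<open>
  A random set \<open>S\<close> that contains each index with probability one half contains \<open>k\<close> and misses \<open>l\<close>
  with probability 1/4 if \<open>k \<noteq> l\<close> and never if \<open>k = l\<close>.  Hence the off-diagonal part of a quadratic
  form is an average of forms that pair the signs in \<open>S\<close> with the independent signs outside \<open>S\<close>;
  these are linear once one of the two groups is fixed.
\<close>
lemma offdiag_eq_ravg:
  assumes "finite I"
  shows "(\<Sum>k\<in>I. \<Sum>l\<in>I - {k}. c k l)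
    = ravg I (\<lambda>\<tau>. 4 * (\<Sum>k\<in>{k\<in>I. \<tau> k = 1}. \<Sum>l\<in>I - {k\<in>I. \<tau> k = 1}. c k l))"
proof -
  have "ravg I (\<lambda>\<tau>. (1 + \<tau> k) * (1 - \<tau> l) * c k l) = of_bool (k \<noteq> l) * c k l"
    if "k \<in> I" "l \<in> I" for k l
  proof -
    have "ravg I (\<lambda>\<tau>. (1 + \<tau> k) * (1 - \<tau> l) * c k l)
        = ravg I (\<lambda>\<tau>. c k l * (1 + \<tau> k - \<tau> l - \<tau> k * \<tau> l))"
      by (rule ravg_cong) (simp add: algebra_simps)
    also have "\<dots> = of_bool (k \<noteq> l) * c k l"
      unfolding ravg_cmult ravg_add ravg_diff using assms that
      by (simp add: ravg_coord ravg_coord_mult)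
    finally show ?thesis .
  qed
  then have "(\<Sum>k\<in>I. \<Sum>l\<in>I. of_bool (k \<noteq> l) * c k l)
      = ravg I (\<lambda>\<tau>. \<Sum>k\<in>I. \<Sum>l\<in>I. (1 + \<tau> k) * (1 - \<tau> l) * c k l)"
    unfolding ravg_sum by (simp cong: sum.cong)
  moreover have "(\<Sum>l\<in>I. of_bool (k \<noteq> l) * c k l) = (\<Sum>l\<in>I - {k}. c k l)" for k
    using assms by (intro sum.mono_neutral_cong_right) auto
  moreover have "(\<Sum>k\<in>I. \<Sum>l\<in>I. (1 + \<tau> k) * (1 - \<tau> l) * c k l)
      = 4 * (\<Sum>k\<in>{k\<in>I. \<tau> k = 1}. \<Sum>l\<in>I - {k\<in>I. \<tau> k = 1}. c k l)" if "\<tau> \<in> sign_vecs I" for \<tau>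
  proof -
    have "(\<Sum>k\<in>I. \<Sum>l\<in>I. (1 + \<tau> k) * (1 - \<tau> l) * c k l)
        = (\<Sum>k\<in>{k\<in>I. \<tau> k = 1}. \<Sum>l\<in>I - {k\<in>I. \<tau> k = 1}. 4 * c k l)"
    proof (rule sum.mono_neutral_cong_right[OF assms])
      show "\<forall>k\<in>I - {k \<in> I. \<tau> k = 1}. (\<Sum>l\<in>I. (1 + \<tau> k) * (1 - \<tau> l) * c k l) = 0"
        using sign_vecs_cases[OF that] by fastforce
      fix k assume k: "k \<in> {k \<in> I. \<tau> k = 1}"
      show "(\<Sum>l\<in>I. (1 + \<tau> k) * (1 - \<tau> l) * c k l) = (\<Sum>l\<in>I - {k\<in>I. \<tau> k = 1}. 4 * c k l)"
        using k sign_vecs_cases[OF that] assms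
        by (intro sum.mono_neutral_cong_right) (auto, fastforce+)
    qed auto
    then show ?thesis by (simp add: sum_distrib_left)
  qed
  ultimately show ?thesis by (simp cong: ravg_cong)
qed

text \<open>
  The factor 4 is the price of decoupling, and it survives under any convex functional, here the
  supremum of absolute values.
\<close>
lemma decoupling_Max:
  fixes c :: "'x \<Rightarrow> 'i \<Rightarrow> 'i \<Rightarrow> real"
  assumes I: "finite I" and X: "finite X" "X \<noteq> {}"
    and bound: "\<And>S. S \<subseteq> I \<Longrightarrow>
      ravg I (\<lambda>\<epsilon>. Max ((\<lambda>x. \<bar>\<Sum>k\<in>S. \<Sum>l\<in>I - S. c x k l * \<epsilon> k * \<epsilon> l\<bar>) ` X)) \<le> b"
  shows "ravg I (\<lambda>\<epsilon>. Max ((\<lambda>x. \<bar>\<Sum>k\<in>I. \<Sum>l\<in>I - {k}. c x k l * \<epsilon> k * \<epsilon> l\<bar>) ` X)) \<le> 4 * b"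
proof -
  define D where "D \<tau> \<epsilon> x = (\<Sum>k\<in>{k\<in>I. \<tau> k = 1}. \<Sum>l\<in>I - {k\<in>I. \<tau> k = 1}. c x k l * \<epsilon> k * \<epsilon> l)"
    for \<tau> \<epsilon> :: "'i \<Rightarrow> real" and x
  have "ravg I (\<lambda>\<epsilon>. Max ((\<lambda>x. \<bar>\<Sum>k\<in>I. \<Sum>l\<in>I - {k}. c x k l * \<epsilon> k * \<epsilon> l\<bar>) ` X))
      \<le> ravg I (\<lambda>\<epsilon>. ravg I (\<lambda>\<tau>. 4 * Max ((\<lambda>x. \<bar>D \<tau> \<epsilon> x\<bar>) ` X)))"
  proof (rule ravg_mono)
    fix \<epsilon>
    have "\<bar>\<Sum>k\<in>I. \<Sum>l\<in>I - {k}. c x k l * \<epsilon> k * \<epsilon> l\<bar>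
        \<le> ravg I (\<lambda>\<tau>. 4 * Max ((\<lambda>x. \<bar>D \<tau> \<epsilon> x\<bar>) ` X))" if "x \<in> X" for x
    proof -
      have "\<bar>\<Sum>k\<in>I. \<Sum>l\<in>I - {k}. c x k l * \<epsilon> k * \<epsilon> l\<bar> = \<bar>ravg I (\<lambda>\<tau>. 4 * D \<tau> \<epsilon> x)\<bar>"
        unfolding D_def by (subst offdiag_eq_ravg[OF I]) simp
      also have "\<dots> \<le> ravg I (\<lambda>\<tau>. \<bar>4 * D \<tau> \<epsilon> x\<bar>)" by (rule ravg_abs_le)
      also have "\<dots> \<le> ravg I (\<lambda>\<tau>. 4 * Max ((\<lambda>x. \<bar>D \<tau> \<epsilon> x\<bar>) ` X))"
        using X that by (intro ravg_mono) (auto simp: abs_mult intro!: Max_ge)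
      finally show ?thesis .
    qed
    then show "Max ((\<lambda>x. \<bar>\<Sum>k\<in>I. \<Sum>l\<in>I - {k}. c x k l * \<epsilon> k * \<epsilon> l\<bar>) ` X)
        \<le> ravg I (\<lambda>\<tau>. 4 * Max ((\<lambda>x. \<bar>D \<tau> \<epsilon> x\<bar>) ` X))"
      using X by (subst Max_le_iff) auto
  qed
  also have "\<dots> = ravg I (\<lambda>\<tau>. 4 * ravg I (\<lambda>\<epsilon>. Max ((\<lambda>x. \<bar>D \<tau> \<epsilon> x\<bar>) ` X)))"
    by (subst ravg_swap) (simp add: ravg_cmult)
  also have "\<dots> \<le> ravg I (\<lambda>\<tau>. 4 * b)"
    unfolding D_def by (intro ravg_mono mult_left_mono bound) auto
  finally show ?thesis using I by simp
qed

text \<open>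
  After decoupling, the form is linear in the signs of \<open>S\<close>, and the subgaussian bound replaces it by
  half the squared norm of its coefficients.  The constant is \<open>(4 t)\<^sup>2 / 2\<close>.
\<close>
lemma exp_chaos_le_exp_square:
  assumes I: "finite I"
  shows "ravg I (\<lambda>\<epsilon>. exp (t * (\<Sum>k\<in>I. \<Sum>l\<in>I - {k}. C k l * \<epsilon> k * \<epsilon> l)))
    \<le> ravg I (\<lambda>\<epsilon>. exp (8 * t\<^sup>2 * (\<Sum>k\<in>I. (\<Sum>l\<in>I. C k l * \<epsilon> l)\<^sup>2)))"
proof -
  define D where "D S \<epsilon> = (\<Sum>k\<in>S. \<Sum>l\<in>I - S. C k l * \<epsilon> k * \<epsilon> l)" for S \<epsilon>
  define N where "N \<epsilon> = (\<Sum>k\<in>I. (\<Sum>l\<in>I. C k l * \<epsilon> l)\<^sup>2)" for \<epsilon>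
  have split: "ravg I (\<lambda>\<epsilon>. exp (4 * t * D S \<epsilon>)) \<le> ravg I (\<lambda>\<epsilon>. exp (8 * t\<^sup>2 * N \<epsilon>))" if S: "S \<subseteq> I" for S
  proof -
    have fin: "finite S" "finite (I - S)" using S I finite_subset by auto
    define w where "w \<beta> k = (\<Sum>l\<in>I - S. C k l * \<beta> l)" for \<beta> k
    have "ravg I (\<lambda>\<epsilon>. exp (4 * t * D S \<epsilon>))
        = ravg S (\<lambda>\<alpha>. ravg (I - S) (\<lambda>\<beta>. exp (4 * t * D S (\<lambda>i. \<alpha> i + \<beta> i))))"
      by (rule ravg_split[OF I S])
    also have "\<dots> = ravg S (\<lambda>\<alpha>. ravg (I - S) (\<lambda>\<beta>. exp (\<Sum>k\<in>S. (4 * t * w \<beta> k) * \<alpha> k)))"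
    proof (intro ravg_cong)
      fix \<alpha> \<beta> assume "\<alpha> \<in> sign_vecs S" "\<beta> \<in> sign_vecs (I - S)"
      then have "\<alpha> l = 0" if "l \<in> I - S" for l using that by (auto intro: sign_vecs_outside)
      moreover have "\<beta> k = 0" if "k \<in> S" for k
        using that \<open>\<beta> \<in> _\<close> by (auto intro: sign_vecs_outside)
      ultimately have "D S (\<lambda>i. \<alpha> i + \<beta> i) = (\<Sum>k\<in>S. w \<beta> k * \<alpha> k)"
        unfolding D_def w_def sum_distrib_right by (intro sum.cong refl) simp
      then show "exp (4 * t * D S (\<lambda>i. \<alpha> i + \<beta> i)) = exp (\<Sum>k\<in>S. (4 * t * w \<beta> k) * \<alpha> k)"
        by (simp only: mult.assoc flip: sum_distrib_left)
    qed
    also have "\<dots> = ravg (I - S) (\<lambda>\<beta>. ravg S (\<lambda>\<alpha>. exp (\<Sum>k\<in>S. (4 * t * w \<beta> k) * \<alpha> k)))"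
      by (rule ravg_swap)
    also have "\<dots> \<le> ravg (I - S) (\<lambda>\<beta>. ravg S (\<lambda>\<alpha>. exp (8 * t\<^sup>2 * N (\<lambda>i. \<alpha> i + \<beta> i))))"
    proof (rule ravg_mono)
      fix \<beta> assume \<beta>: "\<beta> \<in> sign_vecs (I - S)"
      have \<beta>0: "\<beta> k = 0" if "k \<in> S" for k using that \<beta> by (auto intro: sign_vecs_outside)
      \<comment> \<open>Restoring the signs in \<open>S\<close> only increases the mean square: \<open>w \<beta>\<close> is the average of the full
        image over these signs, and squaring is convex.\<close>
      have mean: "ravg S (\<lambda>\<alpha>. \<Sum>l\<in>I. C k l * (\<alpha> l + \<beta> l)) = w \<beta> k" for k
      proof -
        have "ravg S (\<lambda>\<alpha>. C k l * (\<alpha> l + \<beta> l)) = C k l * \<beta> l" for l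
        proof (cases "l \<in> S")
          case True
          then show ?thesis using fin by (simp add: ravg_cmult ravg_add ravg_coord)
        next
          case False
          then have "ravg S (\<lambda>\<alpha>. C k l * (\<alpha> l + \<beta> l)) = ravg S (\<lambda>\<alpha>. C k l * \<beta> l)"
            by (intro ravg_cong) (simp add: sign_vecs_outside)
          then show ?thesis using fin by simp
        qed
        then have "ravg S (\<lambda>\<alpha>. \<Sum>l\<in>I. C k l * (\<alpha> l + \<beta> l)) = (\<Sum>l\<in>I. C k l * \<beta> l)"
          by (simp add: ravg_sum)
        also have "\<dots> = w \<beta> k"
          unfolding w_def using I \<beta>0 by (intro sum.mono_neutral_right) auto
        finally show ?thesis .
      qed
      have mgf: "ravg S (\<lambda>\<alpha>. exp (\<Sum>k\<in>S. (4 * t * w \<beta> k) * \<alpha> k)) \<le> exp ((\<Sum>k\<in>S. (4 * t * w \<beta> k)\<^sup>2) / 2)"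
        by (rule ravg_mgf[OF fin(1)])
      have "(\<Sum>k\<in>S. (4 * t * w \<beta> k)\<^sup>2) / 2 = (\<Sum>k\<in>S. 8 * t\<^sup>2 * (w \<beta> k)\<^sup>2)"
        unfolding sum_divide_distrib by (intro sum.cong refl) (simp add: power_mult_distrib)
      also have "\<dots> \<le> (\<Sum>k\<in>I. 8 * t\<^sup>2 * (w \<beta> k)\<^sup>2)"
        by (intro sum_mono2 I S) auto
      also have "\<dots> \<le> (\<Sum>k\<in>I. 8 * t\<^sup>2 * ravg S (\<lambda>\<alpha>. (\<Sum>l\<in>I. C k l * (\<alpha> l + \<beta> l))\<^sup>2))"
        unfolding mean[symmetric] by (intro mult_left_mono sum_mono ravg_square_le fin) auto
      also have "\<dots> = ravg S (\<lambda>\<alpha>. 8 * t\<^sup>2 * N (\<lambda>i. \<alpha> i + \<beta> i))"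
        unfolding N_def ravg_cmult ravg_sum sum_distrib_left ..
      finally have "exp ((\<Sum>k\<in>S. (4 * t * w \<beta> k)\<^sup>2) / 2) \<le> exp (ravg S (\<lambda>\<alpha>. 8 * t\<^sup>2 * N (\<lambda>i. \<alpha> i + \<beta> i)))"
        by simp
      also have "\<dots> \<le> ravg S (\<lambda>\<alpha>. exp (8 * t\<^sup>2 * N (\<lambda>i. \<alpha> i + \<beta> i)))"
        by (rule exp_ravg_le[OF fin(1)])
      finally show "ravg S (\<lambda>\<alpha>. exp (\<Sum>k\<in>S. (4 * t * w \<beta> k) * \<alpha> k))
          \<le> ravg S (\<lambda>\<alpha>. exp (8 * t\<^sup>2 * N (\<lambda>i. \<alpha> i + \<beta> i)))"
        using mgf by (rule order_trans[rotated])
    qed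
    also have "\<dots> = ravg I (\<lambda>\<epsilon>. exp (8 * t\<^sup>2 * N \<epsilon>))"
      by (subst ravg_swap) (rule ravg_split[OF I S, symmetric])
    finally show ?thesis .
  qed
  have "ravg I (\<lambda>\<epsilon>. exp (t * (\<Sum>k\<in>I. \<Sum>l\<in>I - {k}. C k l * \<epsilon> k * \<epsilon> l)))
      \<le> ravg I (\<lambda>\<epsilon>. ravg I (\<lambda>\<tau>. exp (4 * t * D {k\<in>I. \<tau> k = 1} \<epsilon>)))"
  proof (rule ravg_mono)
    fix \<epsilon>
    have "ravg I (\<lambda>\<tau>. 4 * t * D {k\<in>I. \<tau> k = 1} \<epsilon>) = t * ravg I (\<lambda>\<tau>. 4 * D {k\<in>I. \<tau> k = 1} \<epsilon>)"
      unfolding ravg_cmult[symmetric] by (simp only: mult_ac)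
    also have "ravg I (\<lambda>\<tau>. 4 * D {k\<in>I. \<tau> k = 1} \<epsilon>) = (\<Sum>k\<in>I. \<Sum>l\<in>I - {k}. C k l * \<epsilon> k * \<epsilon> l)"
      unfolding D_def by (rule offdiag_eq_ravg[OF I, symmetric])
    finally have "t * (\<Sum>k\<in>I. \<Sum>l\<in>I - {k}. C k l * \<epsilon> k * \<epsilon> l)
        = ravg I (\<lambda>\<tau>. 4 * t * D {k\<in>I. \<tau> k = 1} \<epsilon>)" by simp
    then show "exp (t * (\<Sum>k\<in>I. \<Sum>l\<in>I - {k}. C k l * \<epsilon> k * \<epsilon> l))
      \<le> ravg I (\<lambda>\<tau>. exp (4 * t * D {k\<in>I. \<tau> k = 1} \<epsilon>))"
      using exp_ravg_le[OF I, of "\<lambda>\<tau>. 4 * t * D {k\<in>I. \<tau> k = 1} \<epsilon>"] by simp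
  qed
  also have "\<dots> = ravg I (\<lambda>\<tau>. ravg I (\<lambda>\<epsilon>. exp (4 * t * D {k\<in>I. \<tau> k = 1} \<epsilon>)))"
    by (rule ravg_swap)
  also have "\<dots> \<le> ravg I (\<lambda>\<tau>. ravg I (\<lambda>\<epsilon>. exp (8 * t\<^sup>2 * N \<epsilon>)))" by (intro ravg_mono split) auto
  finally show ?thesis using I by (simp add: N_def)
qed

text \<open>
  An elementary substitute for the usual comparison with Gaussian vectors.  Let \<open>F\<close> be the left-hand
  side.  The square \<open>|C \<epsilon>|\<^sup>2\<close> is its mean \<open>h\<close> plus an off-diagonal form with matrix \<open>B = C\<^sup>T C\<close>.
  The preceding lemma bounds the exponential moment of that form by the one of \<open>8 a\<^sup>2 |B \<epsilon>|\<^sup>2\<close>, and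
  \<open>|B \<epsilon>| \<le> \<kappa> |C \<epsilon>|\<close>.  For small \<open>a\<close> this is at most half of \<open>a |C \<epsilon>|\<^sup>2\<close>, so \<open>F \<le> exp (a h) sqrt F\<close>,
  which can be solved for \<open>F\<close>.
\<close>
lemma exp_square_norm_le:
  assumes I: "finite I" and a: "a \<ge> 0" "16 * a * \<kappa>\<^sup>2 \<le> 1"
    and op: "\<And>v. (\<Sum>k\<in>I. (\<Sum>i\<in>I. C i k * v i)\<^sup>2) \<le> \<kappa>\<^sup>2 * (\<Sum>i\<in>I. (v i)\<^sup>2)"
  shows "ravg I (\<lambda>\<epsilon>. exp (a * (\<Sum>i\<in>I. (\<Sum>l\<in>I. C i l * \<epsilon> l)\<^sup>2)))
    \<le> exp (2 * a * (\<Sum>i\<in>I. \<Sum>l\<in>I. (C i l)\<^sup>2))"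
proof -
  define N where "N \<epsilon> = (\<Sum>i\<in>I. (\<Sum>l\<in>I. C i l * \<epsilon> l)\<^sup>2)" for \<epsilon>
  define B where "B k l = (\<Sum>i\<in>I. C i k * C i l)" for k l
  define h where "h = (\<Sum>i\<in>I. \<Sum>l\<in>I. (C i l)\<^sup>2)"
  define F where "F = ravg I (\<lambda>\<epsilon>. exp (a * N \<epsilon>))"
  have "F > 0"
    unfolding F_def ravg_def using I by (intro divide_pos_pos sum_pos) auto
  have N_eq: "N \<epsilon> = h + (\<Sum>k\<in>I. \<Sum>l\<in>I - {k}. B k l * \<epsilon> k * \<epsilon> l)" if \<epsilon>: "\<epsilon> \<in> sign_vecs I" for \<epsilon>
  proof -
    have "N \<epsilon> = (\<Sum>i\<in>I. \<Sum>k\<in>I. \<Sum>l\<in>I. C i k * C i l * \<epsilon> k * \<epsilon> l)"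
      unfolding N_def power2_eq_square sum_product by (simp add: mult_ac)
    also have "\<dots> = (\<Sum>k\<in>I. \<Sum>i\<in>I. \<Sum>l\<in>I. C i k * C i l * \<epsilon> k * \<epsilon> l)"
      by (rule sum.swap)
    also have "\<dots> = (\<Sum>k\<in>I. \<Sum>l\<in>I. \<Sum>i\<in>I. C i k * C i l * \<epsilon> k * \<epsilon> l)"
      by (intro sum.cong refl sum.swap)
    also have "\<dots> = (\<Sum>k\<in>I. \<Sum>l\<in>I. B k l * \<epsilon> k * \<epsilon> l)"
      by (simp add: B_def sum_distrib_right)
    also have "\<dots> = (\<Sum>k\<in>I. B k k * \<epsilon> k * \<epsilon> k + (\<Sum>l\<in>I - {k}. B k l * \<epsilon> k * \<epsilon> l))"
      using I by (intro sum.cong refl sum.remove)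
    also have "\<dots> = (\<Sum>k\<in>I. B k k) + (\<Sum>k\<in>I. \<Sum>l\<in>I - {k}. B k l * \<epsilon> k * \<epsilon> l)"
      using sign_vecs_sq[OF \<epsilon>] by (simp add: sum.distrib mult.assoc flip: power2_eq_square)
    also have "(\<Sum>k\<in>I. B k k) = h"
      unfolding B_def h_def by (subst sum.swap) (simp add: power2_eq_square)
    finally show ?thesis .
  qed
  have "F = exp (a * h) * ravg I (\<lambda>\<epsilon>. exp (a * (\<Sum>k\<in>I. \<Sum>l\<in>I - {k}. B k l * \<epsilon> k * \<epsilon> l)))"
    unfolding F_def ravg_cmult[symmetric]
    by (intro ravg_cong) (simp add: N_eq distrib_left exp_add)
  also have "\<dots> \<le> exp (a * h) * ravg I (\<lambda>\<epsilon>. exp (8 * a\<^sup>2 * (\<Sum>k\<in>I. (\<Sum>l\<in>I. B k l * \<epsilon> l)\<^sup>2)))"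
    by (intro mult_left_mono exp_chaos_le_exp_square I) auto
  also have "\<dots> \<le> exp (a * h) * ravg I (\<lambda>\<epsilon>. exp (a / 2 * N \<epsilon>))"
  proof (intro mult_left_mono ravg_mono)
    fix \<epsilon>
    have "(\<Sum>l\<in>I. B k l * \<epsilon> l) = (\<Sum>i\<in>I. C i k * (\<Sum>l\<in>I. C i l * \<epsilon> l))" for k
      unfolding B_def sum_distrib_left sum_distrib_right by (subst sum.swap) (simp add: mult.assoc)
    then have "(\<Sum>k\<in>I. (\<Sum>l\<in>I. B k l * \<epsilon> l)\<^sup>2) \<le> \<kappa>\<^sup>2 * N \<epsilon>"
      using op[of "\<lambda>i. \<Sum>l\<in>I. C i l * \<epsilon> l"] by (simp add: N_def)
    then have "8 * a\<^sup>2 * (\<Sum>k\<in>I. (\<Sum>l\<in>I. B k l * \<epsilon> l)\<^sup>2) \<le> 8 * a\<^sup>2 * (\<kappa>\<^sup>2 * N \<epsilon>)"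
      by (intro mult_left_mono) auto
    also have "\<dots> = (a / 2 * N \<epsilon>) * (16 * a * \<kappa>\<^sup>2)" by (simp add: power2_eq_square)
    also have "\<dots> \<le> a / 2 * N \<epsilon> * 1"
      using a by (intro mult_left_mono) (auto simp: N_def sum_nonneg)
    finally show "exp (8 * a\<^sup>2 * (\<Sum>k\<in>I. (\<Sum>l\<in>I. B k l * \<epsilon> l)\<^sup>2)) \<le> exp (a / 2 * N \<epsilon>)" by simp
  qed auto
  also have "\<dots> \<le> exp (a * h) * sqrt F"
  proof (intro mult_left_mono real_le_rsqrt)
    have "(ravg I (\<lambda>\<epsilon>. exp (a / 2 * N \<epsilon>)))\<^sup>2 \<le> ravg I (\<lambda>\<epsilon>. (exp (a / 2 * N \<epsilon>))\<^sup>2)"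
      by (rule ravg_square_le[OF I])
    also have "\<dots> = F" unfolding F_def by (simp flip: exp_double)
    finally show "(ravg I (\<lambda>\<epsilon>. exp (a / 2 * N \<epsilon>)))\<^sup>2 \<le> F" .
  qed auto
  finally have "sqrt F * sqrt F \<le> exp (a * h) * sqrt F" using \<open>F > 0\<close> by simp
  then have "sqrt F \<le> exp (a * h)"
    by (rule mult_right_le_imp_le) (simp add: \<open>F > 0\<close>)
  then have "(sqrt F)\<^sup>2 \<le> (exp (a * h))\<^sup>2" using \<open>F > 0\<close> by (intro power_mono) auto
  then show ?thesis using \<open>F > 0\<close> unfolding F_def N_def h_def
    by (simp add: mult.assoc flip: exp_double)
qed

text \<open>
  The exponential moment form of the Hanson--Wright inequality.
\<close>
lemma hanson_wright_mgf:
  assumes I: "finite I" and t: "128 * t\<^sup>2 * \<kappa>\<^sup>2 \<le> 1"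
    and op: "\<And>v. (\<Sum>k\<in>I. (\<Sum>i\<in>I. C i k * v i)\<^sup>2) \<le> \<kappa>\<^sup>2 * (\<Sum>i\<in>I. (v i)\<^sup>2)"
  shows "ravg I (\<lambda>\<epsilon>. exp (t * (\<Sum>k\<in>I. \<Sum>l\<in>I - {k}. C k l * \<epsilon> k * \<epsilon> l)))
    \<le> exp (16 * t\<^sup>2 * (\<Sum>i\<in>I. \<Sum>l\<in>I. (C i l)\<^sup>2))"
proof -
  have "ravg I (\<lambda>\<epsilon>. exp (t * (\<Sum>k\<in>I. \<Sum>l\<in>I - {k}. C k l * \<epsilon> k * \<epsilon> l)))
    \<le> ravg I (\<lambda>\<epsilon>. exp (8 * t\<^sup>2 * (\<Sum>k\<in>I. (\<Sum>l\<in>I. C k l * \<epsilon> l)\<^sup>2)))"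
    by (rule exp_chaos_le_exp_square[OF I])
  also have "\<dots> \<le> exp (2 * (8 * t\<^sup>2) * (\<Sum>i\<in>I. \<Sum>l\<in>I. (C i l)\<^sup>2))"
    using t by (intro exp_square_norm_le[OF I, where \<kappa> = \<kappa>] op) auto
  finally show ?thesis by simp
qed

section \<open>Circular convolution and the Fourier transform\<close>

text \<open>
  The convolution with the signs in the place of the generator, \<open>v * x\<close>, for real functions on the
  residues.
\<close>
definition cconv :: "nat \<Rightarrow> (nat \<Rightarrow> real) \<Rightarrow> (nat \<Rightarrow> real) \<Rightarrow> nat \<Rightarrow> real" where
  "cconv n x v j = (\<Sum>k<n. v (cyc_sub n j k) * x k)"

lemma cyc_sub_less: "n > 0 \<Longrightarrow> cyc_sub n j k < n"
  by (simp add: cyc_sub_def nat_less_iff)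

lemma int_cyc_sub: "n > 0 \<Longrightarrow> int (cyc_sub n j k) = (int j - int k) mod int n"
  by (simp add: cyc_sub_def)

lemma cyc_sub_cyc_sub:
  assumes "j < n" "k < n"
  shows "cyc_sub n j (cyc_sub n j k) = k"
proof -
  have "int (cyc_sub n j (cyc_sub n j k)) = int k"
    using assms by (simp add: int_cyc_sub mod_diff_right_eq)
  then show ?thesis by simp
qed

lemma cyc_sub_add_mod:
  assumes "i < n" "k < n"
  shows "cyc_sub n ((i + k) mod n) k = i"
proof -
  have "int (cyc_sub n ((i + k) mod n) k) = int i"
    using assms by (simp add: int_cyc_sub zmod_int mod_diff_left_eq)
  then show ?thesis by simp
qed

lemma add_mod_cyc_sub:
  assumes "j < n" "k < n"
  shows "(cyc_sub n j k + k) mod n = j"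
proof -
  have "int ((cyc_sub n j k + k) mod n) = int j"
    using assms by (simp add: int_cyc_sub zmod_int mod_add_left_eq)
  then show ?thesis by simp
qed

lemma bij_betw_cyc_sub_right: "j < n \<Longrightarrow> bij_betw (cyc_sub n j) {..<n} {..<n}"
  by (rule bij_betwI[where g = "cyc_sub n j"]) (auto simp: cyc_sub_cyc_sub cyc_sub_less)

lemma bij_betw_cyc_sub_left: "k < n \<Longrightarrow> bij_betw (\<lambda>j. cyc_sub n j k) {..<n} {..<n}"
  by (rule bij_betwI[where g = "\<lambda>i. (i + k) mod n"])
    (auto simp: cyc_sub_add_mod add_mod_cyc_sub cyc_sub_less)

lemma cconv_commute: "j < n \<Longrightarrow> cconv n x v j = (\<Sum>i<n. x (cyc_sub n j i) * v i)"
  unfolding cconv_def using bij_betw_cyc_sub_right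
  by (subst sum.reindex_bij_betw[OF bij_betw_cyc_sub_right, symmetric])
    (auto intro!: sum.cong simp: cyc_sub_cyc_sub mult.commute)

lemma cconv_diff_left: "cconv n (\<lambda>k. x k - y k) v j = cconv n x v j - cconv n y v j"
  by (simp add: cconv_def algebra_simps sum_subtractf)

definition dft :: "nat \<Rightarrow> (nat \<Rightarrow> real) \<Rightarrow> nat \<Rightarrow> complex" where
  "dft n x \<omega> = (\<Sum>k<n. of_real (x k) * (cis (2 * pi / n) ^ k) ^ \<omega>)"

lemma dft_diff: "dft n (\<lambda>k. x k - y k) \<omega> = dft n x \<omega> - dft n y \<omega>"
  by (simp add: dft_def algebra_simps sum_subtractf)

lemma norm_dft_le: "cmod (dft n x \<omega>) \<le> (\<Sum>k<n. \<bar>x k\<bar>)"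
  unfolding dft_def by (rule sum_norm_le) (simp add: norm_mult norm_power)

lemma cis_root_power: "n > 0 \<Longrightarrow> cis (2 * pi / real n) ^ n = 1"
  by (simp add: Complex.DeMoivre)

lemma sum_roots_unity:
  assumes "k < n" "l < n"
  shows "(\<Sum>\<omega><n. (cis (2 * pi / n) ^ k) ^ \<omega> * cnj ((cis (2 * pi / n) ^ l) ^ \<omega>)) = (if k = l then of_nat n else 0)"
proof -
  define z where "z = cis (2 * pi / n)"
  have z1: "z ^ n = 1" using assms by (simp add: z_def cis_root_power)
  have nz: "z * cnj z = 1" by (simp add: z_def cis_mult cis_cnj)
  define w where "w = z ^ k * cnj (z ^ l)"
  have "w ^ n = (z ^ n) ^ k * cnj ((z ^ n) ^ l)"
    unfolding w_def by (simp add: power_mult_distrib mult.commute flip: power_mult)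
  then have w1: "w ^ n = 1" by (simp add: z1)
  have "(\<Sum>\<omega><n. (z ^ k) ^ \<omega> * cnj ((z ^ l) ^ \<omega>)) = (\<Sum>\<omega><n. w ^ \<omega>)"
    by (simp add: w_def power_mult_distrib)
  also have "\<dots> = (if k = l then of_nat n else 0)"
  proof (cases "k = l")
    case True
    then have "w = 1" using nz unfolding w_def by (simp flip: power_mult_distrib)
    then show ?thesis using True by simp
  next
    case False
    have "w \<noteq> 1"
    proof
      assume "w = 1"
      then have "z ^ k * (cnj z ^ l * z ^ l) = z ^ l" by (simp add: w_def flip: mult.assoc)
      then have "z ^ k = z ^ l" using nz by (simp add: mult.commute flip: power_mult_distrib)
      then have "cis (2 * pi * real k / n) = cis (2 * pi * real l / n)"
        by (simp add: z_def Complex.DeMoivre mult_ac)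
      moreover have "inj_on (\<lambda>k. cis (2 * pi * real k / real n)) {..<n}"
        using Complex.bij_betw_roots_unity[of n] assms by (simp add: bij_betw_def)
      ultimately show False using False assms by (auto simp: inj_on_def)
    qed
    then show ?thesis using False by (simp add: geometric_sum w1)
  qed
  finally show ?thesis by (simp add: z_def)
qed

lemma parseval:
  "(\<Sum>\<omega><n. (cmod (dft n f \<omega>))\<^sup>2) = n * (\<Sum>k<n. (f k)\<^sup>2)"
proof -
  define u where "u k = cis (2 * pi / n) ^ k" for k
  have "complex_of_real (\<Sum>\<omega><n. (cmod (dft n f \<omega>))\<^sup>2) = (\<Sum>\<omega><n. dft n f \<omega> * cnj (dft n f \<omega>))"
    by (simp flip: complex_norm_square)
  also have "\<dots> = (\<Sum>\<omega><n. \<Sum>k<n. \<Sum>l<n. of_real (f k * f l) * (u k ^ \<omega> * cnj (u l ^ \<omega>)))"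
    by (simp add: dft_def sum_product u_def mult_ac)
  also have "\<dots> = (\<Sum>k<n. \<Sum>\<omega><n. \<Sum>l<n. of_real (f k * f l) * (u k ^ \<omega> * cnj (u l ^ \<omega>)))"
    by (rule sum.swap)
  also have "\<dots> = (\<Sum>k<n. \<Sum>l<n. \<Sum>\<omega><n. of_real (f k * f l) * (u k ^ \<omega> * cnj (u l ^ \<omega>)))"
    by (intro sum.cong refl sum.swap)
  also have "\<dots> = (\<Sum>k<n. \<Sum>l<n. of_real (f k * f l) * (if k = l then of_nat n else 0))"
    unfolding sum_distrib_left[symmetric] u_def by (intro sum.cong refl) (subst sum_roots_unity, auto)
  also have "\<dots> = (\<Sum>k<n. of_real (f k * f k) * of_nat n)"
    by (intro sum.cong refl) (simp add: if_distrib cong: if_cong)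
  also have "\<dots> = complex_of_real (n * (\<Sum>k<n. (f k)\<^sup>2))"
    by (simp add: sum_distrib_left power2_eq_square mult_ac)
  finally show ?thesis by (simp only: of_real_eq_iff)
qed

lemma dft_cconv:
  "dft n (cconv n x v) \<omega> = dft n x \<omega> * dft n v \<omega>"
proof -
  define z where "z = cis (2 * pi / n)"
  have shift: "(\<Sum>j<n. of_real (v (cyc_sub n j k)) * (z ^ j) ^ \<omega>) = dft n v \<omega> * (z ^ k) ^ \<omega>"
    if k: "k < n" for k
  proof -
    have z1: "z ^ n = 1" using k by (simp add: z_def cis_root_power)
    have zmod: "z ^ (a mod n) = z ^ a" for a
    proof -
      have "z ^ a = z ^ (n * (a div n) + a mod n)" by simp
      then show ?thesis by (simp only: power_add power_mult z1) simp
    qed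
    have "(\<Sum>j<n. of_real (v (cyc_sub n j k)) * (z ^ j) ^ \<omega>)
        = (\<Sum>j<n. of_real (v (cyc_sub n j k)) * (z ^ (cyc_sub n j k + k)) ^ \<omega>)"
      using k by (intro sum.cong refl) (metis add_mod_cyc_sub lessThan_iff zmod)
    also have "\<dots> = (\<Sum>i<n. of_real (v i) * (z ^ (i + k)) ^ \<omega>)"
      by (rule sum.reindex_bij_betw[OF bij_betw_cyc_sub_left[OF k]])
    also have "\<dots> = dft n v \<omega> * (z ^ k) ^ \<omega>"
      unfolding dft_def z_def sum_distrib_right
      by (intro sum.cong refl) (simp only: power_add power_mult_distrib mult.assoc)
    finally show ?thesis .
  qed
  have "dft n (cconv n x v) \<omega>
      = (\<Sum>j<n. \<Sum>k<n. of_real (x k) * (of_real (v (cyc_sub n j k)) * (z ^ j) ^ \<omega>))"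
    unfolding dft_def cconv_def z_def of_real_sum sum_distrib_right by (simp add: mult_ac)
  also have "\<dots> = (\<Sum>k<n. of_real (x k) * (\<Sum>j<n. of_real (v (cyc_sub n j k)) * (z ^ j) ^ \<omega>))"
    by (subst sum.swap) (simp add: sum_distrib_left)
  also have "\<dots> = (\<Sum>k<n. of_real (x k) * (dft n v \<omega> * (z ^ k) ^ \<omega>))"
    by (simp add: shift)
  also have "\<dots> = dft n x \<omega> * dft n v \<omega>"
    by (simp add: dft_def[of n x] z_def sum_distrib_left mult_ac)
  finally show ?thesis .
qed

text \<open>
  Convolution is diagonal in the Fourier basis, so its operator norm is the largest modulus of a
  Fourier coefficient of \<open>x\<close>.
\<close>
lemma cconv_L2_le:
  assumes "\<And>\<omega>. \<omega> < n \<Longrightarrow> cmod (dft n x \<omega>) \<le> D" and "D \<ge> 0"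
  shows "L2_set (cconv n x v) {..<n} \<le> D * L2_set v {..<n}"
proof (cases "n = 0")
  case False
  have "n * (\<Sum>j<n. (cconv n x v j)\<^sup>2) = (\<Sum>\<omega><n. (cmod (dft n x \<omega>))\<^sup>2 * (cmod (dft n v \<omega>))\<^sup>2)"
    by (simp add: dft_cconv norm_mult power_mult_distrib flip: parseval)
  also have "\<dots> \<le> (\<Sum>\<omega><n. D\<^sup>2 * (cmod (dft n v \<omega>))\<^sup>2)"
    using assms by (intro sum_mono mult_right_mono power_mono) auto
  also have "\<dots> = n * (D\<^sup>2 * (\<Sum>k<n. (v k)\<^sup>2))"
    by (simp add: parseval mult_ac flip: sum_distrib_left)
  finally have "(\<Sum>j<n. (cconv n x v j)\<^sup>2) \<le> D\<^sup>2 * (\<Sum>k<n. (v k)\<^sup>2)"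
    using False by simp
  then have "sqrt (\<Sum>j<n. (cconv n x v j)\<^sup>2) \<le> sqrt (D\<^sup>2 * (\<Sum>k<n. (v k)\<^sup>2))"
    by (rule real_sqrt_le_mono)
  then show ?thesis using assms(2) by (simp add: L2_set_def real_sqrt_mult)
qed simp

section \<open>Grids of sparse averages and their coverings\<close>

text \<open>
  The points of the chaining.  They are the averages of \<open>M\<close> vectors from \<open>{0, \<plusminus>e\<^sub>k}\<close>, multiplied by
  \<open>sqrt r\<close>, written with an integer vector of \<open>1\<close>-norm at most \<open>M\<close>; such averages approximate all
  vectors with \<open>|x|\<^sub>1 \<le> sqrt r\<close>, and in particular all \<open>r\<close>-sparse unit vectors.  The number \<open>M\<close> of
  atoms measures the complexity of a point.
\<close>
definition grid :: "nat \<Rightarrow> real \<Rightarrow> nat \<Rightarrow> (nat \<Rightarrow> real) set" where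
  "grid n r M = {(\<lambda>k. sqrt r / M * of_int (z k)) | z :: nat \<Rightarrow> int.
     (\<forall>k\<ge>n. z k = 0) \<and> (\<Sum>k<n. \<bar>z k\<bar>) \<le> int M}"

definition atoms :: "nat \<Rightarrow> (nat \<Rightarrow> int) set" where
  "atoms n = insert (\<lambda>_. 0) ((\<lambda>(k, s) i. if i = k then s else 0) ` ({..<n} \<times> {1, -1}))"

lemma finite_atoms: "finite (atoms n)"
  by (simp add: atoms_def)

lemma card_atoms_le: "card (atoms n) \<le> 2 * n + 1"
proof -
  have "card (atoms n) \<le> Suc (card ((\<lambda>(k, s) i. if i = k then s else (0::int)) ` ({..<n} \<times> {1, -1})))"
    unfolding atoms_def by (rule card_insert_le_m1) auto
  also have "card ((\<lambda>(k, s) i. if i = k then s else (0::int)) ` ({..<n} \<times> {1, -1}))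
      \<le> card ({..<n} \<times> {1, -1 :: int})"
    by (rule card_image_le) auto
  also have "\<dots> = 2 * n" by (simp add: card_cartesian_product)
  finally show ?thesis by simp
qed

lemma atoms_sum_abs: "u \<in> atoms n \<Longrightarrow> (\<Sum>k<n. \<bar>u k\<bar>) \<le> 1"
  unfolding atoms_def by (auto simp: if_distrib[of abs] cong: if_cong)

lemma atoms_outside: "u \<in> atoms n \<Longrightarrow> k \<ge> n \<Longrightarrow> u k = 0"
  unfolding atoms_def by auto

lemma sum_atoms_decomposition:
  assumes "\<forall>k\<ge>n. z k = 0" "(\<Sum>k<n. \<bar>z k\<bar>) \<le> int M"
  shows "\<exists>u. (\<forall>i<M. u i \<in> atoms n) \<and> (\<forall>k. z k = (\<Sum>i<M. u i k))"
  using assms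
proof (induction M arbitrary: z)
  case 0
  then have "(\<Sum>k<n. \<bar>z k\<bar>) = 0" by (simp add: order_antisym sum_nonneg)
  then have "\<forall>k<n. z k = 0" by (simp add: sum_nonneg_eq_0_iff)
  then have "\<forall>k. z k = 0" using 0(1) by (metis not_le)
  then show ?case by simp
next
  case (Suc M)
  show ?case
  proof (cases "\<forall>k. z k = 0")
    case True
    then show ?thesis by (intro exI[of _ "\<lambda>_ _. 0"]) (simp add: atoms_def)
  next
    case False
    then obtain k0 where k0: "z k0 \<noteq> 0" by auto
    then have "k0 < n" using Suc.prems(1) not_le by blast
    define e where "e i = (if i = k0 then sgn (z k0) else 0)" for i
    have e: "e \<in> atoms n"
      unfolding atoms_def using \<open>k0 < n\<close> k0
      by (intro insertI2 image_eqI[of _ _ "(k0, sgn (z k0))"]) (auto simp: e_def sgn_if)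
    have "(\<Sum>k<n. \<bar>z k - e k\<bar>) = (\<Sum>k<n. \<bar>z k\<bar> - (if k = k0 then 1 else 0))"
      using k0 by (intro sum.cong refl) (auto simp: e_def sgn_if)
    also have "\<dots> = (\<Sum>k<n. \<bar>z k\<bar>) - 1" using \<open>k0 < n\<close> by (simp add: sum_subtractf)
    finally have "(\<Sum>k<n. \<bar>z k - e k\<bar>) \<le> int M" using Suc.prems(2) by simp
    moreover have "\<forall>k\<ge>n. z k - e k = 0" using Suc.prems(1) \<open>k0 < n\<close> by (auto simp: e_def)
    ultimately obtain u where u: "\<forall>i<M. u i \<in> atoms n" "\<forall>k. z k - e k = (\<Sum>i<M. u i k)"
      using Suc.IH[of "\<lambda>k. z k - e k"] by auto
    have "z k = (\<Sum>i<Suc M. (u(M := e)) i k)" for k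
      using u(2)[rule_format, of k] by simp
    then show ?thesis using u(1) e
      by (intro exI[of _ "u(M := e)"]) (auto simp: less_Suc_eq)
  qed
qed

lemma gridE:
  assumes "y \<in> grid n r M"
  obtains u where "\<And>i. i < M \<Longrightarrow> u i \<in> atoms n" "\<And>k. y k = sqrt r / M * of_int (\<Sum>i<M. u i k)"
proof -
  obtain z where z: "\<forall>k\<ge>n. z k = 0" "(\<Sum>k<n. \<bar>z k\<bar>) \<le> int M" "y = (\<lambda>k. sqrt r / M * of_int (z k))"
    using assms by (auto simp: grid_def)
  obtain u where "\<forall>i<M. u i \<in> atoms n" "\<forall>k. z k = (\<Sum>i<M. u i k)"
    using sum_atoms_decomposition[OF z(1,2)] by blast
  then show ?thesis using z(3) by (intro that[of u]) auto
qed

lemma gridI: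
  assumes "\<And>i. i < M \<Longrightarrow> u i \<in> atoms n"
  shows "(\<lambda>k. sqrt r / M * of_int (\<Sum>i<M. u i k)) \<in> grid n r M"
proof -
  have "(\<Sum>k<n. \<bar>\<Sum>i<M. u i k\<bar>) \<le> (\<Sum>k<n. \<Sum>i<M. \<bar>u i k\<bar>)" by (intro sum_mono sum_abs)
  also have "\<dots> = (\<Sum>i<M. \<Sum>k<n. \<bar>u i k\<bar>)" by (rule sum.swap)
  also have "\<dots> \<le> (\<Sum>i<M. 1)" using assms by (intro sum_mono atoms_sum_abs) auto
  finally have "(\<Sum>k<n. \<bar>\<Sum>i<M. u i k\<bar>) \<le> int M" by simp
  moreover have "\<forall>k\<ge>n. (\<Sum>i<M. u i k) = 0" using assms by (auto intro!: sum.neutral atoms_outside)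
  ultimately show ?thesis
    unfolding grid_def by (intro CollectI exI[of _ "\<lambda>k. \<Sum>i<M. u i k"] conjI) simp_all
qed

lemma grid_eq_image:
  "grid n r M \<subseteq> (\<lambda>u k. sqrt r / M * of_int (\<Sum>i<M. u i k)) ` (\<Pi>\<^sub>E i\<in>{..<M}. atoms n)"
proof
  fix y assume "y \<in> grid n r M"
  then obtain u where u: "\<And>i. i < M \<Longrightarrow> u i \<in> atoms n"
    "\<And>k. y k = sqrt r / M * of_int (\<Sum>i<M. u i k)" by (rule gridE) blast
  show "y \<in> (\<lambda>u k. sqrt r / M * of_int (\<Sum>i<M. u i k)) ` (\<Pi>\<^sub>E i\<in>{..<M}. atoms n)"
    using u by (intro image_eqI[of _ _ "restrict u {..<M}"]) (auto simp: fun_eq_iff)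
qed

lemma finite_grid: "finite (grid n r M)"
  using finite_subset[OF grid_eq_image] by (simp add: finite_PiE finite_atoms)

lemma card_grid_le: "card (grid n r M) \<le> (2 * n + 1) ^ M"
proof -
  have "card (grid n r M) \<le> card (\<Pi>\<^sub>E i\<in>{..<M}. atoms n)"
    by (rule surj_card_le[OF _ grid_eq_image]) (simp add: finite_PiE finite_atoms)
  also have "\<dots> = card (atoms n) ^ M" by (simp add: card_PiE)
  also have "\<dots> \<le> (2 * n + 1) ^ M" by (intro power_mono card_atoms_le) auto
  finally show ?thesis .
qed

lemma grid_sum_abs:
  assumes "y \<in> grid n r M" "r \<ge> 0"
  shows "(\<Sum>k<n. \<bar>y k\<bar>) \<le> sqrt r"
proof -
  obtain z where z: "(\<Sum>k<n. \<bar>z k\<bar>) \<le> int M" "y = (\<lambda>k. sqrt r / M * of_int (z k))"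
    using assms by (auto simp: grid_def)
  have "(\<Sum>k<n. \<bar>y k\<bar>) = sqrt r / M * of_int (\<Sum>k<n. \<bar>z k\<bar>)"
    using assms(2) by (simp add: z(2) abs_mult sum_distrib_left)
  also have "\<dots> \<le> sqrt r / M * of_int (int M)"
    by (intro mult_left_mono of_int_le_iff[THEN iffD2] z(1)) (use assms(2) in auto)
  also have "\<dots> \<le> sqrt r" using assms(2) by simp
  finally show ?thesis .
qed

text \<open>
  The error, in the norm that is the largest modulus of a Fourier coefficient, with which grid
  points of \<open>2\<^sup>i\<close> atoms approximate finer ones, up to an absolute constant.
\<close>
definition mesh :: "nat \<Rightarrow> real \<Rightarrow> nat \<Rightarrow> real" where
  "mesh n r i = sqrt (2 * r * ln (4 * real n) / 2 ^ i)"

text \<open>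
  Maurey's empirical method in a form that needs no sampling: pair the \<open>2 M\<close> atoms and keep one atom
  of each pair.  Twice the kept part differs from the whole by a Rademacher sum with one term for
  each pair, whose Fourier coefficients are bounded by 2 in modulus.  By the maximal inequality over
  the \<open>n\<close> frequencies some choice makes all coefficients of the difference of order \<open>sqrt (M ln n)\<close>.
\<close>
lemma grid_halving:
  assumes y: "y \<in> grid n r (2 * M)" and "M > 0" "n > 0" "r \<ge> 0"
  shows "\<exists>y'\<in>grid n r M. \<forall>\<omega><n.
    cmod (dft n (\<lambda>k. y k - y' k) \<omega>) \<le> 2 * sqrt (2 * r * ln (4 * real n) / M)"
proof -
  obtain u where u: "\<And>i. i < 2 * M \<Longrightarrow> u i \<in> atoms n"
    "\<And>k. y k = sqrt r / (2 * M) * of_int (\<Sum>i<2*M. u i k)"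
    using gridE[OF y] by (metis of_nat_mult of_nat_numeral)
  define w where "w i k = real_of_int (u i k) - of_int (u (i + M) k)" for i k
  have w_dft: "cmod (dft n (w i) \<omega>) \<le> 2" if "i < M" for i \<omega>
  proof -
    have "(\<Sum>k<n. \<bar>w i k\<bar>) \<le> (\<Sum>k<n. of_int \<bar>u i k\<bar> + of_int \<bar>u (i + M) k\<bar>)"
      unfolding w_def by (intro sum_mono) (simp only: of_int_abs abs_triangle_ineq4)
    also have "\<dots> = of_int ((\<Sum>k<n. \<bar>u i k\<bar>) + (\<Sum>k<n. \<bar>u (i + M) k\<bar>))"
      by (simp add: sum.distrib)
    also have "\<dots> \<le> of_int (1 + 1)"
      using that by (intro of_int_le_iff[THEN iffD2] add_mono atoms_sum_abs u) auto
    finally show ?thesis using norm_dft_le[of n "w i" \<omega>] by simp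
  qed
  define a where "a p i = (if snd p then Re (dft n (w i) (fst p)) else Im (dft n (w i) (fst p)))"
    for p :: "nat \<times> bool" and i
  \<comment> \<open>Real and imaginary parts at all frequencies are handled as \<open>2 n\<close> real Rademacher sums.\<close>
  define J where "J = {..<n} \<times> (UNIV :: bool set)"
  have J: "finite J" "J \<noteq> {}" "card J = 2 * n"
    using \<open>n > 0\<close> by (auto simp: J_def card_cartesian_product)
  define G where "G = (2 * sqrt M) * sqrt (2 * ln (2 * real (card J)))"
  have "(\<Sum>i<M. (a p i)\<^sup>2) \<le> (2 * sqrt M)\<^sup>2" for p
  proof -
    have "(\<Sum>i<M. (a p i)\<^sup>2) \<le> (\<Sum>i<M. 2\<^sup>2)"
    proof (intro sum_mono)
      fix i assume "i \<in> {..<M}"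
      then have "\<bar>a p i\<bar> \<le> 2" using w_dft[of i "fst p"] abs_Re_le_cmod abs_Im_le_cmod
        unfolding a_def by (smt (verit) lessThan_iff)
      then show "(a p i)\<^sup>2 \<le> 2\<^sup>2" by (metis abs_numeral abs_le_square_iff)
    qed
    then show ?thesis by (simp add: power_mult_distrib)
  qed
  then have "ravg {..<M} (\<lambda>\<sigma>. Max ((\<lambda>p. \<bar>\<Sum>i<M. a p i * \<sigma> i\<bar>) ` J)) \<le> G"
    unfolding G_def using J by (intro ravg_Max_le) auto
  moreover obtain \<sigma> where \<sigma>: "\<sigma> \<in> sign_vecs {..<M}"
    "Max ((\<lambda>p. \<bar>\<Sum>i<M. a p i * \<sigma> i\<bar>) ` J) \<le> ravg {..<M} (\<lambda>\<sigma>. Max ((\<lambda>p. \<bar>\<Sum>i<M. a p i * \<sigma> i\<bar>) ` J))"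
    using ravg_exists_ge[of "{..<M}" "\<lambda>\<sigma>. Max ((\<lambda>p. \<bar>\<Sum>i<M. a p i * \<sigma> i\<bar>) ` J)"] by auto
  ultimately have "Max ((\<lambda>p. \<bar>\<Sum>i<M. a p i * \<sigma> i\<bar>) ` J) \<le> G" by linarith
  then have G: "\<bar>\<Sum>i<M. a p i * \<sigma> i\<bar> \<le> G" if "p \<in> J" for p
    using J that by (subst (asm) Max_le_iff) auto
  define v where "v i = (if \<sigma> i = 1 then u i else u (i + M))" for i
  define y' where "y' = (\<lambda>k. sqrt r / M * of_int (\<Sum>i<M. v i k))"
  have "y' \<in> grid n r M" unfolding y'_def by (rule gridI) (auto simp: v_def intro!: u)
  moreover have "cmod (dft n (\<lambda>k. y k - y' k) \<omega>) \<le> 2 * sqrt (2 * r * ln (4 * real n) / M)"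
    if \<omega>: "\<omega> < n" for \<omega>
  proof -
    define c where "c = - sqrt r / (2 * M)"
    have "y k - y' k = c * (\<Sum>i<M. \<sigma> i * w i k)" for k
    proof -
      have "{..<2 * M} = {..<M} \<union> (\<lambda>i. i + M) ` {..<M}"
      proof (intro equalityI subsetI)
        fix i assume "i \<in> {..<2 * M}"
        then show "i \<in> {..<M} \<union> (\<lambda>i. i + M) ` {..<M}"
          by (cases "i < M") (auto intro!: image_eqI[of _ _ "i - M"])
      qed auto
      moreover have "(\<Sum>i\<in>{..<M} \<union> (\<lambda>i. i + M) ` {..<M}. u i k)
          = (\<Sum>i<M. u i k) + (\<Sum>i\<in>(\<lambda>i. i + M) ` {..<M}. u i k)"
        by (rule sum.union_disjoint) auto
      moreover have "(\<Sum>i\<in>(\<lambda>i. i + M) ` {..<M}. u i k) = (\<Sum>i<M. u (i + M) k)"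
        by (subst sum.reindex) (auto simp: inj_on_def)
      ultimately have "(\<Sum>i<2*M. u i k) = (\<Sum>i<M. u i k + u (i + M) k)"
        by (simp add: sum.distrib)
      then have "y k - y' k = (\<Sum>i<M. sqrt r / (2 * M) * (of_int (u i k) + of_int (u (i + M) k))
          - sqrt r / M * of_int (v i k))"
        unfolding u(2) y'_def by (simp only: of_int_sum of_int_add sum_distrib_left sum_subtractf)
      also have "\<dots> = (\<Sum>i<M. c * (\<sigma> i * w i k))"
      proof (rule sum.cong[OF refl])
        fix i assume "i \<in> {..<M}"
        then have "\<sigma> i = -1 \<or> \<sigma> i = 1" by (rule sign_vecs_cases[OF \<sigma>(1)])
        then show "sqrt r / (2 * M) * (of_int (u i k) + of_int (u (i + M) k))
          - sqrt r / M * of_int (v i k) = c * (\<sigma> i * w i k)"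
          using \<open>M > 0\<close> by (auto simp: v_def w_def c_def field_simps)
      qed
      finally show ?thesis by (simp add: sum_distrib_left)
    qed
    then have "dft n (\<lambda>k. y k - y' k) \<omega> = (\<Sum>k<n. \<Sum>i<M. of_real c *
        (of_real (\<sigma> i) * (of_real (w i k) * (cis (2 * pi / n) ^ k) ^ \<omega>)))"
      unfolding dft_def by (simp only: of_real_mult of_real_sum sum_distrib_left sum_distrib_right mult.assoc)
    also have "\<dots> = of_real c * (\<Sum>i<M. of_real (\<sigma> i) * dft n (w i) \<omega>)"
      unfolding dft_def sum_distrib_left by (rule sum.swap)
    finally have "dft n (\<lambda>k. y k - y' k) \<omega> = of_real c * (\<Sum>i<M. of_real (\<sigma> i) * dft n (w i) \<omega>)" .
    moreover have "cmod (\<Sum>i<M. of_real (\<sigma> i) * dft n (w i) \<omega>) \<le> G + G"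
    proof -
      have "Re (\<Sum>i<M. of_real (\<sigma> i) * dft n (w i) \<omega>) = (\<Sum>i<M. a (\<omega>, True) i * \<sigma> i)"
        "Im (\<Sum>i<M. of_real (\<sigma> i) * dft n (w i) \<omega>) = (\<Sum>i<M. a (\<omega>, False) i * \<sigma> i)"
        by (simp_all add: a_def mult.commute)
      then show ?thesis
        using cmod_le[of "\<Sum>i<M. of_real (\<sigma> i) * dft n (w i) \<omega>"] G[of "(\<omega>, True)"] G[of "(\<omega>, False)"] \<omega>
        by (simp add: J_def)
    qed
    ultimately have "cmod (dft n (\<lambda>k. y k - y' k) \<omega>) \<le> \<bar>c\<bar> * (G + G)"
      by (simp add: norm_mult mult_left_mono)
    also have "\<dots> = 2 * sqrt (2 * r * ln (4 * real n) / M)"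
    proof -
      have "sqrt M / M = 1 / sqrt M" using \<open>M > 0\<close> by (simp add: field_simps)
      moreover have "\<bar>c\<bar> * (G + G) = 2 * (sqrt r * (sqrt M / M) * sqrt (2 * ln (4 * real n)))"
        using \<open>r \<ge> 0\<close> by (simp add: c_def G_def J)
      ultimately show ?thesis by (simp add: real_sqrt_mult real_sqrt_divide)
    qed
    finally show ?thesis .
  qed
  ultimately show ?thesis by blast
qed

lemma mesh_Suc: "mesh n r (Suc i) = mesh n r i / sqrt 2"
  by (simp add: mesh_def real_sqrt_divide real_sqrt_mult)

lemma mesh_nonneg: "n > 0 \<Longrightarrow> r \<ge> 0 \<Longrightarrow> mesh n r i \<ge> 0"
  by (simp add: mesh_def)

text \<open>
  Repeated halving; the errors form a geometric series with ratio \<open>sqrt 2\<close>, dominated by the last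
  and coarsest step.
\<close>
lemma grid_coarsening:
  assumes "y \<in> grid n r (2 ^ (i + j))" and "n > 0" "r \<ge> 0"
  shows "\<exists>y'\<in>grid n r (2 ^ i). \<forall>\<omega><n. cmod (dft n (\<lambda>k. y k - y' k) \<omega>) \<le> 8 * mesh n r i"
  using assms(1)
proof (induction j arbitrary: i)
  case 0
  then show ?case using mesh_nonneg[OF assms(2,3)]
    by (intro bexI[of _ y]) (auto simp: dft_def)
next
  case (Suc j)
  then have "y \<in> grid n r (2 ^ (Suc i + j))" by simp
  then obtain y1 where y1: "y1 \<in> grid n r (2 ^ Suc i)"
    "\<forall>\<omega><n. cmod (dft n (\<lambda>k. y k - y1 k) \<omega>) \<le> 8 * mesh n r (Suc i)"
    using Suc.IH by blast
  have "\<exists>y'\<in>grid n r (2 ^ i). \<forall>\<omega><n. cmod (dft n (\<lambda>k. y1 k - y' k) \<omega>) \<le> 2 * mesh n r i"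
    using grid_halving[of y1 n r "2 ^ i"] y1(1) assms by (simp add: mesh_def)
  then obtain y2 where y2: "y2 \<in> grid n r (2 ^ i)"
    "\<forall>\<omega><n. cmod (dft n (\<lambda>k. y1 k - y2 k) \<omega>) \<le> 2 * mesh n r i" by blast
  \<comment> \<open>\<open>2 + 8 / sqrt 2 \<le> 8\<close>, so the error bound reproduces itself.\<close>
  have "4 / 3 \<le> sqrt 2" by (rule real_le_rsqrt) (simp add: power2_eq_square)
  then have "(8::real) / sqrt 2 \<le> 6" by (simp add: divide_le_eq)
  then have "8 * mesh n r (Suc i) \<le> 6 * mesh n r i"
    using mult_right_mono[OF _ mesh_nonneg[OF assms(2,3)], of "8 / sqrt 2" 6 i]
    by (simp add: mesh_Suc)
  moreover have "cmod (dft n (\<lambda>k. y k - y2 k) \<omega>)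
      \<le> cmod (dft n (\<lambda>k. y k - y1 k) \<omega>) + cmod (dft n (\<lambda>k. y1 k - y2 k) \<omega>)" for \<omega>
    unfolding dft_diff using norm_triangle_ineq[of "dft n y \<omega> - dft n y1 \<omega>" "dft n y1 \<omega> - dft n y2 \<omega>"]
    by simp
  ultimately have "\<forall>\<omega><n. cmod (dft n (\<lambda>k. y k - y2 k) \<omega>) \<le> 8 * mesh n r i"
    using y1(2) y2(2) by (smt (verit))
  then show ?case using y2(1) by blast
qed

text \<open>
  The approximations must stay in \<open>X\<close>, because the chaining needs their energies to be bounded, and
  coarse grid points can have large Euclidean norm.  So each point is sent to a representative of
  its class under the coarsening map, at the cost of a factor 2.
\<close>
lemma grid_covering:
  assumes X: "X \<subseteq> grid n r (2 ^ K)" and "i \<le> K" and "n > 0" "r \<ge> 0"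
  shows "\<exists>g. g \<in> X \<rightarrow> X \<and> card (g ` X) \<le> (2 * n + 1) ^ (2 ^ i) \<and>
    (\<forall>x\<in>X. \<forall>\<omega><n. cmod (dft n (\<lambda>k. x k - g x k) \<omega>) \<le> 16 * mesh n r i)"
proof -
  have "\<forall>y\<in>X. \<exists>y'\<in>grid n r (2 ^ i). \<forall>\<omega><n. cmod (dft n (\<lambda>k. y k - y' k) \<omega>) \<le> 8 * mesh n r i"
    using grid_coarsening[of _ n r i "K - i"] assms by auto
  then obtain h where h: "\<And>y. y \<in> X \<Longrightarrow> h y \<in> grid n r (2 ^ i)"
    "\<And>y \<omega>. y \<in> X \<Longrightarrow> \<omega> < n \<Longrightarrow> cmod (dft n (\<lambda>k. y k - h y k) \<omega>) \<le> 8 * mesh n r i"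
    by metis
  define g where "g y = inv_into X h (h y)" for y
  have g: "g y \<in> X" "h (g y) = h y" if "y \<in> X" for y
    using that by (auto simp: g_def inv_into_into f_inv_into_f)
  have "card (g ` X) = card (inv_into X h ` h ` X)" by (simp add: g_def image_image)
  also have "\<dots> \<le> card (h ` X)"
    using finite_subset[OF X finite_grid] by (intro card_image_le) auto
  also have "\<dots> \<le> card (grid n r (2 ^ i))" using h(1) by (intro card_mono finite_grid) auto
  also have "\<dots> \<le> (2 * n + 1) ^ (2 ^ i)" by (rule card_grid_le)
  finally have "card (g ` X) \<le> (2 * n + 1) ^ (2 ^ i)" .
  moreover have "cmod (dft n (\<lambda>k. x k - g x k) \<omega>) \<le> 16 * mesh n r i" if "x \<in> X" "\<omega> < n" for x \<omega>
    using h(2)[of x \<omega>] h(2)[of "g x" \<omega>] g[OF that(1)] that norm_triangle_ineq4[of "dft n x \<omega> - dft n (h x) \<omega>" "dft n (g x) \<omega> - dft n (h x) \<omega>"]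
    by (simp add: dft_diff)
  ultimately show ?thesis using g(1) by (intro exI[of _ g]) auto
qed

section \<open>Chaining for the restricted energy\<close>

lemma sign_vecs_uminus_bij: "bij_betw (\<lambda>\<epsilon> i. - \<epsilon> i) (sign_vecs I) (sign_vecs I)"
  by (rule bij_betwI[where g = "\<lambda>\<epsilon> i. - \<epsilon> i"]) (fastforce simp: sign_vecs_def PiE_dflt_def)+

lemma ravg_uminus: "ravg I (\<lambda>\<epsilon>. f (\<lambda>i. - \<epsilon> i)) = ravg I f"
  unfolding ravg_def by (subst sum.reindex_bij_betw[OF sign_vecs_uminus_bij]) simp

lemma cconv_supported:
  assumes "j < n" "S \<subseteq> {..<n}" "\<And>i. i \<notin> S \<Longrightarrow> v i = 0"
  shows "cconv n x v j = (\<Sum>i\<in>S. x (cyc_sub n j i) * v i)"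
  unfolding cconv_commute[OF assms(1)] using assms by (intro sum.mono_neutral_right) auto

lemma cconv_zero [simp]: "cconv n (\<lambda>_. 0) v j = 0"
  by (simp add: cconv_def)

lemma L2_set_inner_le: "\<bar>\<Sum>i\<in>A. f i * g i\<bar> \<le> L2_set f A * L2_set g A"
proof -
  have "\<bar>\<Sum>i\<in>A. f i * g i\<bar> \<le> (\<Sum>i\<in>A. \<bar>f i\<bar> * \<bar>g i\<bar>)"
    using sum_abs[of "\<lambda>i. f i * g i" A] by (simp add: abs_mult)
  then show ?thesis using L2_set_mult_ineq[of f g A] by simp
qed

lemma L2_set_square: "(L2_set f A)\<^sup>2 = (\<Sum>i\<in>A. (f i)\<^sup>2)"
  by (simp add: L2_set_def sum_nonneg)

lemma L2_set_subset_le: "finite B \<Longrightarrow> A \<subseteq> B \<Longrightarrow> L2_set f A \<le> L2_set f B"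
  unfolding L2_set_def by (intro real_sqrt_le_mono sum_mono2) auto

text \<open>
  The adjoint of a convolution has the same operator norm.  This is the duality argument: test the
  adjoint on its own value.
\<close>
lemma cconv_adjoint_L2_le:
  assumes "\<Omega> \<subseteq> {..<n}" "S \<subseteq> {..<n}" "D \<ge> 0"
    and dft: "\<And>\<omega>. \<omega> < n \<Longrightarrow> cmod (dft n x \<omega>) \<le> D"
  shows "L2_set (\<lambda>i. \<Sum>j\<in>\<Omega>. x (cyc_sub n j i) * w j) S \<le> D * L2_set w \<Omega>"
proof -
  define h where "h i = (\<Sum>j\<in>\<Omega>. x (cyc_sub n j i) * w j)" for i
  define v where "v i = (if i \<in> S then h i else 0)" for i
  have "(L2_set h S)\<^sup>2 = (\<Sum>i\<in>S. v i * h i)"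
    unfolding L2_set_square by (intro sum.cong refl) (simp add: v_def power2_eq_square)
  also have "\<dots> = (\<Sum>j\<in>\<Omega>. (\<Sum>i\<in>S. x (cyc_sub n j i) * v i) * w j)"
    unfolding h_def sum_distrib_left sum_distrib_right by (subst sum.swap) (simp add: mult_ac)
  also have "\<dots> = (\<Sum>j\<in>\<Omega>. cconv n x v j * w j)"
  proof (intro sum.cong refl)
    fix j assume "j \<in> \<Omega>"
    then have "cconv n x v j = (\<Sum>i\<in>S. x (cyc_sub n j i) * v i)"
      using assms(1,2) by (intro cconv_supported) (auto simp: v_def)
    then show "(\<Sum>i\<in>S. x (cyc_sub n j i) * v i) * w j = cconv n x v j * w j" by simp
  qed
  also have "\<dots> \<le> L2_set (cconv n x v) \<Omega> * L2_set w \<Omega>"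
    using L2_set_inner_le[of "cconv n x v" w \<Omega>] by linarith
  also have "\<dots> \<le> D * L2_set v {..<n} * L2_set w \<Omega>"
    using L2_set_subset_le[of "{..<n}" \<Omega> "cconv n x v"] cconv_L2_le[OF dft assms(3), of v] assms(1)
    by (intro mult_right_mono) auto
  also have "L2_set v {..<n} = L2_set h S"
    unfolding L2_set_def using assms(2)
    by (intro arg_cong[of _ _ sqrt] sum.mono_neutral_cong_right) (auto simp: v_def)
  finally have *: "L2_set h S * L2_set h S \<le> (D * L2_set w \<Omega>) * L2_set h S"
    by (simp add: power2_eq_square mult_ac)
  have "L2_set h S \<le> D * L2_set w \<Omega>"
  proof (cases "L2_set h S = 0")
    case False
    then have "L2_set h S > 0" using L2_set_nonneg[of h S] by linarith
    with * show ?thesis by (rule mult_right_le_imp_le)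
  qed (simp add: assms(3))
  then show ?thesis unfolding h_def .
qed

text \<open>
  One link of the chain.  For fixed \<open>\<beta>\<close> the pairing is a Rademacher sum in \<open>\<alpha>\<close>, and its coefficient
  vector is the adjoint of convolution by \<open>d\<close> applied to \<open>y * \<beta>\<close>.  Only the first factor contributes
  a small quantity; the second one enters through its norm.
\<close>
lemma decoupled_increment_Max_le:
  fixes P :: "((nat \<Rightarrow> real) \<times> (nat \<Rightarrow> real)) set"
  assumes \<Omega>: "\<Omega> \<subseteq> {..<n}" and S: "S \<subseteq> {..<n}" and P: "finite P" "P \<noteq> {}" and "D \<ge> 0"
    and dft: "\<And>d y \<omega>. (d, y) \<in> P \<Longrightarrow> \<omega> < n \<Longrightarrow> cmod (dft n d \<omega>) \<le> D"
    and N: "\<And>d y. (d, y) \<in> P \<Longrightarrow> L2_set (cconv n y \<beta>) \<Omega> \<le> N"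
  shows "ravg S (\<lambda>\<alpha>. Max ((\<lambda>(d, y). \<bar>\<Sum>j\<in>\<Omega>. cconv n d \<alpha> j * cconv n y \<beta> j\<bar>) ` P))
    \<le> D * N * sqrt (2 * ln (2 * real (card P)))"
proof -
  have fS: "finite S" using S finite_subset by blast
  have "N \<ge> 0" using P N L2_set_nonneg order_trans by (metis equals0I surj_pair)
  define a where "a p i = (\<Sum>j\<in>\<Omega>. fst p (cyc_sub n j i) * cconv n (snd p) \<beta> j)"
    for p :: "(nat \<Rightarrow> real) \<times> (nat \<Rightarrow> real)" and i
  have "ravg S (\<lambda>\<alpha>. Max ((\<lambda>(d, y). \<bar>\<Sum>j\<in>\<Omega>. cconv n d \<alpha> j * cconv n y \<beta> j\<bar>) ` P))
      = ravg S (\<lambda>\<alpha>. Max ((\<lambda>p. \<bar>\<Sum>i\<in>S. a p i * \<alpha> i\<bar>) ` P))"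
  proof (rule ravg_cong)
    fix \<alpha> assume \<alpha>: "\<alpha> \<in> sign_vecs S"
    have "(\<Sum>j\<in>\<Omega>. cconv n (fst p) \<alpha> j * cconv n (snd p) \<beta> j) = (\<Sum>i\<in>S. a p i * \<alpha> i)" for p
    proof -
      have "(\<Sum>j\<in>\<Omega>. cconv n (fst p) \<alpha> j * cconv n (snd p) \<beta> j)
          = (\<Sum>j\<in>\<Omega>. (\<Sum>i\<in>S. fst p (cyc_sub n j i) * \<alpha> i) * cconv n (snd p) \<beta> j)"
        using \<Omega> S \<alpha> by (intro sum.cong refl) (subst cconv_supported[of _ n S \<alpha>], auto simp: sign_vecs_outside)
      also have "\<dots> = (\<Sum>i\<in>S. a p i * \<alpha> i)"
        unfolding a_def sum_distrib_right by (subst sum.swap) (simp add: mult_ac)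
      finally show ?thesis .
    qed
    then show "Max ((\<lambda>(d, y). \<bar>\<Sum>j\<in>\<Omega>. cconv n d \<alpha> j * cconv n y \<beta> j\<bar>) ` P)
        = Max ((\<lambda>p. \<bar>\<Sum>i\<in>S. a p i * \<alpha> i\<bar>) ` P)"
      by (simp add: case_prod_unfold)
  qed
  also have "\<dots> \<le> (D * N) * sqrt (2 * ln (2 * real (card P)))"
  proof (rule ravg_Max_le[OF fS P])
    fix p assume "p \<in> P"
    then have p: "(fst p, snd p) \<in> P" by simp
    have "L2_set (a p) S \<le> D * L2_set (cconv n (snd p) \<beta>) \<Omega>"
      unfolding a_def using dft[OF p] by (intro cconv_adjoint_L2_le \<Omega> S \<open>D \<ge> 0\<close>) auto
    also have "\<dots> \<le> D * N" by (intro mult_left_mono N[OF p] \<open>D \<ge> 0\<close>)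
    finally have "(L2_set (a p) S)\<^sup>2 \<le> (D * N)\<^sup>2" by (intro power_mono) auto
    then show "(\<Sum>i\<in>S. (a p i)\<^sup>2) \<le> (D * N)\<^sup>2" by (simp add: L2_set_square)
  qed (use \<open>N \<ge> 0\<close> \<open>D \<ge> 0\<close> in auto)
  finally show ?thesis .
qed

definition grid_ball :: "nat \<Rightarrow> real \<Rightarrow> nat \<Rightarrow> (nat \<Rightarrow> real) set" where
  "grid_ball n r M = {y \<in> grid n r M. L2_set y {..<n} \<le> 1}"

lemma zero_in_grid_ball: "(\<lambda>_. 0) \<in> grid_ball n r M"
  by (auto simp: grid_ball_def grid_def L2_set_def intro!: exI[of _ "\<lambda>_. 0"])

lemma finite_grid_ball [simp]: "finite (grid_ball n r M)"
  by (simp add: grid_ball_def finite_grid)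

lemma grid_ball_nonempty [simp]: "grid_ball n r M \<noteq> {}"
  using zero_in_grid_ball by blast

definition maxnorm :: "nat \<Rightarrow> nat set \<Rightarrow> (nat \<Rightarrow> real) set \<Rightarrow> (nat \<Rightarrow> real) \<Rightarrow> real" where
  "maxnorm n \<Omega> X v = Max ((\<lambda>x. L2_set (cconv n x v) \<Omega>) ` X)"

lemma maxnorm_ge: "finite X \<Longrightarrow> x \<in> X \<Longrightarrow> L2_set (cconv n x v) \<Omega> \<le> maxnorm n \<Omega> X v"
  by (simp add: maxnorm_def)

lemma maxnorm_nonneg: "finite X \<Longrightarrow> X \<noteq> {} \<Longrightarrow> maxnorm n \<Omega> X v \<ge> 0"
  using maxnorm_ge L2_set_nonneg order_trans by (metis all_not_in_conv)

text \<open>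
  The restriction of a sign vector to \<open>S\<close> is the mean of that vector and of the one with flipped
  signs outside \<open>S\<close>, and these two have the same law.
\<close>
lemma ravg_maxnorm_subset_le:
  assumes S: "S \<subseteq> {..<n}" and X: "finite X" "X \<noteq> {}"
  shows "ravg S (maxnorm n \<Omega> X) \<le> ravg {..<n} (maxnorm n \<Omega> X)"
proof -
  have fin: "finite S" "finite ({..<n} - S)" using S finite_subset by auto
  define N where "N = maxnorm n \<Omega> X"
  \<comment> \<open>\<open>\<alpha>\<close> is the midpoint of \<open>\<alpha> + \<beta>\<close> and \<open>\<alpha> - \<beta>\<close>.\<close>
  have half: "N \<alpha> \<le> 1/2 * N (\<lambda>i. \<alpha> i + \<beta> i) + 1/2 * N (\<lambda>i. \<alpha> i + - \<beta> i)" for \<alpha> \<beta>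
  proof -
    have "L2_set (cconv n x \<alpha>) \<Omega> \<le> 1/2 * N (\<lambda>i. \<alpha> i + \<beta> i) + 1/2 * N (\<lambda>i. \<alpha> i + - \<beta> i)"
      if "x \<in> X" for x
    proof -
      have "cconv n x \<alpha> j = 1/2 * cconv n x (\<lambda>i. \<alpha> i + \<beta> i) j + 1/2 * cconv n x (\<lambda>i. \<alpha> i + - \<beta> i) j" for j
        by (simp add: cconv_def algebra_simps sum.distrib sum_subtractf flip: sum_distrib_left)
      then have "L2_set (cconv n x \<alpha>) \<Omega>
          = L2_set (\<lambda>j. 1/2 * cconv n x (\<lambda>i. \<alpha> i + \<beta> i) j + 1/2 * cconv n x (\<lambda>i. \<alpha> i + - \<beta> i) j) \<Omega>"
        by (intro L2_set_cong refl)
      also have "\<dots> \<le> L2_set (\<lambda>j. 1/2 * cconv n x (\<lambda>i. \<alpha> i + \<beta> i) j) \<Omega> + L2_set (\<lambda>j. 1/2 * cconv n x (\<lambda>i. \<alpha> i + - \<beta> i) j) \<Omega>"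
        by (rule L2_set_triangle_ineq)
      also have "\<dots> = 1/2 * L2_set (cconv n x (\<lambda>i. \<alpha> i + \<beta> i)) \<Omega> + 1/2 * L2_set (cconv n x (\<lambda>i. \<alpha> i + - \<beta> i)) \<Omega>"
        by (simp only: L2_set_right_distrib)
      also have "\<dots> \<le> 1/2 * N (\<lambda>i. \<alpha> i + \<beta> i) + 1/2 * N (\<lambda>i. \<alpha> i + - \<beta> i)"
        unfolding N_def using maxnorm_ge[OF X(1) that] by (intro add_mono mult_left_mono) auto
      finally show ?thesis .
    qed
    then show ?thesis unfolding N_def maxnorm_def using X by (subst Max_le_iff) auto
  qed
  have "ravg S N = ravg S (\<lambda>\<alpha>. ravg ({..<n} - S) (\<lambda>\<beta>. N \<alpha>))" using fin by simp
  also have "\<dots> \<le> ravg S (\<lambda>\<alpha>. ravg ({..<n} - S) (\<lambda>\<beta>. 1/2 * N (\<lambda>i. \<alpha> i + \<beta> i) + 1/2 * N (\<lambda>i. \<alpha> i + - \<beta> i)))"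
    by (intro ravg_mono half)
  also have "\<dots> = ravg S (\<lambda>\<alpha>. ravg ({..<n} - S) (\<lambda>\<beta>. N (\<lambda>i. \<alpha> i + \<beta> i)))"
  proof (rule ravg_cong)
    fix \<alpha>
    have "ravg ({..<n} - S) (\<lambda>\<beta>. N (\<lambda>i. \<alpha> i + - \<beta> i)) = ravg ({..<n} - S) (\<lambda>\<beta>. N (\<lambda>i. \<alpha> i + \<beta> i))"
      by (rule ravg_uminus[of _ "\<lambda>\<beta>. N (\<lambda>i. \<alpha> i + \<beta> i)"])
    then show "ravg ({..<n} - S) (\<lambda>\<beta>. 1/2 * N (\<lambda>i. \<alpha> i + \<beta> i) + 1/2 * N (\<lambda>i. \<alpha> i + - \<beta> i))
        = ravg ({..<n} - S) (\<lambda>\<beta>. N (\<lambda>i. \<alpha> i + \<beta> i))"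
      unfolding ravg_add ravg_cmult by simp
  qed
  also have "\<dots> = ravg {..<n} N" by (rule ravg_split[OF _ S, symmetric]) simp
  finally show ?thesis unfolding N_def .
qed

text \<open>
  The maps of the chain.  The pairing vanishes at the origin and the identity recovers the point
  itself, so prescribing the maps at both ends lets the increments telescope to the full value.
\<close>
lemma coarsening_maps:
  assumes "K > 0" "n > 0" "r \<ge> 0"
  defines "X \<equiv> grid_ball n r (2 ^ K)"
  obtains g where
    "\<And>i. i \<le> K \<Longrightarrow> g i \<in> X \<rightarrow> X"
    "\<And>i. i \<le> K \<Longrightarrow> card (g i ` X) \<le> (2 * n + 1) ^ (2 ^ i)"
    "\<And>i x \<omega>. i \<le> K \<Longrightarrow> x \<in> X \<Longrightarrow> \<omega> < n \<Longrightarrow> cmod (dft n (\<lambda>k. x k - g i x k) \<omega>) \<le> 16 * mesh n r i"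
    "\<And>x. g 0 x = (\<lambda>_. 0)" "\<And>x. g K x = x"
proof -
  have X: "X \<subseteq> grid n r (2 ^ K)" by (auto simp: X_def grid_ball_def)
  define adm where "adm i g \<longleftrightarrow> i \<le> K \<longrightarrow> (g \<in> X \<rightarrow> X \<and> card (g ` X) \<le> (2 * n + 1) ^ (2 ^ i) \<and>
    (\<forall>x\<in>X. \<forall>\<omega><n. cmod (dft n (\<lambda>k. x k - g x k) \<omega>) \<le> 16 * mesh n r i) \<and>
    (i = 0 \<longrightarrow> g = (\<lambda>_ _. 0)) \<and> (i = K \<longrightarrow> g = (\<lambda>x. x)))" for i g
  have "\<forall>i. \<exists>g. adm i g"
  proof
    fix i
    consider "i = 0" | "i = K" "i > 0" | "i < K" "i > 0" | "i > K" by linarith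
    then show "\<exists>g. adm i g"
    proof cases
      case 1
      have "cmod (dft n (\<lambda>k. x k - 0) \<omega>) \<le> 16 * mesh n r 0" if "x \<in> X" for x \<omega>
      proof -
        have "cmod (dft n x \<omega>) \<le> sqrt r"
          using norm_dft_le[of n x \<omega>] grid_sum_abs[of x n r "2 ^ K"] X that assms by force
        also have "\<dots> \<le> sqrt (2 * r * ln (4 * real n))"
        proof (rule real_sqrt_le_mono)
          have "exp 1 \<le> 4 * real n" using exp_le \<open>n > 0\<close> by (simp add: order_trans[of _ 3])
          then have "1 \<le> ln (4 * real n)" using \<open>n > 0\<close> by (subst ln_ge_iff) auto
          then show "r \<le> 2 * r * ln (4 * real n)" using mult_left_mono[of 1 "2 * ln (4 * real n)" r] assms by simp
        qed
        also have "\<dots> \<le> 16 * mesh n r 0" using mesh_nonneg[of n r 0] assms by (simp add: mesh_def)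
        finally show ?thesis by simp
      qed
      moreover have "card ((\<lambda>_ _. 0 :: real) ` X) \<le> (2 * n + 1) ^ (2 ^ i)"
        using card_image_le[of "{\<lambda>_. 0}"] unfolding X_def by (simp add: image_constant_conv)
      ultimately show ?thesis unfolding adm_def using 1 \<open>K > 0\<close>
        by (intro exI[of _ "\<lambda>_ _. 0"]) (auto simp: X_def zero_in_grid_ball)
    next
      case 2
      have "card X \<le> card (grid n r (2 ^ K))" by (rule card_mono[OF finite_grid X])
      also have "\<dots> \<le> (2 * n + 1) ^ (2 ^ K)" by (rule card_grid_le)
      finally show ?thesis unfolding adm_def using 2 mesh_nonneg[of n r K] assms
        by (intro exI[of _ "\<lambda>x. x"]) (auto simp: dft_def)
    next
      case 3
      from grid_covering[OF X less_imp_le[OF 3(1)] assms(2,3)]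
      obtain g where "g \<in> X \<rightarrow> X \<and> card (g ` X) \<le> (2 * n + 1) ^ (2 ^ i) \<and>
          (\<forall>x\<in>X. \<forall>\<omega><n. cmod (dft n (\<lambda>k. x k - g x k) \<omega>) \<le> 16 * mesh n r i)"
        by (elim exE)
      with 3 show ?thesis unfolding adm_def by (intro exI[of _ g]) simp
    next
      case 4
      then show ?thesis by (simp add: adm_def)
    qed
  qed
  then obtain g where g: "\<forall>i. adm i (g i)" using choice by blast
  show ?thesis
    by (rule that[of g]) (use g in \<open>auto simp: adm_def\<close>)
qed

text \<open>
  This is where the squared logarithms in the bound on \<open>m\<close> come from.  The entropy at level \<open>i\<close> is
  of order \<open>2\<^sup>i ln n\<close> and the mesh is of order \<open>sqrt (r ln n / 2\<^sup>i)\<close>, so that mesh times root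
  entropy is \<open>sqrt r ln n\<close> at every level.  Summing over the levels gives the other factor \<open>ln r\<close>.
\<close>
lemma mesh_entropy_product:
  assumes "n > 0" "r \<ge> 0" "c \<ge> 1" "real c \<le> (2 * real n + 1) ^ (3 * 2 ^ i)"
  shows "32 * mesh n r i * sqrt (2 * ln (2 * real c)) \<le> 128 * sqrt r * ln (4 * real n)"
proof -
  define l where "l = ln (4 * real n)"
  have "exp 1 \<le> 4 * real n" using exp_le \<open>n > 0\<close> by (simp add: order_trans[of _ 3])
  then have l: "l \<ge> 1" unfolding l_def using \<open>n > 0\<close> by (subst ln_ge_iff) auto
  have "ln (2 * real c) \<le> ln 2 + ln ((2 * real n + 1) ^ (3 * 2 ^ i))"
    using assms by (simp add: ln_mult)
  also have "\<dots> = ln 2 + 3 * 2 ^ i * ln (2 * real n + 1)" by (simp add: ln_realpow)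
  also have "\<dots> \<le> 2 ^ i * l + 3 * 2 ^ i * l"
  proof (intro add_mono mult_left_mono)
    have "ln 2 \<le> l" unfolding l_def using \<open>n > 0\<close> by simp
    also have "\<dots> \<le> 2 ^ i * l" using l by simp
    finally show "ln 2 \<le> 2 ^ i * l" .
    show "ln (2 * real n + 1) \<le> l" unfolding l_def using \<open>n > 0\<close> by simp
  qed auto
  finally have "sqrt (2 * ln (2 * real c)) \<le> sqrt (8 * 2 ^ i * l)" by simp
  then have "32 * mesh n r i * sqrt (2 * ln (2 * real c)) \<le> 32 * mesh n r i * sqrt (8 * 2 ^ i * l)"
    using mesh_nonneg assms by (intro mult_left_mono) auto
  also have "\<dots> = 32 * sqrt ((2 * r * l / 2 ^ i) * (8 * 2 ^ i * l))"
    by (simp only: mesh_def l_def mult.assoc flip: real_sqrt_mult)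
  also have "(2 * r * l / 2 ^ i) * (8 * 2 ^ i * l) = r * (4 * l)\<^sup>2" by (simp add: power2_eq_square)
  also have "32 * sqrt (r * (4 * l)\<^sup>2) = 128 * sqrt r * l" using l by (simp add: real_sqrt_mult)
  finally show ?thesis unfolding l_def .
qed

text \<open>
  Chaining for the decoupled chaos.  The difference of the pairings at two consecutive levels splits
  into two terms; in each of them one factor is an increment, and the maximal inequality is applied
  to its signs with the other signs fixed.  These two terms give the factor 2 in \<open>256 = 2 \<cdot> 128\<close>.
\<close>
lemma decoupled_chaos_Max_le:
  assumes \<Omega>: "\<Omega> \<subseteq> {..<n}" and S: "S \<subseteq> {..<n}" and K: "K > 0" and n: "n > 0" and r: "r \<ge> 0"
  defines "X \<equiv> grid_ball n r (2 ^ K)"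
  shows "ravg {..<n} (\<lambda>\<epsilon>. Max ((\<lambda>x. \<bar>\<Sum>k\<in>S. \<Sum>l\<in>{..<n} - S.
      (\<Sum>j\<in>\<Omega>. x (cyc_sub n j k) * x (cyc_sub n j l)) * \<epsilon> k * \<epsilon> l\<bar>) ` X))
    \<le> 256 * real K * sqrt r * ln (4 * real n) * ravg {..<n} (maxnorm n \<Omega> X)" (is "ravg _ ?M \<le> _")
proof -
  have fX: "finite X" "X \<noteq> {}" by (simp_all add: X_def)
  define N where "N = maxnorm n \<Omega> X"
  define R where "R = {..<n} - S"
  have fin: "finite S" "finite R" "R \<subseteq> {..<n}" using S finite_subset by (auto simp: R_def)
  obtain g where g:
    "\<And>i. i \<le> K \<Longrightarrow> g i \<in> X \<rightarrow> X"
    "\<And>i. i \<le> K \<Longrightarrow> card (g i ` X) \<le> (2 * n + 1) ^ (2 ^ i)"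
    "\<And>i x \<omega>. i \<le> K \<Longrightarrow> x \<in> X \<Longrightarrow> \<omega> < n \<Longrightarrow> cmod (dft n (\<lambda>k. x k - g i x k) \<omega>) \<le> 16 * mesh n r i"
    "\<And>x. g 0 x = (\<lambda>_. 0)" "\<And>x. g K x = x"
    using coarsening_maps[OF K n r] unfolding X_def by blast
  define T where "T d y a b = (\<Sum>j\<in>\<Omega>. cconv n d a j * cconv n y b j)" for d y a b
  define P where "P i h = (\<lambda>x. ((\<lambda>k. g (Suc i) x k - g i x k), g h x)) ` X" for i h
  define M where "M i h a b = Max ((\<lambda>(d, y). \<bar>T d y a b\<bar>) ` P i h)" for i h a b
  define G where "G = 128 * sqrt r * ln (4 * real n)"
  have "ln (4 * real n) \<ge> 0" using n by simp
  then have "G \<ge> 0" using r by (simp add: G_def)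
  have fP: "finite (P i h)" "P i h \<noteq> {}" for i h using fX by (auto simp: P_def)
  have M_ge: "\<bar>T (\<lambda>k. g (Suc i) x k - g i x k) (g h x) a b\<bar> \<le> M i h a b" if "x \<in> X" for i h x a b
    unfolding M_def using fP that by (intro Max_ge) (auto simp: P_def)

  have step: "ravg Q (\<lambda>a. M i h a b) \<le> G * N b"
    if Q: "Q \<subseteq> {..<n}" and i: "i < K" and h: "h = i \<or> h = Suc i" for Q i h b
  proof -
    \<comment> \<open>There are at most as many links as pairs of values of the two maps.\<close>
    have cP: "real (card (P i h)) \<le> (2 * real n + 1) ^ (3 * 2 ^ i)"
    proof -
      have "P i h \<subseteq> (\<lambda>(p, q). ((\<lambda>k. p k - q k), if h = i then q else p)) ` (g (Suc i) ` X \<times> g i ` X)"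
      proof
        fix z assume "z \<in> P i h"
        then obtain x where "x \<in> X" "z = ((\<lambda>k. g (Suc i) x k - g i x k), g h x)" by (auto simp: P_def)
        then show "z \<in> (\<lambda>(p, q). ((\<lambda>k. p k - q k), if h = i then q else p)) ` (g (Suc i) ` X \<times> g i ` X)"
          using h by (intro image_eqI[of _ _ "(g (Suc i) x, g i x)"]) auto
      qed
      then have "card (P i h) \<le> card (g (Suc i) ` X \<times> g i ` X)"
        using fX by (intro surj_card_le) auto
      also have "\<dots> \<le> (2 * n + 1) ^ (2 ^ Suc i) * (2 * n + 1) ^ (2 ^ i)"
        unfolding card_cartesian_product using g(2)[of i] g(2)[of "Suc i"] i by (intro mult_le_mono) auto
      also have "\<dots> = (2 * n + 1) ^ (3 * 2 ^ i)" by (simp flip: power_add)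
      finally have "real (card (P i h)) \<le> real ((2 * n + 1) ^ (3 * 2 ^ i))" by (rule of_nat_mono)
      then show ?thesis by (simp add: add.commute)
    qed
    have "card (P i h) \<ge> 1" using fP[of i h] by (simp add: Suc_le_eq card_gt_0_iff)
    have "ravg Q (\<lambda>a. M i h a b) \<le> 32 * mesh n r i * N b * sqrt (2 * ln (2 * real (card (P i h))))"
      unfolding M_def T_def
    proof (rule decoupled_increment_Max_le[OF \<Omega> Q fP])
      show "0 \<le> 32 * mesh n r i" using mesh_nonneg[OF n r] by simp
      fix d y assume "(d, y) \<in> P i h"
      then obtain x where x: "x \<in> X" "d = (\<lambda>k. g (Suc i) x k - g i x k)" "y = g h x"
        by (auto simp: P_def)
      have "g h x \<in> X" using g(1)[of h] h i x(1) by auto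
      then show "L2_set (cconv n y b) \<Omega> \<le> N b"
        unfolding N_def x(3) by (intro maxnorm_ge fX)
      fix \<omega> assume \<omega>: "\<omega> < n"
      have "dft n d \<omega> = dft n (\<lambda>k. x k - g i x k) \<omega> - dft n (\<lambda>k. x k - g (Suc i) x k) \<omega>"
        by (simp add: x(2) dft_diff)
      then have "cmod (dft n d \<omega>) \<le> cmod (dft n (\<lambda>k. x k - g i x k) \<omega>) + cmod (dft n (\<lambda>k. x k - g (Suc i) x k) \<omega>)"
        by (simp only: norm_triangle_ineq4)
      also have "\<dots> \<le> 16 * mesh n r i + 16 * mesh n r (Suc i)"
        using i x(1) \<omega> by (intro add_mono g(3)) auto
      also have "mesh n r (Suc i) \<le> mesh n r i"
        using mesh_nonneg[OF n r, of i] by (simp add: mesh_Suc divide_le_eq mult_left_le_one_le mult_right_le_one_le)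
          (metis mult.right_neutral mult_left_mono one_le_numeral real_sqrt_ge_1_iff)
      finally show "cmod (dft n d \<omega>) \<le> 32 * mesh n r i" by simp
    qed
    also have "\<dots> = N b * (32 * mesh n r i * sqrt (2 * ln (2 * real (card (P i h)))))" by simp
    also have "\<dots> \<le> N b * G"
      unfolding G_def N_def using \<open>card (P i h) \<ge> 1\<close> cP
      by (intro mult_left_mono mesh_entropy_product n r maxnorm_nonneg fX) auto
    finally show ?thesis by (simp add: mult.commute)
  qed

  have pointwise: "?M (\<lambda>i. \<alpha> i + \<beta> i) \<le> (\<Sum>i<K. M i (Suc i) \<alpha> \<beta> + M i i \<beta> \<alpha>)"
    if \<alpha>: "\<alpha> \<in> sign_vecs S" and \<beta>: "\<beta> \<in> sign_vecs R" for \<alpha> \<beta>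
  proof -
    have "\<bar>\<Sum>k\<in>S. \<Sum>l\<in>{..<n} - S. (\<Sum>j\<in>\<Omega>. x (cyc_sub n j k) * x (cyc_sub n j l))
        * (\<alpha> k + \<beta> k) * (\<alpha> l + \<beta> l)\<bar> \<le> (\<Sum>i<K. M i (Suc i) \<alpha> \<beta> + M i i \<beta> \<alpha>)"
      (is "\<bar>?F\<bar> \<le> _") if x: "x \<in> X" for x
    proof -
      define B where "B i = T (g i x) (g i x) \<alpha> \<beta>" for i
      have "?F = (\<Sum>k\<in>S. \<Sum>l\<in>R. \<Sum>j\<in>\<Omega>. (x (cyc_sub n j k) * \<alpha> k) * (x (cyc_sub n j l) * \<beta> l))"
      proof -
        have "\<beta> k = 0" if "k \<in> S" for k using \<beta> that by (intro sign_vecs_outside[OF \<beta>]) (auto simp: R_def)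
        moreover have "\<alpha> l = 0" if "l \<in> R" for l using that by (intro sign_vecs_outside[OF \<alpha>]) (auto simp: R_def)
        ultimately show ?thesis
          unfolding R_def[symmetric] by (intro sum.cong refl) (simp add: sum_distrib_left sum_distrib_right mult_ac)
      qed
      also have "\<dots> = (\<Sum>k\<in>S. \<Sum>j\<in>\<Omega>. \<Sum>l\<in>R. (x (cyc_sub n j k) * \<alpha> k) * (x (cyc_sub n j l) * \<beta> l))"
        by (intro sum.cong refl sum.swap)
      also have "\<dots> = (\<Sum>j\<in>\<Omega>. \<Sum>k\<in>S. \<Sum>l\<in>R. (x (cyc_sub n j k) * \<alpha> k) * (x (cyc_sub n j l) * \<beta> l))"
        by (rule sum.swap)
      also have "\<dots> = T x x \<alpha> \<beta>"
        unfolding T_def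
      proof (intro sum.cong refl)
        fix j assume "j \<in> \<Omega>"
        then have "j < n" using \<Omega> by auto
        then show "(\<Sum>k\<in>S. \<Sum>l\<in>R. (x (cyc_sub n j k) * \<alpha> k) * (x (cyc_sub n j l) * \<beta> l))
            = cconv n x \<alpha> j * cconv n x \<beta> j"
          using S fin sign_vecs_outside[OF \<alpha>] sign_vecs_outside[OF \<beta>]
          by (simp add: cconv_supported[of j n S \<alpha>] cconv_supported[of j n R \<beta>] sum_product)
      qed
      also have "\<dots> = B K - B 0" by (simp add: B_def g(4,5) T_def)
      also have "\<dots> = (\<Sum>i<K. B (Suc i) - B i)" by (rule sum_lessThan_telescope[symmetric])
      finally have "\<bar>?F\<bar> \<le> (\<Sum>i<K. \<bar>B (Suc i) - B i\<bar>)" using sum_abs by simp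
      also have "\<dots> \<le> (\<Sum>i<K. M i (Suc i) \<alpha> \<beta> + M i i \<beta> \<alpha>)"
      proof (rule sum_mono)
        fix i
        define d where "d = (\<lambda>k. g (Suc i) x k - g i x k)"
        have "B (Suc i) - B i = T d (g (Suc i) x) \<alpha> \<beta> + T d (g i x) \<beta> \<alpha>"
          by (simp add: B_def T_def d_def cconv_diff_left algebra_simps flip: sum.distrib sum_subtractf)
        then show "\<bar>B (Suc i) - B i\<bar> \<le> M i (Suc i) \<alpha> \<beta> + M i i \<beta> \<alpha>"
          using M_ge[OF x, of i "Suc i" \<alpha> \<beta>] M_ge[OF x, of i i \<beta> \<alpha>] unfolding d_def by linarith
      qed
      finally show ?thesis .
    qed
    then show ?thesis using fX by (subst Max_le_iff) auto
  qed

  have "ravg {..<n} ?M = ravg S (\<lambda>\<alpha>. ravg R (\<lambda>\<beta>. ?M (\<lambda>i. \<alpha> i + \<beta> i)))"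
    unfolding R_def by (rule ravg_split[OF _ S]) simp
  also have "\<dots> \<le> ravg S (\<lambda>\<alpha>. ravg R (\<lambda>\<beta>. \<Sum>i<K. M i (Suc i) \<alpha> \<beta> + M i i \<beta> \<alpha>))"
    by (intro ravg_mono pointwise)
  also have "\<dots> = (\<Sum>i<K. ravg S (\<lambda>\<alpha>. ravg R (\<lambda>\<beta>. M i (Suc i) \<alpha> \<beta>)) + ravg S (\<lambda>\<alpha>. ravg R (\<lambda>\<beta>. M i i \<beta> \<alpha>)))"
    by (simp only: ravg_sum ravg_add)
  also have "\<dots> = (\<Sum>i<K. ravg R (\<lambda>\<beta>. ravg S (\<lambda>\<alpha>. M i (Suc i) \<alpha> \<beta>)) + ravg S (\<lambda>\<alpha>. ravg R (\<lambda>\<beta>. M i i \<beta> \<alpha>)))"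
    by (intro sum.cong refl arg_cong2[of _ _ _ _ "(+)"] ravg_swap)
  also have "\<dots> \<le> (\<Sum>i<K. ravg R (\<lambda>\<beta>. G * N \<beta>) + ravg S (\<lambda>\<alpha>. G * N \<alpha>))"
    using S fin by (intro sum_mono add_mono ravg_mono step) auto
  also have "\<dots> \<le> (\<Sum>i<K. G * ravg {..<n} N + G * ravg {..<n} N)"
    unfolding ravg_cmult N_def using S fin fX \<open>G \<ge> 0\<close>
    by (intro sum_mono add_mono mult_left_mono ravg_maxnorm_subset_le) auto
  also have "\<dots> = 256 * real K * sqrt r * ln (4 * real n) * ravg {..<n} (maxnorm n \<Omega> X)"
    by (simp add: G_def N_def)
  finally show ?thesis .
qed

text \<open>
  Since squared signs are 1, the diagonal of the quadratic form in the generator sums to \<open>|\<Omega>|\<close> times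
  the squared norm of \<open>x\<close>; the deviation of the energy from its mean is exactly an off-diagonal
  form.
\<close>
lemma cconv_energy_eq_chaos:
  assumes \<Omega>: "\<Omega> \<subseteq> {..<n}" and \<epsilon>: "\<epsilon> \<in> sign_vecs {..<n}"
  shows "(\<Sum>j\<in>\<Omega>. (cconv n x \<epsilon> j)\<^sup>2) - card \<Omega> * (L2_set x {..<n})\<^sup>2
    = (\<Sum>k<n. \<Sum>l\<in>{..<n} - {k}. (\<Sum>j\<in>\<Omega>. x (cyc_sub n j k) * x (cyc_sub n j l)) * \<epsilon> k * \<epsilon> l)"
proof -
  define c where "c k l = (\<Sum>j\<in>\<Omega>. x (cyc_sub n j k) * x (cyc_sub n j l))" for k l
  have "(\<Sum>j\<in>\<Omega>. (cconv n x \<epsilon> j)\<^sup>2)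
      = (\<Sum>j\<in>\<Omega>. \<Sum>k<n. \<Sum>l<n. x (cyc_sub n j k) * x (cyc_sub n j l) * \<epsilon> k * \<epsilon> l)"
  proof (intro sum.cong refl)
    fix j assume "j \<in> \<Omega>"
    then have "j < n" using \<Omega> by auto
    then show "(cconv n x \<epsilon> j)\<^sup>2 = (\<Sum>k<n. \<Sum>l<n. x (cyc_sub n j k) * x (cyc_sub n j l) * \<epsilon> k * \<epsilon> l)"
      by (simp add: cconv_commute power2_eq_square sum_product mult_ac)
  qed
  also have "\<dots> = (\<Sum>k<n. \<Sum>j\<in>\<Omega>. \<Sum>l<n. x (cyc_sub n j k) * x (cyc_sub n j l) * \<epsilon> k * \<epsilon> l)"
    by (rule sum.swap)
  also have "\<dots> = (\<Sum>k<n. \<Sum>l<n. \<Sum>j\<in>\<Omega>. x (cyc_sub n j k) * x (cyc_sub n j l) * \<epsilon> k * \<epsilon> l)"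
    by (intro sum.cong refl sum.swap)
  also have "\<dots> = (\<Sum>k<n. \<Sum>l<n. c k l * \<epsilon> k * \<epsilon> l)" by (simp add: c_def sum_distrib_right)
  also have "\<dots> = (\<Sum>k<n. c k k * \<epsilon> k * \<epsilon> k + (\<Sum>l\<in>{..<n} - {k}. c k l * \<epsilon> k * \<epsilon> l))"
    by (intro sum.cong refl sum.remove) auto
  also have "\<dots> = (\<Sum>k<n. c k k) + (\<Sum>k<n. \<Sum>l\<in>{..<n} - {k}. c k l * \<epsilon> k * \<epsilon> l)"
    using sign_vecs_sq[OF \<epsilon>] by (simp add: sum.distrib mult.assoc flip: power2_eq_square)
  also have "(\<Sum>k<n. c k k) = (\<Sum>j\<in>\<Omega>. \<Sum>k<n. (x (cyc_sub n j k))\<^sup>2)"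
    unfolding c_def by (subst sum.swap) (simp add: power2_eq_square)
  also have "\<dots> = (\<Sum>j\<in>\<Omega>. \<Sum>k<n. (x k)\<^sup>2)"
  proof (rule sum.cong[OF refl])
    fix j assume "j \<in> \<Omega>"
    then have "j < n" using \<Omega> by auto
    then show "(\<Sum>k<n. (x (cyc_sub n j k))\<^sup>2) = (\<Sum>k<n. (x k)\<^sup>2)"
      by (intro sum.reindex_bij_betw[OF bij_betw_cyc_sub_right])
  qed
  also have "\<dots> = card \<Omega> * (L2_set x {..<n})\<^sup>2" by (simp add: L2_set_square)
  finally show ?thesis by (simp add: c_def)
qed

definition deviation :: "nat \<Rightarrow> nat set \<Rightarrow> (nat \<Rightarrow> real) set \<Rightarrow> (nat \<Rightarrow> real) \<Rightarrow> real" where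
  "deviation n \<Omega> X \<epsilon> =
     Max ((\<lambda>x. \<bar>(\<Sum>j\<in>\<Omega>. (cconv n x \<epsilon> j)\<^sup>2) - card \<Omega> * (L2_set x {..<n})\<^sup>2\<bar>) ` X)"

text \<open>
  The norms that appear as weights in the chaining are themselves controlled by the deviation,
  because an energy is at most its mean plus its deviation.
\<close>
lemma ravg_deviation_self_bound:
  assumes \<Omega>: "\<Omega> \<subseteq> {..<n}" and K: "K > 0" and n: "n > 0" and r: "r \<ge> 0"
  defines "X \<equiv> grid_ball n r (2 ^ K)"
  shows "ravg {..<n} (deviation n \<Omega> X)
    \<le> 1024 * real K * sqrt r * ln (4 * real n) * sqrt (ravg {..<n} (deviation n \<Omega> X) + card \<Omega>)"
proof -
  have fX: "finite X" "X \<noteq> {}" by (simp_all add: X_def)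
  define V where "V = ravg {..<n} (deviation n \<Omega> X)"
  define EN where "EN = ravg {..<n} (maxnorm n \<Omega> X)"
  have "ln (4 * real n) \<ge> 0" using n by simp
  have "V = ravg {..<n} (\<lambda>\<epsilon>. Max ((\<lambda>x. \<bar>\<Sum>k<n. \<Sum>l\<in>{..<n} - {k}.
      (\<Sum>j\<in>\<Omega>. x (cyc_sub n j k) * x (cyc_sub n j l)) * \<epsilon> k * \<epsilon> l\<bar>) ` X))"
    unfolding V_def deviation_def by (intro ravg_cong) (simp add: cconv_energy_eq_chaos[OF \<Omega>])
  also have "\<dots> \<le> 4 * (256 * real K * sqrt r * ln (4 * real n) * EN)"
    unfolding EN_def X_def
    by (rule decoupling_Max) (simp, simp, simp, erule decoupled_chaos_Max_le[OF \<Omega> _ K n r])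
  also have "\<dots> = 1024 * real K * sqrt r * ln (4 * real n) * EN" by simp
  also have "\<dots> \<le> 1024 * real K * sqrt r * ln (4 * real n) * sqrt (V + card \<Omega>)"
  proof (intro mult_left_mono real_le_rsqrt)
    have "EN\<^sup>2 \<le> ravg {..<n} (\<lambda>\<epsilon>. (maxnorm n \<Omega> X \<epsilon>)\<^sup>2)"
      unfolding EN_def by (rule ravg_square_le) simp
    also have "\<dots> \<le> ravg {..<n} (\<lambda>\<epsilon>. deviation n \<Omega> X \<epsilon> + card \<Omega>)"
    proof (rule ravg_mono)
      fix \<epsilon>
      have "maxnorm n \<Omega> X \<epsilon> \<in> (\<lambda>x. L2_set (cconv n x \<epsilon>) \<Omega>) ` X"
        unfolding maxnorm_def using fX by (intro Max_in) auto
      then obtain x where x: "x \<in> X" "maxnorm n \<Omega> X \<epsilon> = L2_set (cconv n x \<epsilon>) \<Omega>" by auto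
      have "\<bar>(\<Sum>j\<in>\<Omega>. (cconv n x \<epsilon> j)\<^sup>2) - card \<Omega> * (L2_set x {..<n})\<^sup>2\<bar> \<le> deviation n \<Omega> X \<epsilon>"
        unfolding deviation_def using fX x(1) by (intro Max_ge) auto
      moreover have "(L2_set x {..<n})\<^sup>2 \<le> 1"
        using x(1) by (auto simp: X_def grid_ball_def power_le_one)
      then have "card \<Omega> * (L2_set x {..<n})\<^sup>2 \<le> real (card \<Omega>) * 1" by (intro mult_left_mono) auto
      ultimately show "(maxnorm n \<Omega> X \<epsilon>)\<^sup>2 \<le> deviation n \<Omega> X \<epsilon> + card \<Omega>"
        unfolding x(2) L2_set_square by linarith
    qed
    also have "\<dots> = V + card \<Omega>" unfolding V_def by (simp add: ravg_add)
    finally show "EN\<^sup>2 \<le> V + card \<Omega>" .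
  qed (use \<open>ln (4 * real n) \<ge> 0\<close> r in auto)
  finally show ?thesis unfolding V_def .
qed

lemma deviation_nonneg: "finite X \<Longrightarrow> X \<noteq> {} \<Longrightarrow> deviation n \<Omega> X \<epsilon> \<ge> 0"
  unfolding deviation_def by (subst Max_ge_iff) auto

text \<open>
  If \<open>V\<close> exceeded \<open>2 b sqrt m\<close>, then \<open>b\<^sup>2 \<le> b sqrt m < V / 2\<close>, and \<open>V\<^sup>2 \<le> b\<^sup>2 (V + m)\<close> would give
  \<open>V\<^sup>2 \<le> 2 b\<^sup>2 m\<close>, which is less than \<open>V\<^sup>2\<close>.
\<close>
lemma self_bound_solve:
  fixes V m b :: real
  assumes "V \<ge> 0" "m > 0" "b \<ge> 0" "V \<le> b * sqrt (V + m)" "b \<le> sqrt m"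
  shows "V \<le> 2 * b * sqrt m"
proof (rule ccontr)
  assume *: "\<not> V \<le> 2 * b * sqrt m"
  have "V\<^sup>2 \<le> (b * sqrt (V + m))\<^sup>2" using assms by (intro power_mono)
  also have "\<dots> = b\<^sup>2 * (V + m)" using assms by (simp add: power_mult_distrib)
  finally have 1: "V\<^sup>2 \<le> b\<^sup>2 * V + b\<^sup>2 * m" by (simp add: distrib_left)
  have "b * b \<le> b * sqrt m" using assms by (intro mult_left_mono)
  then have "b\<^sup>2 \<le> V / 2" using * by (simp add: power2_eq_square)
  then have "b\<^sup>2 * V \<le> V / 2 * V" using assms by (intro mult_right_mono)
  with 1 have 2: "V\<^sup>2 \<le> 2 * b\<^sup>2 * m" by (simp add: power2_eq_square)
  have "(2 * b * sqrt m)\<^sup>2 < V\<^sup>2" using * assms by (intro power_strict_mono) auto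
  then have "4 * b\<^sup>2 * m < V\<^sup>2" using assms by (simp add: power_mult_distrib)
  moreover have "0 \<le> b\<^sup>2 * m" using assms by simp
  ultimately show False using 2 by simp
qed

lemma ravg_deviation_le:
  assumes \<Omega>: "\<Omega> \<subseteq> {..<n}" "\<Omega> \<noteq> {}" and K: "K > 0" and r: "r \<ge> 0"
    and b: "1024 * real K * sqrt r * ln (4 * real n) \<le> sqrt (card \<Omega>)"
  shows "ravg {..<n} (deviation n \<Omega> (grid_ball n r (2 ^ K)))
    \<le> 2 * (1024 * real K * sqrt r * ln (4 * real n)) * sqrt (card \<Omega>)"
proof -
  have n: "n > 0" using \<Omega> by (cases n) auto
  have "finite \<Omega>" using \<Omega>(1) finite_subset by blast
  show ?thesis
  proof (rule self_bound_solve[OF _ _ _ ravg_deviation_self_bound[OF \<Omega>(1) K n r] b])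
    show "0 \<le> ravg {..<n} (deviation n \<Omega> (grid_ball n r (2 ^ K)))"
      by (intro ravg_nonneg deviation_nonneg) auto
    show "0 < real (card \<Omega>)" using \<Omega> \<open>finite \<Omega>\<close> by (simp add: card_gt_0_iff)
    show "0 \<le> 1024 * real K * sqrt r * ln (4 * real n)" using n r by simp
  qed
qed

section \<open>Symmetric forms controlled on a net\<close>

definition bform :: "nat \<Rightarrow> (nat \<Rightarrow> nat \<Rightarrow> real) \<Rightarrow> (nat \<Rightarrow> real) \<Rightarrow> (nat \<Rightarrow> real) \<Rightarrow> real" where
  "bform n H u v = (\<Sum>k<n. \<Sum>l<n. H k l * u k * v l)"

lemma bform_add_left: "bform n H (\<lambda>k. u k + w k) v = bform n H u v + bform n H w v"
  by (simp add: bform_def algebra_simps sum.distrib)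

lemma bform_add_right: "bform n H u (\<lambda>k. v k + w k) = bform n H u v + bform n H u w"
  by (simp add: bform_def algebra_simps sum.distrib)

lemma bform_diff_left: "bform n H (\<lambda>k. u k - w k) v = bform n H u v - bform n H w v"
  by (simp add: bform_def algebra_simps sum_subtractf)

lemma bform_diff_right: "bform n H u (\<lambda>k. v k - w k) = bform n H u v - bform n H u w"
  by (simp add: bform_def algebra_simps sum_subtractf)

lemma bform_scale_left: "bform n H (\<lambda>k. a * u k) v = a * bform n H u v"
  by (simp add: bform_def sum_distrib_left mult_ac)

lemma bform_scale_right: "bform n H u (\<lambda>k. a * v k) = a * bform n H u v"
  by (simp add: bform_def sum_distrib_left mult_ac)

lemma bform_commute:
  assumes "\<And>k l. k < n \<Longrightarrow> l < n \<Longrightarrow> H k l = H l k"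
  shows "bform n H u v = bform n H v u"
  unfolding bform_def by (subst sum.swap) (auto intro!: sum.cong simp: assms mult_ac)

lemma bform_le:
  assumes "\<And>k. k < n \<Longrightarrow> \<bar>u k\<bar> \<le> 1" "\<And>k. k < n \<Longrightarrow> \<bar>v k\<bar> \<le> 1"
  shows "\<bar>bform n H u v\<bar> \<le> (\<Sum>k<n. \<Sum>l<n. \<bar>H k l\<bar>)"
proof -
  have "\<bar>bform n H u v\<bar> \<le> (\<Sum>k<n. \<Sum>l<n. \<bar>H k l * u k * v l\<bar>)"
    unfolding bform_def by (rule order_trans[OF sum_abs]) (intro sum_mono sum_abs)
  also have "\<dots> \<le> (\<Sum>k<n. \<Sum>l<n. \<bar>H k l\<bar>)"
  proof (intro sum_mono)
    fix k l assume kl: "k \<in> {..<n}" "l \<in> {..<n}"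
    have "\<bar>u k\<bar> * \<bar>v l\<bar> \<le> 1 * 1" using kl assms by (intro mult_mono) auto
    then have "\<bar>H k l\<bar> * (\<bar>u k\<bar> * \<bar>v l\<bar>) \<le> \<bar>H k l\<bar> * 1" by (intro mult_left_mono) auto
    then show "\<bar>H k l * u k * v l\<bar> \<le> \<bar>H k l\<bar>" by (simp add: abs_mult mult.assoc)
  qed
  finally show ?thesis .
qed

lemma L2_set_abs_member_le: "finite A \<Longrightarrow> i \<in> A \<Longrightarrow> \<bar>f i\<bar> \<le> L2_set f A"
  using member_le_L2_set[of A i "\<lambda>i. \<bar>f i\<bar>"] by (simp add: L2_set_def)

lemma L2_set_scale: "L2_set (\<lambda>k. a * f k) A = \<bar>a\<bar> * L2_set f A"
  by (simp add: L2_set_def power_mult_distrib real_sqrt_mult flip: sum_distrib_left)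

lemma L2_set_normalise:
  assumes "L2_set u A \<noteq> 0"
  shows "L2_set (\<lambda>k. 1 / L2_set u A * u k) A = 1"
  unfolding L2_set_scale using assms by simp

lemma bform_L2_zero_left:
  assumes "L2_set u {..<n} = 0"
  shows "bform n H u v = 0"
proof -
  have "\<forall>i\<in>{..<n}. u i = 0" using assms by (simp add: L2_set_eq_0_iff)
  then show ?thesis by (simp add: bform_def)
qed

lemma bform_L2_zero_right:
  assumes "L2_set v {..<n} = 0"
  shows "bform n H u v = 0"
proof -
  have "\<forall>i\<in>{..<n}. v i = 0" using assms by (simp add: L2_set_eq_0_iff)
  then show ?thesis by (simp add: bform_def)
qed

lemma L2_set_parallelogram:
  "(L2_set (\<lambda>k. u k + v k) A)\<^sup>2 + (L2_set (\<lambda>k. u k - v k) A)\<^sup>2 = 2 * (L2_set u A)\<^sup>2 + 2 * (L2_set v A)\<^sup>2"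
proof -
  have "(L2_set (\<lambda>k. u k + v k) A)\<^sup>2 + (L2_set (\<lambda>k. u k - v k) A)\<^sup>2
      = (\<Sum>k\<in>A. (u k + v k)\<^sup>2 + (u k - v k)\<^sup>2)" by (simp add: L2_set_square sum.distrib)
  also have "\<dots> = (\<Sum>k\<in>A. 2 * (u k)\<^sup>2 + 2 * (v k)\<^sup>2)"
    by (intro sum.cong refl) (simp add: power2_eq_square algebra_simps)
  finally show ?thesis by (simp add: L2_set_square sum.distrib sum_distrib_left)
qed

abbreviation supported_on :: "nat set \<Rightarrow> (nat \<Rightarrow> real) \<Rightarrow> bool" where
  "supported_on T x \<equiv> \<forall>i. i \<notin> T \<longrightarrow> x i = 0"

text \<open>
  Polarisation: on the subspace of vectors supported on \<open>T\<close> a symmetric form is bounded by its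
  quadratic form.
\<close>
lemma bform_le_of_quadratic:
  assumes sym: "\<And>k l. k < n \<Longrightarrow> l < n \<Longrightarrow> H k l = H l k"
    and q: "\<And>x. supported_on T x \<Longrightarrow> L2_set x {..<n} \<le> 1 \<Longrightarrow> \<bar>bform n H x x\<bar> \<le> S"
    and u: "supported_on T u" and v: "supported_on T v"
  shows "\<bar>bform n H u v\<bar> \<le> S * L2_set u {..<n} * L2_set v {..<n}"
proof -
  define N where "N x = L2_set x {..<n}" for x
  have quad: "\<bar>bform n H w w\<bar> \<le> S * (N w)\<^sup>2" if w: "supported_on T w" for w
  proof (cases "N w = 0")
    case True
    then show ?thesis by (simp add: N_def bform_L2_zero_left)
  next
    case False
    have "\<bar>bform n H (\<lambda>k. 1 / N w * w k) (\<lambda>k. 1 / N w * w k)\<bar> \<le> S"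
      using w False unfolding N_def by (intro q) (auto simp: L2_set_normalise simp del: times_divide_eq_left)
    then have "\<bar>bform n H w w\<bar> / (N w)\<^sup>2 \<le> S"
      unfolding bform_scale_left bform_scale_right by (simp add: abs_mult power2_eq_square)
    then show ?thesis using False by (simp add: divide_le_eq)
  qed
  have unit: "\<bar>bform n H u v\<bar> \<le> S"
    if "supported_on T u" "supported_on T v" "N u = 1" "N v = 1" for u v
  proof -
    have "4 * bform n H u v = bform n H (\<lambda>k. u k + v k) (\<lambda>k. u k + v k) - bform n H (\<lambda>k. u k - v k) (\<lambda>k. u k - v k)"
      unfolding bform_add_left bform_add_right bform_diff_left bform_diff_right
      using bform_commute[of n H u v, OF sym] by simp
    moreover have "\<bar>bform n H (\<lambda>k. u k + v k) (\<lambda>k. u k + v k)\<bar> \<le> S * (N (\<lambda>k. u k + v k))\<^sup>2"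
      "\<bar>bform n H (\<lambda>k. u k - v k) (\<lambda>k. u k - v k)\<bar> \<le> S * (N (\<lambda>k. u k - v k))\<^sup>2"
      using that by (auto intro!: quad)
    moreover have "S * (N (\<lambda>k. u k + v k))\<^sup>2 + S * (N (\<lambda>k. u k - v k))\<^sup>2 = S * 4"
      unfolding distrib_left[symmetric] N_def L2_set_parallelogram using that by (simp add: N_def)
    ultimately show ?thesis by linarith
  qed
  show ?thesis
  proof (cases "N u = 0 \<or> N v = 0")
    case True
    then show ?thesis by (auto simp: N_def bform_L2_zero_left bform_L2_zero_right)
  next
    case False
    have "\<bar>bform n H (\<lambda>k. 1 / N u * u k) (\<lambda>k. 1 / N v * v k)\<bar> \<le> S"
      using u v False unfolding N_def by (intro unit) (auto simp: N_def L2_set_normalise simp del: times_divide_eq_left)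
    then have "\<bar>bform n H u v\<bar> / (N u * N v) \<le> S"
      unfolding bform_scale_left bform_scale_right by (simp add: abs_mult N_def mult.commute)
    moreover have "N u * N v > 0" using False by (simp add: N_def less_le)
    ultimately show ?thesis by (simp add: divide_le_eq N_def mult.assoc)
  qed
qed

text \<open>
  The usual net argument.  With \<open>S\<close> the supremum of the quadratic form over the unit ball, moving
  from \<open>x\<close> to the net point \<open>y\<close> changes the form by at most \<open>S |x - y| |x + y| \<le> S / 2\<close>, hence \<open>S \<le>
  \<mu> + S / 2\<close>.
\<close>
lemma bform_le_of_net:
  assumes sym: "\<And>k l. k < n \<Longrightarrow> l < n \<Longrightarrow> H k l = H l k"
    and net: "\<And>x. supported_on T x \<Longrightarrow> L2_set x {..<n} \<le> 1 \<Longrightarrow>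
      \<exists>y. supported_on T y \<and> L2_set y {..<n} \<le> 1 \<and> L2_set (\<lambda>k. x k - y k) {..<n} \<le> 1/4
        \<and> \<bar>bform n H y y\<bar> \<le> \<mu>"
    and u: "supported_on T u" and v: "supported_on T v"
  shows "\<bar>bform n H u v\<bar> \<le> 2 * \<mu> * L2_set u {..<n} * L2_set v {..<n}"
proof -
  define Y where "Y = {x. supported_on T x \<and> L2_set x {..<n} \<le> 1}"
  define S where "S = (SUP x\<in>Y. \<bar>bform n H x x\<bar>)"
  have "(\<lambda>_. 0) \<in> Y" by (simp add: Y_def L2_set_def)
  then have Y: "Y \<noteq> {}" by blast
  have bdd: "bdd_above ((\<lambda>x. \<bar>bform n H x x\<bar>) ` Y)"
  proof (rule bdd_aboveI2)
    fix x assume x: "x \<in> Y"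
    have "\<bar>x k\<bar> \<le> 1" if "k < n" for k
      using L2_set_abs_member_le[of "{..<n}" k x] x that by (auto simp: Y_def)
    then show "\<bar>bform n H x x\<bar> \<le> (\<Sum>k<n. \<Sum>l<n. \<bar>H k l\<bar>)" by (intro bform_le) auto
  qed
  have S: "\<bar>bform n H x x\<bar> \<le> S" if "supported_on T x" "L2_set x {..<n} \<le> 1" for x
    unfolding S_def using that by (intro cSUP_upper bdd) (simp add: Y_def)
  have "S \<ge> 0" using S[of "\<lambda>_. 0"] by (simp add: L2_set_def bform_def)
  have "\<bar>bform n H x x\<bar> \<le> \<mu> + S / 2" if "x \<in> Y" for x
  proof -
    have "\<exists>y. supported_on T y \<and> L2_set y {..<n} \<le> 1
        \<and> L2_set (\<lambda>k. x k - y k) {..<n} \<le> 1/4 \<and> \<bar>bform n H y y\<bar> \<le> \<mu>"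
      by (rule net) (use that in \<open>auto simp: Y_def\<close>)
    then obtain y where y: "supported_on T y" "L2_set y {..<n} \<le> 1"
      "L2_set (\<lambda>k. x k - y k) {..<n} \<le> 1/4" "\<bar>bform n H y y\<bar> \<le> \<mu>"
      by (elim exE conjE)
    have "bform n H x x - bform n H y y = bform n H (\<lambda>k. x k - y k) (\<lambda>k. x k + y k)"
      unfolding bform_add_right bform_diff_left using bform_commute[of n H x y, OF sym] by simp
    moreover have "\<bar>bform n H (\<lambda>k. x k - y k) (\<lambda>k. x k + y k)\<bar>
        \<le> S * L2_set (\<lambda>k. x k - y k) {..<n} * L2_set (\<lambda>k. x k + y k) {..<n}"
      using that y by (intro bform_le_of_quadratic[where T = T] sym S) (auto simp: Y_def)
    moreover have "L2_set (\<lambda>k. x k + y k) {..<n} \<le> 2"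
      using L2_set_triangle_ineq[of x y "{..<n}"] that y by (simp add: Y_def)
    then have "S * L2_set (\<lambda>k. x k - y k) {..<n} * L2_set (\<lambda>k. x k + y k) {..<n} \<le> S * (1/4) * 2"
      using y(3) \<open>S \<ge> 0\<close> by (intro mult_mono) auto
    ultimately show ?thesis using y(4) by linarith
  qed
  then have "S \<le> \<mu> + S / 2" unfolding S_def by (intro cSUP_least Y)
  then have "S \<le> 2 * \<mu>" by simp
  have "\<bar>bform n H u v\<bar> \<le> S * L2_set u {..<n} * L2_set v {..<n}"
    by (rule bform_le_of_quadratic[OF sym S u v])
  also have "\<dots> \<le> 2 * \<mu> * L2_set u {..<n} * L2_set v {..<n}"
    using \<open>S \<le> 2 * \<mu>\<close> by (intro mult_right_mono) auto
  finally show ?thesis .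
qed

lemma sum_abs_le_sqrt_card_L2:
  "(\<Sum>k\<in>T. \<bar>x k\<bar>) \<le> sqrt (card T) * L2_set x T"
  using L2_set_mult_ineq[of "\<lambda>_. 1" x T] by (simp add: L2_set_constant)

text \<open>
  Rounding each coordinate towards zero to a multiple of \<open>sqrt r / M\<close> enlarges neither the support
  nor the norms, and moves an \<open>r\<close>-sparse vector by at most \<open>sqrt r \<cdot> sqrt r / M \<le> 1/4\<close>.  So the
  finest grid serves as the net, and the chain need not be continued to arbitrarily small scales.
\<close>
lemma sparse_rounding:
  assumes T: "T \<subseteq> {..<n}" "card T \<le> r" and r: "r \<ge> 1" and M: "4 * r \<le> M"
    and x: "supported_on T x" "L2_set x {..<n} \<le> 1"
  shows "\<exists>y\<in>grid_ball n r M. supported_on T y \<and> L2_set (\<lambda>k. x k - y k) {..<n} \<le> 1/4"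
proof -
  define h where "h = sqrt (real r) / real M"
  have h: "h > 0" using r M by (simp add: h_def)
  define z where "z k = (if x k \<ge> 0 then \<lfloor>\<bar>x k\<bar> / h\<rfloor> else - \<lfloor>\<bar>x k\<bar> / h\<rfloor>)" for k
  define y where "y = (\<lambda>k. h * of_int (z k))"
  have fl: "0 \<le> \<lfloor>\<bar>x k\<bar> / h\<rfloor>" "h * of_int \<lfloor>\<bar>x k\<bar> / h\<rfloor> \<le> \<bar>x k\<bar>" "\<bar>x k\<bar> - h \<le> h * of_int \<lfloor>\<bar>x k\<bar> / h\<rfloor>" for k
  proof -
    show "0 \<le> \<lfloor>\<bar>x k\<bar> / h\<rfloor>" using h by simp
    have "of_int \<lfloor>\<bar>x k\<bar> / h\<rfloor> \<le> \<bar>x k\<bar> / h" by simp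
    then show "h * of_int \<lfloor>\<bar>x k\<bar> / h\<rfloor> \<le> \<bar>x k\<bar>" using h by (simp add: le_divide_eq mult.commute)
    have "\<bar>x k\<bar> / h - 1 \<le> of_int \<lfloor>\<bar>x k\<bar> / h\<rfloor>" by linarith
    then have "h * (\<bar>x k\<bar> / h - 1) \<le> h * of_int \<lfloor>\<bar>x k\<bar> / h\<rfloor>" using h by (intro mult_left_mono) auto
    then show "\<bar>x k\<bar> - h \<le> h * of_int \<lfloor>\<bar>x k\<bar> / h\<rfloor>" using h by (simp add: right_diff_distrib)
  qed
  have fin: "finite T" using T(1) finite_subset by blast
  have zabs: "\<bar>z k\<bar> = \<lfloor>\<bar>x k\<bar> / h\<rfloor>" for k using fl(1)[of k] by (simp add: z_def)
  have y_le: "\<bar>y k\<bar> \<le> \<bar>x k\<bar>" for k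
    using fl(2)[of k] h zabs[of k] by (simp add: y_def abs_mult flip: of_int_abs)
  have xy: "\<bar>x k - y k\<bar> \<le> h" for k
    using fl(2)[of k] fl(3)[of k] h by (auto simp: y_def z_def abs_le_iff split: if_splits)
  have yT: "supported_on T y" using x(1) by (simp add: y_def z_def)
  have "y \<in> grid n r M"
  proof -
    have "h * of_int (\<Sum>k<n. \<bar>z k\<bar>) = (\<Sum>k<n. \<bar>y k\<bar>)"
      using h by (simp add: y_def abs_mult sum_distrib_left)
    also have "\<dots> \<le> (\<Sum>k<n. \<bar>x k\<bar>)" by (intro sum_mono y_le)
    also have "\<dots> = (\<Sum>k\<in>T. \<bar>x k\<bar>)" using T x by (intro sum.mono_neutral_right) auto
    also have "\<dots> \<le> sqrt (card T) * L2_set x T" by (rule sum_abs_le_sqrt_card_L2)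
    also have "\<dots> \<le> sqrt r * 1"
    proof (intro mult_mono)
      show "L2_set x T \<le> 1" using L2_set_subset_le[of "{..<n}" T x] T(1) x(2) by simp
    qed (use T in auto)
    also have "\<dots> = h * of_int (int M)" using r M by (simp add: h_def)
    finally have "real_of_int (\<Sum>k<n. \<bar>z k\<bar>) \<le> of_int (int M)" using h by simp
    then have "(\<Sum>k<n. \<bar>z k\<bar>) \<le> int M" by (simp only: of_int_le_iff)
    moreover have "\<forall>k\<ge>n. z k = 0"
    proof (intro allI impI)
      fix k assume "k \<ge> n"
      then have "k \<notin> T" using T(1) by auto
      then show "z k = 0" using x(1) by (simp add: z_def)
    qed
    ultimately show ?thesis unfolding grid_def y_def h_def by blast
  qed
  moreover have "L2_set y {..<n} \<le> 1"
  proof -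
    have "L2_set y {..<n} \<le> L2_set x {..<n}"
      unfolding L2_set_def using y_le by (intro real_sqrt_le_mono sum_mono) (simp add: abs_le_square_iff)
    then show ?thesis using x(2) by simp
  qed
  moreover have "L2_set (\<lambda>k. x k - y k) {..<n} \<le> 1/4"
  proof -
    have "(\<Sum>k<n. (x k - y k)\<^sup>2) = (\<Sum>k\<in>T. (x k - y k)\<^sup>2)"
      using T x(1) yT by (intro sum.mono_neutral_right) auto
    also have "\<dots> \<le> (\<Sum>k\<in>T. h\<^sup>2)" using xy h by (intro sum_mono) (simp add: abs_le_square_iff[symmetric])
    also have "\<dots> \<le> r * h\<^sup>2" using T by (simp add: mult_right_mono)
    also have "\<dots> = (r / M)\<^sup>2" by (simp add: h_def power_divide power2_eq_square)
    also have "\<dots> \<le> (1/4)\<^sup>2" using M r by (intro power_mono) (auto simp: divide_le_eq)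
    finally show ?thesis unfolding L2_set_def by (intro real_le_lsqrt) auto
  qed
  ultimately show ?thesis using yT by (auto simp: grid_ball_def)
qed

lemma sparse_bform_le:
  assumes sym: "\<And>k l. k < n \<Longrightarrow> l < n \<Longrightarrow> H k l = H l k"
    and net: "\<And>y. y \<in> grid_ball n r M \<Longrightarrow> \<bar>bform n H y y\<bar> \<le> \<mu>"
    and T: "T \<subseteq> {..<n}" "card T \<le> r" and r: "r \<ge> 1" and M: "4 * r \<le> M"
    and u: "supported_on T u" and v: "supported_on T v"
  shows "\<bar>bform n H u v\<bar> \<le> 2 * \<mu> * L2_set u {..<n} * L2_set v {..<n}"
proof (rule bform_le_of_net[OF sym _ u v])
  fix x assume "supported_on T x" "L2_set x {..<n} \<le> 1"
  then obtain y where "y \<in> grid_ball n r M" "supported_on T y" "L2_set (\<lambda>k. x k - y k) {..<n} \<le> 1/4"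
    using sparse_rounding[OF T r M] by blast
  then show "\<exists>y. supported_on T y \<and> L2_set y {..<n} \<le> 1 \<and> L2_set (\<lambda>k. x k - y k) {..<n} \<le> 1/4
        \<and> \<bar>bform n H y y\<bar> \<le> \<mu>"
    using net by (intro exI[of _ y]) (auto simp: grid_ball_def)
qed

lemma exists_top_subset:
  fixes f :: "'a \<Rightarrow> real"
  assumes "finite A" "s \<le> card A"
  shows "\<exists>T\<subseteq>A. card T = s \<and> (\<forall>t\<in>T. \<forall>k\<in>A - T. f k \<le> f t)"
  using assms(2)
proof (induction s)
  case 0
  then show ?case by (intro exI[of _ "{}"]) auto
next
  case (Suc s)
  then obtain T where T: "T \<subseteq> A" "card T = s" "\<forall>t\<in>T. \<forall>k\<in>A - T. f k \<le> f t" by auto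
  have fT: "finite T" using T(1) assms(1) finite_subset by blast
  have "A - T \<noteq> {}" using T(1,2) Suc.prems assms(1) by (metis Diff_eq_empty_iff card_mono fT not_less_eq_eq)
  then have "Max (f ` (A - T)) \<in> f ` (A - T)" using assms(1) by (intro Max_in) auto
  then obtain a where a: "a \<in> A - T" "f a = Max (f ` (A - T))" by auto
  then have "f k \<le> f a" if "k \<in> A - T" for k using that assms(1) by simp
  then show ?case using T a fT
    by (intro exI[of _ "insert a T"]) auto
qed

text \<open>
  Up to constants, the norm whose unit ball is the convex hull of the \<open>s\<close>-sparse unit vectors.
\<close>
definition gauge :: "nat \<Rightarrow> nat \<Rightarrow> (nat \<Rightarrow> real) \<Rightarrow> real" where
  "gauge n s u = L2_set u {..<n} + (\<Sum>k<n. \<bar>u k\<bar>) / sqrt s"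

lemma gauge_nonneg: "gauge n s u \<ge> 0"
  unfolding gauge_def by (intro add_nonneg_nonneg divide_nonneg_nonneg sum_nonneg) auto

text \<open>
  Sort the coordinates by decreasing modulus into blocks of length \<open>s\<close>.  Each entry of a block is at
  most the average modulus of the preceding block, so that the Euclidean norm of a block is at most
  \<open>1 / sqrt s\<close> times the \<open>1\<close>-norm of the preceding one.  The sum of the Euclidean norms of the
  blocks is therefore at most the gauge.  The induction removes the first block; the number \<open>N\<close> in
  the inductive claim bounds the norm of whichever block comes first.
\<close>
lemma sublinear_le_gauge:
  fixes q :: "(nat \<Rightarrow> real) \<Rightarrow> real"
  assumes s: "s \<ge> 1" and c: "c \<ge> 0"
    and sub: "\<And>u v. q (\<lambda>k. u k + v k) \<le> q u + q v"
    and sparse: "\<And>T v. T \<subseteq> {..<n} \<Longrightarrow> card T \<le> s \<Longrightarrow> supported_on T v \<Longrightarrow> q v \<le> c * L2_set v {..<n}"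
    and w: "\<forall>i. i \<ge> n \<longrightarrow> w i = 0"
  shows "q w \<le> c * gauge n s w"
proof -
  have *: "q w \<le> c * (N + (\<Sum>k\<in>A. \<bar>w k\<bar>) / sqrt s)"
    if "A \<subseteq> {..<n}" "supported_on A w" "\<And>T. T \<subseteq> A \<Longrightarrow> card T \<le> s \<Longrightarrow> L2_set w T \<le> N" for A w N
    using that
  proof (induction "card A" arbitrary: A w N rule: less_induct)
    case less
    have fA: "finite A" using less.prems(1) finite_subset by blast
    have restr: "L2_set v {..<n} = L2_set v T" if "T \<subseteq> A" "supported_on T v" for v T
      unfolding L2_set_def using that less.prems(1)
      by (intro arg_cong[of _ _ sqrt] sum.mono_neutral_right) auto
    show ?case
    proof (cases "card A \<le> s")
      case True
      have "q w \<le> c * L2_set w A" using sparse[OF less.prems(1) True less.prems(2)] restr[of A w] less.prems(2) by simp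
      also have "\<dots> \<le> c * (N + (\<Sum>k\<in>A. \<bar>w k\<bar>) / sqrt s)"
        using less.prems(3)[of A] True c by (intro mult_left_mono) (auto intro!: add_increasing2 sum_nonneg divide_nonneg_nonneg)
      finally show ?thesis .
    next
      case False
      then obtain T where T: "T \<subseteq> A" "card T = s" "\<forall>t\<in>T. \<forall>k\<in>A - T. \<bar>w k\<bar> \<le> \<bar>w t\<bar>"
        using exists_top_subset[OF fA, of s "\<lambda>k. \<bar>w k\<bar>"] by auto
      have fT: "finite T" using T(1) fA finite_subset by blast
      define head tail where "head k = (if k \<in> T then w k else 0)" and "tail k = (if k \<in> T then 0 else w k)" for k
      have "q w = q (\<lambda>k. head k + tail k)"
        by (rule arg_cong[of _ _ q]) (auto simp: head_def tail_def)
      also have "\<dots> \<le> q head + q tail" by (rule sub)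
      also have "q head \<le> c * N"
      proof -
        have "q head \<le> c * L2_set head T"
          using sparse[of T head] T less.prems(1) restr[of T head] by (auto simp: head_def)
        also have "L2_set head T = L2_set w T" by (rule L2_set_cong) (auto simp: head_def)
        also have "c * L2_set w T \<le> c * N" using less.prems(3)[of T] T c by (intro mult_left_mono) auto
        finally show ?thesis .
      qed
      also have "q tail \<le> c * ((\<Sum>k\<in>T. \<bar>w k\<bar>) / sqrt s + (\<Sum>k\<in>A - T. \<bar>tail k\<bar>) / sqrt s)"
      proof (rule less.hyps)
        show "card (A - T) < card A" using T fA fT s False by (simp add: card_Diff_subset)
        show "A - T \<subseteq> {..<n}" using less.prems(1) by auto
        show "supported_on (A - T) tail" using less.prems(2) by (auto simp: tail_def)
        fix Q assume Q: "Q \<subseteq> A - T" "card Q \<le> s"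
        \<comment> \<open>The average modulus in the first block bounds every later entry.\<close>
        define b where "b = (\<Sum>k\<in>T. \<bar>w k\<bar>) / s"
        have b: "\<bar>tail k\<bar> \<le> b" if "k \<in> Q" for k
        proof -
          have "real s * \<bar>tail k\<bar> = (\<Sum>t\<in>T. \<bar>tail k\<bar>)" using T(2) by simp
          also have "\<dots> \<le> (\<Sum>t\<in>T. \<bar>w t\<bar>)" using T(3) that Q by (intro sum_mono) (auto simp: tail_def)
          finally show ?thesis using s by (simp add: b_def le_divide_eq mult.commute)
        qed
        have "b \<ge> 0" by (simp add: b_def sum_nonneg)
        have "(\<Sum>k\<in>Q. (tail k)\<^sup>2) \<le> (\<Sum>k\<in>Q. b\<^sup>2)"
          using b \<open>b \<ge> 0\<close> by (intro sum_mono) (simp add: abs_le_square_iff[symmetric])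
        also have "\<dots> \<le> s * b\<^sup>2" using Q(2) by (simp add: mult_right_mono)
        finally have "L2_set tail Q \<le> sqrt (s * b\<^sup>2)" unfolding L2_set_def by (rule real_sqrt_le_mono)
        also have "\<dots> = (s / sqrt s) * b"
          using \<open>b \<ge> 0\<close> by (simp only: real_sqrt_mult real_sqrt_abs abs_of_nonneg real_div_sqrt of_nat_0_le_iff)
        also have "\<dots> = (\<Sum>k\<in>T. \<bar>w k\<bar>) / sqrt s" using s by (simp add: b_def)
        finally show "L2_set tail Q \<le> (\<Sum>k\<in>T. \<bar>w k\<bar>) / sqrt s" .
      qed
      also have "(\<Sum>k\<in>A - T. \<bar>tail k\<bar>) = (\<Sum>k\<in>A - T. \<bar>w k\<bar>)" by (intro sum.cong) (auto simp: tail_def)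
      also have "c * N + c * ((\<Sum>k\<in>T. \<bar>w k\<bar>) / sqrt s + (\<Sum>k\<in>A - T. \<bar>w k\<bar>) / sqrt s)
          = c * (N + (\<Sum>k\<in>A. \<bar>w k\<bar>) / sqrt s)"
        unfolding sum.subset_diff[OF T(1) fA, of "\<lambda>k. \<bar>w k\<bar>"] by (simp add: add_divide_distrib distrib_left)
      finally show ?thesis by simp
    qed
  qed
  show ?thesis
    unfolding gauge_def
  proof (rule *)
    fix T assume "T \<subseteq> {..<n}"
    then show "L2_set w T \<le> L2_set w {..<n}" by (intro L2_set_subset_le) auto
  qed (use w in \<open>auto simp: not_less\<close>)
qed

text \<open>
  The restricted isometry property extended from sparse vectors to all vectors.  The union of two
  \<open>s\<close>-sparse supports has at most \<open>2 s\<close> elements, which is the sparsity in the hypothesis.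
\<close>
lemma bform_le_gauge:
  assumes sym: "\<And>k l. k < n \<Longrightarrow> l < n \<Longrightarrow> H k l = H l k"
    and net: "\<And>y. y \<in> grid_ball n (real (2 * s)) M \<Longrightarrow> \<bar>bform n H y y\<bar> \<le> \<mu>"
    and s: "s \<ge> 1" and M: "8 * s \<le> M"
    and u: "\<forall>i. i \<ge> n \<longrightarrow> u i = 0" and v: "\<forall>i. i \<ge> n \<longrightarrow> v i = 0"
  shows "\<bar>bform n H u v\<bar> \<le> 2 * \<mu> * gauge n s u * gauge n s v"
proof -
  have "\<mu> \<ge> 0" using net[OF zero_in_grid_ball] by (simp add: bform_def)
  have sparse: "\<bar>bform n H a b\<bar> \<le> 2 * \<mu> * L2_set a {..<n} * L2_set b {..<n}"
    if "T \<subseteq> {..<n}" "card T \<le> s" "supported_on T a" "T' \<subseteq> {..<n}" "card T' \<le> s" "supported_on T' b" for T T' a b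
  proof (rule sparse_bform_le[OF sym, where r = "2 * s" and M = M and T = "T \<union> T'"])
    show "card (T \<union> T') \<le> 2 * s" using card_Un_le[of T T'] that by simp
    show "\<bar>bform n H y y\<bar> \<le> \<mu>" if "y \<in> grid_ball n (real (2 * s)) M" for y
      using net[of y] that by simp
  qed (use that s M in auto)
  have semi: "\<bar>bform n H u b\<bar> \<le> (2 * \<mu> * L2_set b {..<n}) * gauge n s u"
    if "T' \<subseteq> {..<n}" "card T' \<le> s" "supported_on T' b" for T' b
  proof (rule sublinear_le_gauge[OF s _ _ _ u])
    show "\<bar>bform n H a b\<bar> \<le> 2 * \<mu> * L2_set b {..<n} * L2_set a {..<n}"
      if "T \<subseteq> {..<n}" "card T \<le> s" "supported_on T a" for T a
      using sparse[OF that \<open>T' \<subseteq> {..<n}\<close> \<open>card T' \<le> s\<close> \<open>supported_on T' b\<close>] by (simp add: mult_ac)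
    show "\<bar>bform n H (\<lambda>k. a k + a' k) b\<bar> \<le> \<bar>bform n H a b\<bar> + \<bar>bform n H a' b\<bar>" for a a'
      unfolding bform_add_left by (rule abs_triangle_ineq)
  qed (use \<open>\<mu> \<ge> 0\<close> in auto)
  show ?thesis
  proof (rule sublinear_le_gauge[OF s _ _ _ v])
    show "0 \<le> 2 * \<mu> * gauge n s u"
      using \<open>\<mu> \<ge> 0\<close> gauge_nonneg by simp
    show "\<bar>bform n H u b\<bar> \<le> 2 * \<mu> * gauge n s u * L2_set b {..<n}"
      if "T \<subseteq> {..<n}" "card T \<le> s" "supported_on T b" for T b
      using semi[OF that] by (simp only: mult_ac)
    show "\<bar>bform n H u (\<lambda>k. a k + a' k)\<bar> \<le> \<bar>bform n H u a\<bar> + \<bar>bform n H u a'\<bar>" for a a'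
      unfolding bform_add_right by (rule abs_triangle_ineq)
  qed
qed

section \<open>Random column signs\<close>

definition mask :: "nat set \<Rightarrow> (nat \<Rightarrow> real) \<Rightarrow> nat \<Rightarrow> real" where
  "mask A f k = (if k \<in> A then f k else 0)"

lemma bform_mask:
  assumes "A \<subseteq> {..<n}" "B \<subseteq> {..<n}"
  shows "bform n H (mask A u) (mask B v) = (\<Sum>k\<in>A. \<Sum>l\<in>B. H k l * u k * v l)"
proof -
  have "bform n H (mask A u) (mask B v) = (\<Sum>k\<in>A. \<Sum>l<n. H k l * mask A u k * mask B v l)"
    unfolding bform_def using assms by (intro sum.mono_neutral_right) (auto simp: mask_def)
  also have "\<dots> = (\<Sum>k\<in>A. \<Sum>l\<in>B. H k l * u k * v l)"
    using assms by (intro sum.cong refl sum.mono_neutral_cong_right) (auto simp: mask_def)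
  finally show ?thesis .
qed

lemma L2_set_mask: "finite B \<Longrightarrow> A \<subseteq> B \<Longrightarrow> L2_set (mask A f) B = L2_set f A"
  unfolding L2_set_def by (intro arg_cong[of _ _ sqrt] sum.mono_neutral_cong_right) (auto simp: mask_def)

lemma sum_abs_mask: "finite B \<Longrightarrow> A \<subseteq> B \<Longrightarrow> (\<Sum>k\<in>B. \<bar>mask A f k\<bar>) = (\<Sum>k\<in>A. \<bar>f k\<bar>)"
  by (intro sum.mono_neutral_cong_right) (auto simp: mask_def)

text \<open>
  For bounding a vector that is paired with itself, as in a duality argument.
\<close>
lemma L2_set_self_bound:
  assumes "(\<Sum>k\<in>A. (h k)\<^sup>2) \<le> M * L2_set h A" "M \<ge> 0"
  shows "L2_set h A \<le> M"
proof (cases "L2_set h A = 0")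
  case False
  then have "L2_set h A > 0" using L2_set_nonneg[of h A] by linarith
  moreover have "L2_set h A * L2_set h A \<le> M * L2_set h A"
    using assms(1) by (simp add: power2_eq_square[symmetric] L2_set_square)
  ultimately show ?thesis by (metis mult_right_le_imp_le)
qed (use assms in simp)

text \<open>
  An entry of modulus at least \<open>1 / sqrt s\<close> is at most \<open>sqrt s\<close> times its square, so that the
  \<open>1\<close>-norm of the large entries of a unit vector is at most \<open>sqrt s\<close>.
\<close>
lemma gauge_large:
  assumes T: "T \<subseteq> {..<n}" "\<And>k. k \<in> T \<Longrightarrow> 1 / sqrt s \<le> \<bar>x k\<bar>" and s: "s \<ge> 1"
    and x: "L2_set x {..<n} \<le> 1" and \<alpha>: "\<And>k. k \<in> T \<Longrightarrow> \<bar>\<alpha> k\<bar> \<le> 1"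
  shows "gauge n s (mask T (\<lambda>k. \<alpha> k * x k)) \<le> 2"
proof -
  have *: "\<bar>\<alpha> k * x k\<bar> \<le> \<bar>x k\<bar>" if "k \<in> T" for k
    using \<alpha>[OF that] by (simp add: abs_mult mult_left_le_one_le)
  have "L2_set (\<lambda>k. \<alpha> k * x k) T \<le> L2_set x T"
    unfolding L2_set_def using * by (intro real_sqrt_le_mono sum_mono) (simp add: abs_le_square_iff)
  also have "\<dots> \<le> 1" using L2_set_subset_le[of "{..<n}" T x] T x by simp
  finally have 1: "L2_set (\<lambda>k. \<alpha> k * x k) T \<le> 1" .
  have "(\<Sum>k\<in>T. \<bar>\<alpha> k * x k\<bar>) \<le> (\<Sum>k\<in>T. sqrt s * (x k)\<^sup>2)"
  proof (rule sum_mono)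
    fix k assume k: "k \<in> T"
    have "1 \<le> sqrt s * \<bar>x k\<bar>" using T(2)[OF k] s by (simp add: divide_le_eq mult.commute)
    then have "1 * \<bar>x k\<bar> \<le> sqrt s * \<bar>x k\<bar> * \<bar>x k\<bar>" by (intro mult_right_mono) auto
    then show "\<bar>\<alpha> k * x k\<bar> \<le> sqrt s * (x k)\<^sup>2" using *[OF k] by (simp add: power2_eq_square mult.assoc)
  qed
  also have "\<dots> = sqrt s * (L2_set x T)\<^sup>2" by (simp add: L2_set_square sum_distrib_left)
  also have "\<dots> \<le> sqrt s * 1"
    using \<open>L2_set x T \<le> 1\<close> by (intro mult_left_mono power_le_one) auto
  finally have "(\<Sum>k\<in>T. \<bar>\<alpha> k * x k\<bar>) / sqrt s \<le> 1" using s by (simp add: divide_le_eq)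
  then show ?thesis using 1 T by (simp add: gauge_def L2_set_mask sum_abs_mask)
qed

text \<open>
  Multiplication by the small entries of a unit vector gains a factor \<open>1 / sqrt s\<close> in the Euclidean
  norm by the bound on the entries, and gains the same factor in the other summand by the
  Cauchy--Schwarz inequality.
\<close>
lemma gauge_small:
  assumes R: "R \<subseteq> {..<n}" "\<And>k. k \<in> R \<Longrightarrow> \<bar>x k\<bar> \<le> 1 / sqrt s"
    and x: "L2_set x {..<n} \<le> 1"
  shows "gauge n s (mask R (\<lambda>k. x k * g k)) \<le> 2 * L2_set g R / sqrt s"
proof -
  have "(\<Sum>k\<in>R. (x k * g k)\<^sup>2) \<le> (\<Sum>k\<in>R. (1 / sqrt s * g k)\<^sup>2)"
  proof (rule sum_mono)
    fix k assume "k \<in> R"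
    then have "\<bar>x k * g k\<bar> \<le> \<bar>1 / sqrt s * g k\<bar>"
      unfolding abs_mult using R(2) by (intro mult_right_mono) auto
    then show "(x k * g k)\<^sup>2 \<le> (1 / sqrt s * g k)\<^sup>2" by (simp only: abs_le_square_iff)
  qed
  then have "L2_set (\<lambda>k. x k * g k) R \<le> L2_set (\<lambda>k. 1 / sqrt s * g k) R"
    unfolding L2_set_def by (rule real_sqrt_le_mono)
  also have "\<dots> = L2_set g R / sqrt s" unfolding L2_set_scale by simp
  finally have 1: "L2_set (\<lambda>k. x k * g k) R \<le> L2_set g R / sqrt s" .
  have "L2_set x R \<le> 1" using L2_set_subset_le[of "{..<n}" R x] R x by simp
  then have "L2_set x R * L2_set g R \<le> 1 * L2_set g R" by (intro mult_right_mono) auto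
  then have "(\<Sum>k\<in>R. \<bar>x k * g k\<bar>) \<le> L2_set g R"
    using L2_set_mult_ineq[of x g R] by (simp add: abs_mult)
  then have "(\<Sum>k\<in>R. \<bar>x k * g k\<bar>) / sqrt s \<le> L2_set g R / sqrt s" by (intro divide_right_mono) auto
  then show ?thesis using 1 R by (simp add: gauge_def L2_set_mask sum_abs_mask)
qed

lemma gauge_unit:
  assumes "k < n" "s \<ge> 1"
  shows "gauge n s (mask {k} (\<lambda>_. 1)) \<le> 2"
proof -
  have "{k} \<subseteq> {..<n}" using assms by simp
  then have "gauge n s (mask {k} (\<lambda>_. 1)) = 1 + 1 / sqrt s"
    by (simp add: gauge_def L2_set_mask sum_abs_mask)
  then show ?thesis using assms by simp
qed

text \<open>
  Split \<open>x\<close> at height \<open>1 / sqrt s\<close> into large entries on \<open>T\<close> and small entries on \<open>R\<close>. Put \<open>\<theta> = \<delta> /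
  12\<close>.  The form on the large entries is bounded by \<open>\<theta>\<close> for all signs.  The mixed part is, for fixed
  signs on \<open>T\<close>, a Rademacher sum with variance at most a constant times \<open>\<theta>\<^sup>2 / s\<close>.  The part on the
  small entries is a chaos whose matrix \<open>C\<close> has operator norm at most \<open>\<theta> / s\<close> and squared Frobenius
  norm at most \<open>\<theta>\<^sup>2 / s\<close>; the Hanson--Wright inequality applies.  All three bounds come from the
  gauge, tested on suitable vectors.
\<close>
lemma sign_flipped_form_tail:
  assumes sym: "\<And>k l. k < n \<Longrightarrow> l < n \<Longrightarrow> H k l = H l k"
    and diag: "\<And>k. k < n \<Longrightarrow> H k k = 0"
    and H: "\<And>u v. (\<forall>i. i \<ge> n \<longrightarrow> u i = 0) \<Longrightarrow> (\<forall>i. i \<ge> n \<longrightarrow> v i = 0) \<Longrightarrow>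
      \<bar>bform n H u v\<bar> \<le> \<delta> / 48 * gauge n s u * gauge n s v"
    and s: "s \<ge> 1" and \<delta>: "\<delta> > 0" and x: "L2_set x {..<n} \<le> 1"
  shows "ravg {..<n} (\<lambda>\<epsilon>. of_bool (\<bar>bform n H (\<lambda>k. \<epsilon> k * x k) (\<lambda>k. \<epsilon> k * x k)\<bar> > \<delta>))
    \<le> 4 * exp (- (2 * real s / 9))"
proof -
  define T where "T = {k\<in>{..<n}. 1 / sqrt s < \<bar>x k\<bar>}"
  define R where "R = {..<n} - T"
  have T: "T \<subseteq> {..<n}" "\<And>k. k \<in> T \<Longrightarrow> 1 / sqrt s \<le> \<bar>x k\<bar>" by (auto simp: T_def)
  have R: "R \<subseteq> {..<n}" "\<And>k. k \<in> R \<Longrightarrow> \<bar>x k\<bar> \<le> 1 / sqrt s" by (auto simp: T_def R_def)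
  have fin: "finite T" "finite R" using T(1) R(1) finite_subset by auto
  \<comment> \<open>The gauges of all test vectors are at most 2 up to scaling, and \<open>\<delta> / 48 \<cdot> 2 \<cdot> 2 = \<theta>\<close>.\<close>
  define \<theta> where "\<theta> = \<delta> / 12"
  have \<theta>: "\<theta> > 0" using \<delta> by (simp add: \<theta>_def)
  have Hmask: "\<bar>bform n H (mask A u) (mask B v)\<bar> \<le> \<theta> / 4 * p * q"
    if "A \<subseteq> {..<n}" "B \<subseteq> {..<n}" "gauge n s (mask A u) \<le> p" "gauge n s (mask B v) \<le> q" for A B u v p q
  proof -
    have "\<bar>bform n H (mask A u) (mask B v)\<bar> \<le> \<delta> / 48 * gauge n s (mask A u) * gauge n s (mask B v)"
      using that by (intro H) (auto simp: mask_def)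
    also have "\<dots> \<le> \<delta> / 48 * p * q"
      using that \<delta> gauge_nonneg[of n s "mask A u"] gauge_nonneg[of n s "mask B v"]
      by (intro mult_mono mult_nonneg_nonneg) auto
    finally show ?thesis by (simp add: \<theta>_def)
  qed
  have small: "gauge n s (mask R (\<lambda>k. x k * g k)) \<le> 2 * L2_set g R / sqrt s" for g
    by (rule gauge_small[OF R x])
  have large: "gauge n s (mask T (\<lambda>k. \<alpha> k * x k)) \<le> 2" if "\<And>k. k \<in> T \<Longrightarrow> \<bar>\<alpha> k\<bar> \<le> 1" for \<alpha>
    by (rule gauge_large[OF T s x that])

  define a where "a \<epsilon> = bform n H (mask T (\<lambda>k. \<epsilon> k * x k)) (mask T (\<lambda>k. \<epsilon> k * x k))" for \<epsilon>
  define b where "b \<epsilon> = 2 * bform n H (mask T (\<lambda>k. \<epsilon> k * x k)) (mask R (\<lambda>k. \<epsilon> k * x k))" for \<epsilon>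
  define c where "c \<epsilon> = bform n H (mask R (\<lambda>k. \<epsilon> k * x k)) (mask R (\<lambda>k. \<epsilon> k * x k))" for \<epsilon>

  have decomp: "bform n H (\<lambda>k. \<epsilon> k * x k) (\<lambda>k. \<epsilon> k * x k) = a \<epsilon> + b \<epsilon> + c \<epsilon>" for \<epsilon>
  proof -
    let ?u = "mask T (\<lambda>k. \<epsilon> k * x k)" and ?v = "mask R (\<lambda>k. \<epsilon> k * x k)"
    have "bform n H (\<lambda>k. \<epsilon> k * x k) (\<lambda>k. \<epsilon> k * x k) = bform n H (\<lambda>k. ?u k + ?v k) (\<lambda>k. ?u k + ?v k)"
      unfolding bform_def by (intro sum.cong refl) (auto simp: mask_def R_def)
    then show ?thesis unfolding bform_add_left bform_add_right a_def b_def c_def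
      using bform_commute[of n H ?u ?v, OF sym] by simp
  qed

  have a_le: "\<bar>a \<epsilon>\<bar> \<le> \<theta>" if "\<epsilon> \<in> sign_vecs {..<n}" for \<epsilon>
  proof -
    have "\<bar>\<epsilon> k\<bar> \<le> 1" if "k \<in> T" for k
    proof -
      have "k \<in> {..<n}" using that T(1) by blast
      from sign_vecs_cases[OF \<open>\<epsilon> \<in> _\<close> this] show ?thesis by auto
    qed
    then show ?thesis unfolding a_def using Hmask[OF T(1) T(1) large large, of \<epsilon> \<epsilon>] by simp
  qed

  have b_mgf: "ravg {..<n} (\<lambda>\<epsilon>. exp (t * b \<epsilon>)) \<le> exp (2 * t\<^sup>2 * (\<theta>\<^sup>2 / s))" for t
  proof -
    define g where "g \<alpha> l = x l * (\<Sum>k\<in>T. H k l * (\<alpha> k * x k))" for \<alpha> l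
    have "ravg {..<n} (\<lambda>\<epsilon>. exp (t * b \<epsilon>))
        = ravg T (\<lambda>\<alpha>. ravg R (\<lambda>\<beta>. exp (t * b (\<lambda>i. \<alpha> i + \<beta> i))))"
      unfolding R_def by (rule ravg_split[OF _ T(1)]) simp
    also have "\<dots> = ravg T (\<lambda>\<alpha>. ravg R (\<lambda>\<beta>. exp (\<Sum>l\<in>R. (2 * t * g \<alpha> l) * \<beta> l)))"
    proof (intro ravg_cong)
      fix \<alpha> \<beta> assume \<alpha>: "\<alpha> \<in> sign_vecs T" and \<beta>: "\<beta> \<in> sign_vecs R"
      have 0: "\<beta> k = 0" if "k \<in> T" for k
        by (rule sign_vecs_outside[OF \<beta>]) (use that in \<open>auto simp: R_def\<close>)
      have 1: "\<alpha> l = 0" if "l \<in> R" for l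
        by (rule sign_vecs_outside[OF \<alpha>]) (use that in \<open>auto simp: R_def\<close>)
      have "b (\<lambda>i. \<alpha> i + \<beta> i) = 2 * (\<Sum>k\<in>T. \<Sum>l\<in>R. H k l * (\<alpha> k * x k) * (\<beta> l * x l))"
        unfolding b_def bform_mask[OF T(1) R(1)] using 0 1 by simp
      also have "\<dots> = 2 * (\<Sum>l\<in>R. g \<alpha> l * \<beta> l)"
        unfolding g_def sum_distrib_left sum_distrib_right by (subst sum.swap) (simp add: mult_ac)
      finally have "t * b (\<lambda>i. \<alpha> i + \<beta> i) = (\<Sum>l\<in>R. (2 * t * g \<alpha> l) * \<beta> l)"
        by (simp add: sum_distrib_left mult_ac)
      then show "exp (t * b (\<lambda>i. \<alpha> i + \<beta> i)) = exp (\<Sum>l\<in>R. (2 * t * g \<alpha> l) * \<beta> l)" by simp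
    qed
    also have "\<dots> \<le> ravg T (\<lambda>\<alpha>. exp (2 * t\<^sup>2 * (\<theta>\<^sup>2 / s)))"
    proof (rule ravg_mono)
      fix \<alpha> assume \<alpha>: "\<alpha> \<in> sign_vecs T"
      have \<alpha>1: "\<bar>\<alpha> k\<bar> \<le> 1" if "k \<in> T" for k
        using sign_vecs_cases[OF \<alpha> that] by auto
      have "(\<Sum>l\<in>R. (g \<alpha> l)\<^sup>2) = bform n H (mask T (\<lambda>k. \<alpha> k * x k)) (mask R (\<lambda>l. x l * g \<alpha> l))"
        unfolding bform_mask[OF T(1) R(1)]
        by (subst sum.swap) (simp add: g_def power2_eq_square sum_distrib_left sum_distrib_right mult_ac)
      also have "\<dots> \<le> \<theta> / 4 * 2 * (2 * L2_set (g \<alpha>) R / sqrt s)"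
        using Hmask[OF T(1) R(1) large[OF \<alpha>1] small] by (rule order_trans[OF abs_ge_self])
      also have "\<dots> = \<theta> / sqrt s * L2_set (g \<alpha>) R" by simp
      finally have "L2_set (g \<alpha>) R \<le> \<theta> / sqrt s" using \<theta> by (intro L2_set_self_bound) auto
      then have "(L2_set (g \<alpha>) R)\<^sup>2 \<le> (\<theta> / sqrt s)\<^sup>2" by (intro power_mono) auto
      then have gs: "(\<Sum>l\<in>R. (g \<alpha> l)\<^sup>2) \<le> \<theta>\<^sup>2 / s" by (simp add: L2_set_square power_divide)
      have "ravg R (\<lambda>\<beta>. exp (\<Sum>l\<in>R. (2 * t * g \<alpha> l) * \<beta> l)) \<le> exp ((\<Sum>l\<in>R. (2 * t * g \<alpha> l)\<^sup>2) / 2)"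
        by (rule ravg_mgf[OF fin(2)])
      also have "(\<Sum>l\<in>R. (2 * t * g \<alpha> l)\<^sup>2) = 4 * t\<^sup>2 * (\<Sum>l\<in>R. (g \<alpha> l)\<^sup>2)"
        by (simp add: power_mult_distrib sum_distrib_left)
      also have "exp (4 * t\<^sup>2 * (\<Sum>l\<in>R. (g \<alpha> l)\<^sup>2) / 2) \<le> exp (2 * t\<^sup>2 * (\<theta>\<^sup>2 / s))"
        using mult_left_mono[OF gs, of "2 * t\<^sup>2"] by simp
      finally show "ravg R (\<lambda>\<beta>. exp (\<Sum>l\<in>R. (2 * t * g \<alpha> l) * \<beta> l)) \<le> exp (2 * t\<^sup>2 * (\<theta>\<^sup>2 / s))" .
    qed
    finally show ?thesis using fin by simp
  qed

  define C where "C k l = (if k \<in> R \<and> l \<in> R then H k l * x k * x l else 0)" for k l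
  have C_form: "(\<Sum>k<n. \<Sum>l<n. C k l * u k * v l) = bform n H (mask R (\<lambda>k. x k * u k)) (mask R (\<lambda>k. x k * v k))" for u v
    unfolding bform_def by (intro sum.cong refl) (simp add: C_def mask_def)
  have c_chaos: "c \<epsilon> = (\<Sum>k<n. \<Sum>l\<in>{..<n} - {k}. C k l * \<epsilon> k * \<epsilon> l)" for \<epsilon>
  proof -
    have "c \<epsilon> = (\<Sum>k<n. \<Sum>l<n. C k l * \<epsilon> k * \<epsilon> l)" unfolding C_form by (simp add: c_def mult.commute)
    also have "\<dots> = (\<Sum>k<n. \<Sum>l\<in>{..<n} - {k}. C k l * \<epsilon> k * \<epsilon> l)"
      using diag by (intro sum.cong refl sum.mono_neutral_right) (auto simp: C_def)
    finally show ?thesis .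
  qed
  have C_op: "(\<Sum>k<n. (\<Sum>i<n. C i k * v i)\<^sup>2) \<le> (\<theta> / s)\<^sup>2 * (\<Sum>i<n. (v i)\<^sup>2)" for v
  proof -
    define h where "h k = (\<Sum>i<n. C i k * v i)" for k
    have "(\<Sum>k<n. (h k)\<^sup>2) = (\<Sum>i<n. \<Sum>k<n. C i k * v i * h k)"
    proof -
      have "(h k)\<^sup>2 = (\<Sum>i<n. C i k * v i * h k)" for k
        unfolding sum_distrib_right[symmetric] by (simp add: power2_eq_square h_def)
      then show ?thesis by (simp only:) (rule sum.swap)
    qed
    also have "\<dots> \<le> \<theta> / 4 * (2 * L2_set v R / sqrt s) * (2 * L2_set h R / sqrt s)"
      unfolding C_form using Hmask[OF R(1) R(1) small small] by (rule order_trans[OF abs_ge_self])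
    also have "\<dots> = \<theta> / s * L2_set v R * L2_set h R" by simp
    also have "\<dots> \<le> \<theta> / s * L2_set v {..<n} * L2_set h {..<n}"
      using \<theta> R(1) by (intro mult_mono L2_set_subset_le mult_nonneg_nonneg) auto
    finally have "L2_set h {..<n} \<le> \<theta> / s * L2_set v {..<n}" using \<theta> by (intro L2_set_self_bound) auto
    then have "(L2_set h {..<n})\<^sup>2 \<le> (\<theta> / s * L2_set v {..<n})\<^sup>2" by (intro power_mono) auto
    then show ?thesis unfolding power_mult_distrib L2_set_square h_def .
  qed
  have C_frob: "(\<Sum>k<n. \<Sum>l<n. (C k l)\<^sup>2) \<le> \<theta>\<^sup>2 / s"
  proof -
    have row: "(\<Sum>l<n. (C k l)\<^sup>2) \<le> (x k)\<^sup>2 * (\<theta>\<^sup>2 / s)" if k: "k < n" for k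
    proof (cases "k \<in> R")
      case True
      define h where "h l = H k l * x l" for l
      have "(\<Sum>l\<in>R. (h l)\<^sup>2) = bform n H (mask {k} (\<lambda>_. 1)) (mask R (\<lambda>l. x l * h l))"
        using k R(1) by (simp add: bform_mask h_def power2_eq_square mult_ac)
      also have "\<dots> \<le> \<theta> / 4 * 2 * (2 * L2_set h R / sqrt s)"
        using k by (intro order_trans[OF abs_ge_self Hmask[OF _ R(1) gauge_unit[OF k s] small]]) auto
      also have "\<dots> = \<theta> / sqrt s * L2_set h R" by simp
      finally have "L2_set h R \<le> \<theta> / sqrt s" using \<theta> by (intro L2_set_self_bound) auto
      then have "(L2_set h R)\<^sup>2 \<le> (\<theta> / sqrt s)\<^sup>2" by (intro power_mono) auto
      then have hs: "(\<Sum>l\<in>R. (h l)\<^sup>2) \<le> \<theta>\<^sup>2 / s" by (simp add: L2_set_square power_divide)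
      have "(\<Sum>l<n. (C k l)\<^sup>2) = (\<Sum>l\<in>R. (x k)\<^sup>2 * (h l)\<^sup>2)"
        using R(1) True by (intro sum.mono_neutral_cong_right) (auto simp: C_def h_def power_mult_distrib)
      also have "\<dots> \<le> (x k)\<^sup>2 * (\<theta>\<^sup>2 / s)" unfolding sum_distrib_left[symmetric] by (intro mult_left_mono hs) simp
      finally show ?thesis .
    qed (simp add: C_def)
    have "(\<Sum>k<n. \<Sum>l<n. (C k l)\<^sup>2) \<le> (\<Sum>k<n. (x k)\<^sup>2 * (\<theta>\<^sup>2 / s))" by (intro sum_mono row) auto
    also have "\<dots> = (L2_set x {..<n})\<^sup>2 * (\<theta>\<^sup>2 / s)" by (simp add: L2_set_square sum_distrib_right sum_divide_distrib)
    also have "\<dots> \<le> 1 * (\<theta>\<^sup>2 / s)" using x by (intro mult_right_mono power_le_one) auto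
    finally show ?thesis by simp
  qed

  \<comment> \<open>The largest exponent that the operator norm allows up to a constant: \<open>128 t\<^sup>2 (\<theta> / s)\<^sup>2 \<le> 1\<close>.
    Both exponential moments are then at most \<open>exp (s / 9)\<close>, while \<open>t \<delta> / 3 = s / 3\<close>.\<close>
  define t where "t = s / (12 * \<theta>)"
  have t: "t > 0" using s \<theta> by (simp add: t_def)
  have tsq: "t\<^sup>2 * (\<theta>\<^sup>2 / s) = s / 144"
    using \<theta> s by (simp add: t_def power_divide power_mult_distrib power2_eq_square)
  have t\<delta>: "t * (\<delta> / 3) = s / 3" using \<delta> by (simp add: t_def \<theta>_def)
  have c_mgf: "ravg {..<n} (\<lambda>\<epsilon>. exp (t' * c \<epsilon>)) \<le> exp (s / 9)" if "t'\<^sup>2 = t\<^sup>2" for t'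
  proof -
    have "t\<^sup>2 * (\<theta> / s)\<^sup>2 = 1 / 144"
      using \<theta> s by (simp add: t_def power_divide power_mult_distrib)
    then have "128 * t'\<^sup>2 * (\<theta> / s)\<^sup>2 \<le> 1" unfolding that by simp
    then have "ravg {..<n} (\<lambda>\<epsilon>. exp (t' * c \<epsilon>)) \<le> exp (16 * t'\<^sup>2 * (\<Sum>k<n. \<Sum>l<n. (C k l)\<^sup>2))"
      unfolding c_chaos by (intro hanson_wright_mgf[where \<kappa> = "\<theta> / s"] C_op) auto
    also have "\<dots> \<le> exp (16 * (t\<^sup>2 * (\<theta>\<^sup>2 / s)))"
      using mult_left_mono[OF C_frob, of "16 * t\<^sup>2"] unfolding that by simp
    finally show ?thesis unfolding tsq by simp
  qed
  have b_mgf': "ravg {..<n} (\<lambda>\<epsilon>. exp (t' * b \<epsilon>)) \<le> exp (s / 9)" if "t'\<^sup>2 = t\<^sup>2" for t'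
  proof -
    have "ravg {..<n} (\<lambda>\<epsilon>. exp (t' * b \<epsilon>)) \<le> exp (2 * (t\<^sup>2 * (\<theta>\<^sup>2 / s)))"
      using b_mgf[of t'] unfolding that by (simp add: mult.assoc)
    also have "\<dots> \<le> exp (s / 9)" unfolding tsq by simp
    finally show ?thesis .
  qed
  have tail: "ravg {..<n} (\<lambda>\<epsilon>. of_bool (f \<epsilon> \<ge> \<delta> / 3)) \<le> exp (- (2 * real s / 9))"
    if "ravg {..<n} (\<lambda>\<epsilon>. exp (t * f \<epsilon>)) \<le> exp (s / 9)" for f
  proof -
    have "ravg {..<n} (\<lambda>\<epsilon>. of_bool (f \<epsilon> \<ge> \<delta> / 3)) \<le> exp (- (t * (\<delta> / 3))) * ravg {..<n} (\<lambda>\<epsilon>. exp (t * f \<epsilon>))"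
      using t by (intro ravg_chernoff) simp
    also have "\<dots> \<le> exp (- (t * (\<delta> / 3))) * exp (s / 9)" by (intro mult_left_mono that) simp
    also have "\<dots> = exp (- (2 * real s / 9))" unfolding t\<delta> by (simp flip: exp_add)
    finally show ?thesis .
  qed
  have "ravg {..<n} (\<lambda>\<epsilon>. of_bool (\<bar>bform n H (\<lambda>k. \<epsilon> k * x k) (\<lambda>k. \<epsilon> k * x k)\<bar> > \<delta>))
      \<le> ravg {..<n} (\<lambda>\<epsilon>. (of_bool (b \<epsilon> \<ge> \<delta> / 3) + of_bool (- b \<epsilon> \<ge> \<delta> / 3))
        + (of_bool (c \<epsilon> \<ge> \<delta> / 3) + of_bool (- c \<epsilon> \<ge> \<delta> / 3)))"
  proof (rule ravg_mono)
    fix \<epsilon> assume "\<epsilon> \<in> sign_vecs {..<n}"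
    then have "\<bar>a \<epsilon>\<bar> \<le> \<theta>" by (rule a_le)
    moreover have "\<theta> \<le> \<delta> / 3" using \<delta> by (simp add: \<theta>_def)
    ultimately show "of_bool (\<bar>bform n H (\<lambda>k. \<epsilon> k * x k) (\<lambda>k. \<epsilon> k * x k)\<bar> > \<delta>)
        \<le> ((of_bool (b \<epsilon> \<ge> \<delta> / 3) + of_bool (- b \<epsilon> \<ge> \<delta> / 3))
        + (of_bool (c \<epsilon> \<ge> \<delta> / 3) + of_bool (- c \<epsilon> \<ge> \<delta> / 3)) :: real)"
      unfolding decomp by (auto simp: of_bool_def)
  qed
  also have "\<dots> \<le> (exp (- (2 * real s / 9)) + exp (- (2 * real s / 9))) + (exp (- (2 * real s / 9)) + exp (- (2 * real s / 9)))"
    unfolding ravg_add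
    using b_mgf'[of t] b_mgf'[of "-t"] c_mgf[of t] c_mgf[of "-t"] by (intro add_mono tail) auto
  finally show ?thesis by simp
qed

section \<open>The Gram matrix and the failure probability\<close>

text \<open>
  The Gram matrix of the columns of the partial circulant matrix, minus the identity.  The columns
  have norm exactly one, since their entries are signs divided by the root of \<open>|\<Omega>|\<close>; so the diagonal
  vanishes.
\<close>
definition gram :: "nat \<Rightarrow> nat set \<Rightarrow> (nat \<Rightarrow> real) \<Rightarrow> nat \<Rightarrow> nat \<Rightarrow> real" where
  "gram n \<Omega> \<epsilon> k l = (if k = l then 0
     else (\<Sum>j\<in>\<Omega>. \<epsilon> (cyc_sub n j k) * \<epsilon> (cyc_sub n j l)) / card \<Omega>)"

lemma gram_commute: "gram n \<Omega> \<epsilon> k l = gram n \<Omega> \<epsilon> l k"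
  by (simp add: gram_def mult.commute)

lemma bform_gram:
  assumes \<Omega>: "\<Omega> \<subseteq> {..<n}" "\<Omega> \<noteq> {}" and \<epsilon>: "\<epsilon> \<in> sign_vecs {..<n}"
  shows "bform n (gram n \<Omega> \<epsilon>) u u = (\<Sum>j\<in>\<Omega>. (cconv n u \<epsilon> j)\<^sup>2) / card \<Omega> - (L2_set u {..<n})\<^sup>2"
proof -
  have "finite \<Omega>" using \<Omega>(1) finite_subset by blast
  then have m: "card \<Omega> > 0" using \<Omega>(2) by (simp add: card_gt_0_iff)
  have n: "n > 0" using \<Omega> by (cases n) auto
  define c where "c k l = (\<Sum>j\<in>\<Omega>. \<epsilon> (cyc_sub n j k) * \<epsilon> (cyc_sub n j l))" for k l
  have "(\<Sum>j\<in>\<Omega>. (cconv n u \<epsilon> j)\<^sup>2)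
      = (\<Sum>j\<in>\<Omega>. \<Sum>k<n. \<Sum>l<n. \<epsilon> (cyc_sub n j k) * \<epsilon> (cyc_sub n j l) * u k * u l)"
    by (simp add: cconv_def power2_eq_square sum_product mult_ac)
  also have "\<dots> = (\<Sum>k<n. \<Sum>j\<in>\<Omega>. \<Sum>l<n. \<epsilon> (cyc_sub n j k) * \<epsilon> (cyc_sub n j l) * u k * u l)"
    by (rule sum.swap)
  also have "\<dots> = (\<Sum>k<n. \<Sum>l<n. \<Sum>j\<in>\<Omega>. \<epsilon> (cyc_sub n j k) * \<epsilon> (cyc_sub n j l) * u k * u l)"
    by (intro sum.cong refl sum.swap)
  also have "\<dots> = (\<Sum>k<n. \<Sum>l<n. c k l * u k * u l)" by (simp add: c_def sum_distrib_right)
  finally have energy: "(\<Sum>j\<in>\<Omega>. (cconv n u \<epsilon> j)\<^sup>2) / card \<Omega>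
      = (\<Sum>k<n. \<Sum>l<n. c k l / card \<Omega> * u k * u l)"
    by (simp add: sum_divide_distrib)
  have "c k k = card \<Omega>" if "k < n" for k
    unfolding c_def using sign_vecs_sq[OF \<epsilon>] cyc_sub_less[OF n] by (simp flip: power2_eq_square)
  then have entry: "gram n \<Omega> \<epsilon> k l * u k * u l = c k l / card \<Omega> * u k * u l - (if k = l then (u k)\<^sup>2 else 0)"
    if "k < n" for k l
    using that m by (simp add: gram_def c_def power2_eq_square)
  have "bform n (gram n \<Omega> \<epsilon>) u u = (\<Sum>k<n. \<Sum>l<n. c k l / card \<Omega> * u k * u l - (if k = l then (u k)\<^sup>2 else 0))"
    unfolding bform_def by (intro sum.cong refl entry) simp
  also have "\<dots> = (\<Sum>k<n. \<Sum>l<n. c k l / card \<Omega> * u k * u l) - (L2_set u {..<n})\<^sup>2"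
    by (simp add: sum_subtractf L2_set_square)
  finally show ?thesis using energy by simp
qed

text \<open>
  The two sources of randomness meet here: the generator \<open>\<epsilon>\<close> is fixed and has small deviation on the
  grid, and the remaining probability is over the column signs \<open>\<epsilon>'\<close> alone.
\<close>
lemma sign_flipped_energy_tail:
  assumes \<Omega>: "\<Omega> \<subseteq> {..<n}" "\<Omega> \<noteq> {}" and \<epsilon>: "\<epsilon> \<in> sign_vecs {..<n}"
    and \<delta>: "\<delta> > 0" and s: "s \<ge> 1" and M: "8 * s \<le> M"
    and good: "deviation n \<Omega> (grid_ball n (real (2 * s)) M) \<epsilon> < card \<Omega> * (\<delta> / 96)"
    and x: "\<forall>i. i \<ge> n \<longrightarrow> x i = 0"
  shows "ravg {..<n} (\<lambda>\<epsilon>'. of_bool (\<bar>(\<Sum>j\<in>\<Omega>. (cconv n (\<lambda>k. \<epsilon>' k * x k) \<epsilon> j)\<^sup>2) / card \<Omega>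
      - (L2_set x {..<n})\<^sup>2\<bar> > \<delta> * (L2_set x {..<n})\<^sup>2)) \<le> 4 * exp (- (2 * real s / 9))"
proof -
  have "finite \<Omega>" using \<Omega>(1) finite_subset by blast
  then have m: "card \<Omega> > 0" using \<Omega>(2) by (simp add: card_gt_0_iff)
  define N where "N = L2_set x {..<n}"
  define H where "H = gram n \<Omega> \<epsilon>"
  have L2_sign: "L2_set (\<lambda>k. \<epsilon>' k * x k) {..<n} = N" if "\<epsilon>' \<in> sign_vecs {..<n}" for \<epsilon>'
    unfolding N_def L2_set_def using sign_vecs_sq[OF that] by (simp add: power_mult_distrib)
  have form: "(\<Sum>j\<in>\<Omega>. (cconv n (\<lambda>k. \<epsilon>' k * x k) \<epsilon> j)\<^sup>2) / card \<Omega> - N\<^sup>2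
      = bform n H (\<lambda>k. \<epsilon>' k * x k) (\<lambda>k. \<epsilon>' k * x k)" if "\<epsilon>' \<in> sign_vecs {..<n}" for \<epsilon>'
    unfolding H_def bform_gram[OF \<Omega> \<epsilon>] L2_sign[OF that] ..
  have net: "\<bar>bform n H y y\<bar> \<le> \<delta> / 96" if "y \<in> grid_ball n (real (2 * s)) M" for y
  proof -
    have "\<bar>(\<Sum>j\<in>\<Omega>. (cconv n y \<epsilon> j)\<^sup>2) - card \<Omega> * (L2_set y {..<n})\<^sup>2\<bar>
        \<le> deviation n \<Omega> (grid_ball n (real (2 * s)) M) \<epsilon>"
      unfolding deviation_def using that by (intro Max_ge) auto
    also have "(\<Sum>j\<in>\<Omega>. (cconv n y \<epsilon> j)\<^sup>2) - card \<Omega> * (L2_set y {..<n})\<^sup>2 = card \<Omega> * bform n H y y"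
      unfolding H_def bform_gram[OF \<Omega> \<epsilon>] using m by (simp add: right_diff_distrib)
    finally have "card \<Omega> * \<bar>bform n H y y\<bar> < card \<Omega> * (\<delta> / 96)" using good by (simp add: abs_mult)
    then show ?thesis using m by simp
  qed
  have tail: "ravg {..<n} (\<lambda>\<epsilon>'. of_bool (\<bar>bform n H (\<lambda>k. \<epsilon>' k * z k) (\<lambda>k. \<epsilon>' k * z k)\<bar> > \<delta>))
      \<le> 4 * exp (- (2 * real s / 9))" if "L2_set z {..<n} \<le> 1" for z
  proof (rule sign_flipped_form_tail[OF _ _ _ s \<delta> that])
    show "H k l = H l k" for k l unfolding H_def by (rule gram_commute)
    show "H k k = 0" for k by (simp add: H_def gram_def)
    show "\<bar>bform n H u v\<bar> \<le> \<delta> / 48 * gauge n s u * gauge n s v"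
      if "\<forall>i. i \<ge> n \<longrightarrow> u i = 0" "\<forall>i. i \<ge> n \<longrightarrow> v i = 0" for u v
      using bform_le_gauge[OF _ net s M that] by (simp add: H_def gram_commute)
  qed
  show ?thesis
  proof (cases "N = 0")
    case True
    have "(\<Sum>j\<in>\<Omega>. (cconv n (\<lambda>k. \<epsilon>' k * x k) \<epsilon> j)\<^sup>2) / card \<Omega> = 0" if "\<epsilon>' \<in> sign_vecs {..<n}" for \<epsilon>'
      using form[OF that] bform_L2_zero_left[of "\<lambda>k. \<epsilon>' k * x k" n H] L2_sign[OF that] True by simp
    then have "ravg {..<n} (\<lambda>\<epsilon>'. of_bool (\<bar>(\<Sum>j\<in>\<Omega>. (cconv n (\<lambda>k. \<epsilon>' k * x k) \<epsilon> j)\<^sup>2) / card \<Omega>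
      - N\<^sup>2\<bar> > \<delta> * N\<^sup>2)) = ravg {..<n} (\<lambda>_. 0)"
      using True by (intro ravg_cong) (simp only:, simp)
    then show ?thesis by (simp add: N_def)
  next
    case False
    define z where "z = (\<lambda>k. 1 / N * x k)"
    have "L2_set z {..<n} \<le> 1" unfolding z_def N_def using False L2_set_normalise[of x "{..<n}"] by (simp add: N_def)
    have "ravg {..<n} (\<lambda>\<epsilon>'. of_bool (\<bar>(\<Sum>j\<in>\<Omega>. (cconv n (\<lambda>k. \<epsilon>' k * x k) \<epsilon> j)\<^sup>2) / card \<Omega> - N\<^sup>2\<bar> > \<delta> * N\<^sup>2))
        = ravg {..<n} (\<lambda>\<epsilon>'. of_bool (\<bar>bform n H (\<lambda>k. \<epsilon>' k * z k) (\<lambda>k. \<epsilon>' k * z k)\<bar> > \<delta>))"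
    proof (rule ravg_cong)
      fix \<epsilon>' assume \<epsilon>': "\<epsilon>' \<in> sign_vecs {..<n}"
      have "(\<lambda>k. \<epsilon>' k * z k) = (\<lambda>k. 1 / N * (\<epsilon>' k * x k))" by (simp add: z_def fun_eq_iff)
      then have "bform n H (\<lambda>k. \<epsilon>' k * z k) (\<lambda>k. \<epsilon>' k * z k)
          = bform n H (\<lambda>k. \<epsilon>' k * x k) (\<lambda>k. \<epsilon>' k * x k) / N\<^sup>2"
        by (simp only: bform_scale_left bform_scale_right) (simp add: power2_eq_square)
      then show "of_bool (\<bar>(\<Sum>j\<in>\<Omega>. (cconv n (\<lambda>k. \<epsilon>' k * x k) \<epsilon> j)\<^sup>2) / card \<Omega> - N\<^sup>2\<bar> > \<delta> * N\<^sup>2)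
          = (of_bool (\<bar>bform n H (\<lambda>k. \<epsilon>' k * z k) (\<lambda>k. \<epsilon>' k * z k)\<bar> > \<delta>) :: real)"
        using False by (simp add: form[OF \<epsilon>'] less_divide_eq)
    qed
    also have "\<dots> \<le> 4 * exp (- (2 * real s / 9))" by (rule tail) fact
    finally show ?thesis by (simp add: N_def)
  qed
qed

text \<open>
  A bad generator is excluded once for all points by Markov's inequality, at cost \<open>\<eta> / 2\<close>; for a
  good one the union bound over the points costs another \<open>\<eta> / 2\<close>.
\<close>
lemma failure_probability_less:
  assumes \<Omega>: "\<Omega> \<subseteq> {..<n}" "\<Omega> \<noteq> {}" and \<delta>: "0 < \<delta>" "\<delta> < 1" and \<eta>: "0 < \<eta>" "\<eta> < 1"
    and s: "s \<ge> 1" and K: "K > 0" "8 * s \<le> 2 ^ K"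
    and b: "1024 * real K * sqrt (real (2 * s)) * ln (4 * real n) \<le> \<delta> * \<eta> / 384 * sqrt (card \<Omega>)"
    and E: "finite E" "\<And>x. x \<in> E \<Longrightarrow> \<forall>i. i \<ge> n \<longrightarrow> x i = 0"
    and p: "card E * (4 * exp (- (2 * real s / 9))) < \<eta> / 2"
  shows "ravg {..<n} (\<lambda>\<epsilon>. ravg {..<n} (\<lambda>\<epsilon>'. of_bool (\<exists>x\<in>E.
      \<bar>(\<Sum>j\<in>\<Omega>. (cconv n (\<lambda>k. \<epsilon>' k * x k) \<epsilon> j)\<^sup>2) / card \<Omega> - (L2_set x {..<n})\<^sup>2\<bar>
        > \<delta> * (L2_set x {..<n})\<^sup>2))) < \<eta>"
proof -
  have "finite \<Omega>" using \<Omega>(1) finite_subset by blast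
  then have m: "card \<Omega> > 0" using \<Omega>(2) by (simp add: card_gt_0_iff)
  define t where "t = card \<Omega> * (\<delta> / 96)"
  have t: "t > 0" using m \<delta> by (simp add: t_def)
  define V where "V = deviation n \<Omega> (grid_ball n (real (2 * s)) (2 ^ K))"
  define bad where "bad \<epsilon> \<epsilon>' x \<longleftrightarrow> \<bar>(\<Sum>j\<in>\<Omega>. (cconv n (\<lambda>k. \<epsilon>' k * x k) \<epsilon> j)\<^sup>2) / card \<Omega> - (L2_set x {..<n})\<^sup>2\<bar>
        > \<delta> * (L2_set x {..<n})\<^sup>2" for \<epsilon> \<epsilon>' x
  have "\<delta> * \<eta> / 384 \<le> 1" using mult_mono[of \<delta> 1 \<eta> 1] \<delta> \<eta> by simp
  then have "\<delta> * \<eta> / 384 * sqrt (card \<Omega>) \<le> 1 * sqrt (card \<Omega>)" by (intro mult_right_mono) auto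
  then have "1024 * real K * sqrt (real (2 * s)) * ln (4 * real n) \<le> sqrt (card \<Omega>)" using b by linarith
  then have "ravg {..<n} V \<le> 2 * (1024 * real K * sqrt (real (2 * s)) * ln (4 * real n)) * sqrt (card \<Omega>)"
    unfolding V_def by (intro ravg_deviation_le \<Omega> K) auto
  also have "\<dots> \<le> 2 * (\<delta> * \<eta> / 384 * sqrt (card \<Omega>)) * sqrt (card \<Omega>)"
    by (intro mult_right_mono mult_left_mono b) auto
  also have "\<dots> = \<eta> / 2 * t" by (simp add: t_def)
  finally have "ravg {..<n} V / t \<le> \<eta> / 2" using t by (simp add: divide_le_eq)
  moreover have "ravg {..<n} (\<lambda>\<epsilon>. of_bool (V \<epsilon> \<ge> t)) \<le> ravg {..<n} V / t"
    using t by (intro ravg_markov) (auto simp: V_def intro!: deviation_nonneg)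
  ultimately have markov: "ravg {..<n} (\<lambda>\<epsilon>. of_bool (V \<epsilon> \<ge> t)) \<le> \<eta> / 2" by linarith
  have "ravg {..<n} (\<lambda>\<epsilon>. ravg {..<n} (\<lambda>\<epsilon>'. of_bool (\<exists>x\<in>E. bad \<epsilon> \<epsilon>' x)))
      \<le> ravg {..<n} (\<lambda>\<epsilon>. of_bool (V \<epsilon> \<ge> t) + card E * (4 * exp (- (2 * real s / 9))))"
  proof (rule ravg_mono)
    fix \<epsilon> assume \<epsilon>: "\<epsilon> \<in> sign_vecs {..<n}"
    show "ravg {..<n} (\<lambda>\<epsilon>'. of_bool (\<exists>x\<in>E. bad \<epsilon> \<epsilon>' x)) \<le> of_bool (V \<epsilon> \<ge> t) + card E * (4 * exp (- (2 * real s / 9)))"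
    proof (cases "V \<epsilon> \<ge> t")
      case True
      have "ravg {..<n} (\<lambda>\<epsilon>'. of_bool (\<exists>x\<in>E. bad \<epsilon> \<epsilon>' x)) \<le> ravg {..<n} (\<lambda>_. 1)"
        by (intro ravg_mono) auto
      also have "\<dots> \<le> of_bool (V \<epsilon> \<ge> t) + card E * (4 * exp (- (2 * real s / 9)))" using True by simp
      finally show ?thesis .
    next
      case False
      have "ravg {..<n} (\<lambda>\<epsilon>'. of_bool (\<exists>x\<in>E. bad \<epsilon> \<epsilon>' x)) \<le> ravg {..<n} (\<lambda>\<epsilon>'. \<Sum>x\<in>E. of_bool (bad \<epsilon> \<epsilon>' x))"
      proof (rule ravg_mono)
        fix \<epsilon>'
        show "of_bool (\<exists>x\<in>E. bad \<epsilon> \<epsilon>' x) \<le> (\<Sum>x\<in>E. of_bool (bad \<epsilon> \<epsilon>' x) :: real)"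
        proof (cases "\<exists>x\<in>E. bad \<epsilon> \<epsilon>' x")
          case True
          then obtain x where "x \<in> E" "bad \<epsilon> \<epsilon>' x" by blast
          then have "1 \<le> (\<Sum>x\<in>E. of_bool (bad \<epsilon> \<epsilon>' x) :: real)"
            using member_le_sum[of x E "\<lambda>x. of_bool (bad \<epsilon> \<epsilon>' x) :: real"] E(1) by simp
          then show ?thesis using True by simp
        qed (simp add: sum_nonneg)
      qed
      also have "\<dots> = (\<Sum>x\<in>E. ravg {..<n} (\<lambda>\<epsilon>'. of_bool (bad \<epsilon> \<epsilon>' x)))" by (rule ravg_sum)
      also have "\<dots> \<le> (\<Sum>x\<in>E. 4 * exp (- (2 * real s / 9)))"
        unfolding bad_def using False E(2)
        by (intro sum_mono sign_flipped_energy_tail[OF \<Omega> \<epsilon> \<delta>(1) s K(2)]) (auto simp: V_def t_def)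
      finally show ?thesis using False by simp
    qed
  qed
  also have "\<dots> = ravg {..<n} (\<lambda>\<epsilon>. of_bool (V \<epsilon> \<ge> t)) + card E * (4 * exp (- (2 * real s / 9)))"
    unfolding ravg_add by simp
  also have "\<dots> < \<eta> / 2 + \<eta> / 2" by (rule add_le_less_mono[OF markov p])
  finally show ?thesis unfolding bad_def by simp
qed

section \<open>Choice of the parameters\<close>

text \<open>
  The sparsity \<open>s\<close> is of the order of \<open>L = ln (27 p / \<eta>)\<close>, to beat the union bound, and the number
  of levels is of the order of \<open>ln L\<close>, to make the finest grid a net.  The constant 27 exceeds \<open>exp
  3\<close>, so that \<open>L \<ge> 3\<close> and \<open>ln L \<ge> 1\<close>.
\<close>
lemma parameters_exist:
  fixes \<delta> \<eta> :: real
  assumes \<delta>: "0 < \<delta>" and \<eta>: "0 < \<eta>" "\<eta> < 1" and p: "p \<ge> 1" and n: "n \<ge> 2"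
    and m: "real m \<ge> (50000000 / \<eta>)\<^sup>2 / \<delta>\<^sup>2 * ln (27 / \<eta> * real p)
      * (ln (ln (27 / \<eta> * real p)))\<^sup>2 * (ln (real n))\<^sup>2"
  obtains s K where "s \<ge> 1" "K > 0" "8 * s \<le> 2 ^ K" "real p * (4 * exp (- (2 * real s / 9))) < \<eta> / 2"
    "1024 * real K * sqrt (real (2 * s)) * ln (4 * real n) \<le> \<delta> * \<eta> / 384 * sqrt m"
proof -
  define L where "L = ln (27 / \<eta> * real p)"
  define l where "l = ln (real n)"
  have arg: "27 \<le> 27 / \<eta> * real p"
    using mult_mono[of 27 "27 / \<eta>" 1 "real p"] \<eta> p by (simp add: le_divide_eq)
  have e3: "exp 1 \<le> (3::real)" by (rule exp_le)
  have "exp (3::real) = exp 1 ^ 3" by (simp flip: exp_of_nat_mult)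
  also have "\<dots> \<le> 3 ^ 3" by (intro power_mono e3) simp
  finally have "exp 3 \<le> 27 / \<eta> * real p" using arg by simp
  then have L: "L \<ge> 3" unfolding L_def using arg by (subst ln_ge_iff) auto
  have lnL: "ln L \<ge> 1" using L e3 by (subst ln_ge_iff) auto
  have l: "l > 0" unfolding l_def using n by simp

  define s where "s = nat \<lceil>5 * L\<rceil>"
  have s: "5 * L \<le> real s" "real s \<le> 6 * L" using L by (simp_all add: s_def) linarith
  have s1: "s \<ge> 1" using s L by (simp add: Suc_le_eq)
  define K where "K = nat \<lceil>log 2 (8 * s)\<rceil>"
  have "log 2 (8 * s) \<ge> log 2 8" using s1 by simp
  moreover have "log 2 8 = (3::real)" using log_pow_cancel[of 2 3] by simp
  ultimately have lg: "log 2 (8 * s) \<ge> 3" by simp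
  have K: "log 2 (8 * s) \<le> real K" "real K \<le> log 2 (8 * s) + 1" using lg by (auto simp: K_def)
  have "K > 0" using K lg by (cases K) auto
  have "real (8 * s) = 2 powr log 2 (8 * s)" using s1 by simp
  also have "\<dots> \<le> 2 powr K" using K by simp
  also have "\<dots> = real (2 ^ K)" by (simp add: powr_realpow)
  finally have K8: "8 * s \<le> 2 ^ K" by (simp only: of_nat_le_iff)

  have "exp (- (2 * real s / 9)) \<le> exp (- L)" using s L by simp
  also have "\<dots> = \<eta> / (27 * p)" unfolding L_def using \<eta> p by (simp add: exp_minus field_simps)
  finally have "real p * (4 * exp (- (2 * real s / 9))) \<le> real p * (4 * (\<eta> / (27 * p)))"
    by (intro mult_left_mono) auto
  also have "\<dots> < \<eta> / 2" using \<eta> p by (simp add: field_simps)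
  finally have tail: "real p * (4 * exp (- (2 * real s / 9))) < \<eta> / 2" .

  have "real K \<le> 10 * ln L"
  proof -
    have "real K \<le> log 2 (16 * real s)"
    proof -
      have "log 2 (16 * real s) = log 2 (2 * (8 * real s))" by simp
      also have "\<dots> = 1 + log 2 (8 * real s)" using s1 by (subst log_mult) auto
      finally show ?thesis using K by simp
    qed
    also have "\<dots> = ln (16 * real s) / ln 2" by (simp add: log_def)
    also have "\<dots> \<le> ln (16 * real s) / (2 / 3)"
      using s1 ln2_ge_two_thirds by (intro divide_left_mono) auto
    also have "ln (16 * real s) \<le> ln (96 * L)" using s s1 by simp
    also have "\<dots> = ln 96 + ln L" using L by (simp add: ln_mult)
    also have "ln 96 \<le> (5::real)"
    proof -
      have "(5/2::real) \<le> exp 1" using exp_lower_Taylor_quadratic[of "1::real"] by simp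
      then have "(5/2) ^ 5 \<le> exp (1::real) ^ 5" by (intro power_mono) auto
      also have "\<dots> = exp 5" by (simp flip: exp_of_nat_mult)
      finally have "96 \<le> exp (5::real)" by (simp add: power_divide)
      then show ?thesis by (metis exp_gt_zero ln_exp ln_le_cancel_iff zero_less_numeral)
    qed
    finally show ?thesis using lnL by (simp add: field_simps)
  qed
  moreover have "sqrt (real (2 * s)) \<le> 4 * sqrt L"
  proof -
    have "sqrt (real (2 * s)) \<le> sqrt (16 * L)" using s L by (intro real_sqrt_le_mono) simp
    then show ?thesis by (simp add: real_sqrt_mult)
  qed
  moreover have "ln (4 * real n) \<le> 3 * l"
  proof -
    have "2 * 2 \<le> real n * real n" using n by (intro mult_mono) auto
    then have "4 * real n \<le> real n ^ 3" using n by (simp add: power3_eq_cube)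
    then have "ln (4 * real n) \<le> ln (real n ^ 3)" using n by (subst ln_le_cancel_iff) auto
    then show ?thesis using n by (simp add: l_def ln_realpow)
  qed
  ultimately have "1024 * real K * sqrt (real (2 * s)) * ln (4 * real n)
      \<le> 1024 * (10 * ln L) * (4 * sqrt L) * (3 * l)"
    using lnL L n by (intro mult_mono mult_nonneg_nonneg) auto
  also have "\<dots> \<le> \<delta> * \<eta> / 384 * (50000000 / (\<eta> * \<delta>) * (sqrt L * ln L * l))"
    using \<delta> \<eta> L lnL l by simp
  also have "\<dots> \<le> \<delta> * \<eta> / 384 * sqrt m"
  proof (intro mult_left_mono real_le_rsqrt)
    show "(50000000 / (\<eta> * \<delta>) * (sqrt L * ln L * l))\<^sup>2 \<le> real m"
      using m L unfolding L_def[symmetric] l_def[symmetric]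
      by (simp add: power_mult_distrib power_divide mult_ac)
  qed (use \<delta> \<eta> in auto)
  finally show ?thesis by (intro that[of s K] s1 \<open>K > 0\<close> K8 tail)
qed

section \<open>Partial circulant matrices\<close>

lemma bij_betw_pick:
  assumes "finite \<Omega>"
  shows "bij_betw (pick \<Omega>) {..<card \<Omega>} \<Omega>"
proof -
  have "pick \<Omega> ` {..<card \<Omega>} = \<Omega>"
  proof (intro equalityI subsetI)
    fix j assume "j \<in> pick \<Omega> ` {..<card \<Omega>}"
    then show "j \<in> \<Omega>" using pick_in_set_le by auto
  next
    fix j assume j: "j \<in> \<Omega>"
    have "card {a\<in>\<Omega>. a < j} < card \<Omega>" using assms j by (intro psubset_card_mono) auto
    then show "j \<in> pick \<Omega> ` {..<card \<Omega>}"
      by (intro image_eqI[of _ _ "card {a\<in>\<Omega>. a < j}"]) (simp_all add: pick_card_in_set[OF j])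
  qed
  then show ?thesis by (simp add: bij_betw_def eq_card_imp_inj_on)
qed

lemma vec_l2norm_real: "x \<in> carrier_vec n \<Longrightarrow> vec_l2norm (x :: real Matrix.vec) = L2_set (\<lambda>k. x $ k) {..<n}"
  by (simp add: vec_l2norm_def L2_set_def)

lemma smult_mat_mult_vec:
  assumes "A \<in> carrier_mat nr n" "v \<in> carrier_vec n"
  shows "(c \<cdot>\<^sub>m A) *\<^sub>v v = c \<cdot>\<^sub>v (A *\<^sub>v (v :: 'a :: comm_ring_1 Matrix.vec))"
  using assms by (intro eq_vecI) auto

lemma diag_of_vec_mult:
  assumes "x \<in> carrier_vec n"
  shows "diag_of_vec (Matrix.vec n \<epsilon>') *\<^sub>v x = Matrix.vec n (\<lambda>k. \<epsilon>' k * (x $ k :: real))"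
proof (rule eq_vecI)
  fix k assume "k < dim_vec (Matrix.vec n (\<lambda>k. \<epsilon>' k * x $ k))"
  then have k: "k < n" by simp
  have "(diag_of_vec (Matrix.vec n \<epsilon>') *\<^sub>v x) $ k = (\<Sum>l<n. (if k = l then \<epsilon>' l else 0) * x $ l)"
    using assms k by (auto simp: diag_of_vec_def mat_diag_def scalar_prod_def atLeast0LessThan intro!: sum.cong)
  also have "\<dots> = (\<Sum>l<n. if k = l then \<epsilon>' k * x $ k else 0)" by (intro sum.cong) auto
  also have "\<dots> = \<epsilon>' k * x $ k" using k by simp
  finally show "(diag_of_vec (Matrix.vec n \<epsilon>') *\<^sub>v x) $ k = Matrix.vec n (\<lambda>k. \<epsilon>' k * x $ k) $ k" using k by simp
qed (simp add: diag_of_vec_def mat_diag_def)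

text \<open>
  The list of rows of the matrix enumerates \<open>\<Omega>\<close>, so its squared norm is the restricted energy of the
  convolution.
\<close>
lemma partial_circulant_norm:
  assumes \<Omega>: "\<Omega> \<subseteq> {..<n}"
  shows "(vec_l2norm (partial_circulant \<Omega> (map_vec complex_of_real (Matrix.vec n \<epsilon>))
      *\<^sub>v map_vec complex_of_real (Matrix.vec n u)))\<^sup>2 = (\<Sum>j\<in>\<Omega>. (cconv n u \<epsilon> j)\<^sup>2) / card \<Omega>"
proof -
  have fin: "finite \<Omega>" using \<Omega> finite_subset by blast
  define m where "m = card \<Omega>"
  define z where "z = map_vec complex_of_real (Matrix.vec n \<epsilon>)"
  define w where "w = map_vec complex_of_real (Matrix.vec n u)"
  have zw: "z \<in> carrier_vec n" "w \<in> carrier_vec n" by (auto simp: z_def w_def)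
  have conv: "circ_conv z w $ j = of_real (cconv n u \<epsilon> j)" if "j < n" for j
  proof -
    have "n > 0" using that by simp
    then show ?thesis using that
      by (simp add: circ_conv_def z_def w_def cconv_def cyc_sub_less)
  qed
  have "partial_circulant \<Omega> z *\<^sub>v w
      = complex_of_real (1 / sqrt m) \<cdot>\<^sub>v (restriction_mat n \<Omega> *\<^sub>v circ_conv z w)"
  proof -
    have R: "restriction_mat n \<Omega> \<in> carrier_mat (card \<Omega>) n" by (rule restriction_mat_carrier[OF \<Omega>])
    have C: "circulant_mat z \<in> carrier_mat n n" using zw(1) by simp
    have "dim_vec z = n" by (simp add: z_def)
    then have "partial_circulant \<Omega> z *\<^sub>v w
        = complex_of_real (1 / sqrt m) \<cdot>\<^sub>v ((restriction_mat n \<Omega> * circulant_mat z) *\<^sub>v w)"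
      unfolding partial_circulant_def m_def by (simp only:) (rule smult_mat_mult_vec[OF mult_carrier_mat[OF R C] zw(2)])
    also have "(restriction_mat n \<Omega> * circulant_mat z) *\<^sub>v w = restriction_mat n \<Omega> *\<^sub>v (circulant_mat z *\<^sub>v w)"
      by (rule assoc_mult_mat_vec[OF R C zw(2)])
    finally show ?thesis unfolding circulant_mat_mult_vec[OF zw] .
  qed
  also have "restriction_mat n \<Omega> *\<^sub>v circ_conv z w = Matrix.vec m (\<lambda>i. circ_conv z w $ pick \<Omega> i)"
    unfolding m_def by (rule restriction_mat_mult_vec[OF \<Omega>]) (simp add: circ_conv_def w_def carrier_vecI)
  finally have eq: "partial_circulant \<Omega> z *\<^sub>v w
      = complex_of_real (1 / sqrt m) \<cdot>\<^sub>v Matrix.vec m (\<lambda>i. circ_conv z w $ pick \<Omega> i)" .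
  have "(vec_l2norm (partial_circulant \<Omega> z *\<^sub>v w))\<^sup>2 = (\<Sum>i<m. (cconv n u \<epsilon> (pick \<Omega> i))\<^sup>2 / m)"
    unfolding eq vec_l2norm_def L2_set_square
  proof (rule sum.cong)
    fix i assume "i \<in> {..<m}"
    then have i: "i < m" "pick \<Omega> i < n" using pick_in_set_le[of i \<Omega>] \<Omega> by (auto simp: m_def)
    then show "(norm ((complex_of_real (1 / sqrt m) \<cdot>\<^sub>v Matrix.vec m (\<lambda>i. circ_conv z w $ pick \<Omega> i)) $ i))\<^sup>2
        = (cconv n u \<epsilon> (pick \<Omega> i))\<^sup>2 / m"
      by (simp add: conv norm_mult norm_divide power_divide power_mult_distrib)
  qed simp
  also have "\<dots> = (\<Sum>j\<in>\<Omega>. (cconv n u \<epsilon> j)\<^sup>2 / m)"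
    unfolding m_def by (rule sum.reindex_bij_betw[OF bij_betw_pick[OF fin]])
  finally show ?thesis by (simp add: z_def w_def m_def sum_divide_distrib)
qed

lemma rademacher_vec_eq:
  "rademacher_vec n = map_pmf (Matrix.vec n) (pmf_of_set (sign_vecs {..<n}))"
  unfolding rademacher_vec_def sign_vecs_def by (subst Pi_pmf_of_set) auto

lemma prob_rademacher_pair:
  "measure_pmf.prob (pair_pmf (rademacher_vec n) (rademacher_vec n)) {(v, v'). P v v'}
    = ravg {..<n} (\<lambda>\<epsilon>. ravg {..<n} (\<lambda>\<epsilon>'. of_bool (P (Matrix.vec n \<epsilon>) (Matrix.vec n \<epsilon>'))))"
proof -
  define A where "A = sign_vecs {..<n}"
  define U where "U = pmf_of_set A"
  have A: "finite A" "A \<noteq> {}" "card A = 2 ^ n" by (simp_all add: A_def card_sign_vecs)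
  define Q where "Q = {(\<epsilon>, \<epsilon>'). P (Matrix.vec n \<epsilon>) (Matrix.vec n \<epsilon>')}"
  have "pair_pmf (rademacher_vec n) (rademacher_vec n)
      = map_pmf (\<lambda>(a, b). (Matrix.vec n a, Matrix.vec n b)) (pair_pmf U U)"
    unfolding map_pair rademacher_vec_eq U_def A_def ..
  then have "measure_pmf.prob (pair_pmf (rademacher_vec n) (rademacher_vec n)) {(v, v'). P v v'}
      = measure_pmf.prob (pair_pmf U U) Q"
    by (simp add: Q_def vimage_def case_prod_unfold)
  also have "\<dots> = measure_pmf.prob (pair_pmf U U) (Q \<inter> set_pmf (pair_pmf U U))"
    by (rule measure_Int_set_pmf[symmetric])
  also have "\<dots> = (\<Sum>p\<in>Q \<inter> (A \<times> A). pmf (pair_pmf U U) p)"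
    using A by (simp add: U_def measure_measure_pmf_finite)
  also have "\<dots> = (\<Sum>p\<in>A \<times> A. of_bool (p \<in> Q) * (1 / 2 ^ n / 2 ^ n))"
  proof (intro sum.mono_neutral_cong_left)
    have "pmf U a = 1 / 2 ^ n" if "a \<in> A" for a
      unfolding U_def using A that by (subst pmf_of_set) auto
    then show "pmf (pair_pmf U U) p = of_bool (p \<in> Q) * (1 / 2 ^ n / 2 ^ n)" if "p \<in> Q \<inter> (A \<times> A)" for p
      using that by (cases p) (simp add: pmf_pair)
  qed (use A in auto)
  also have "\<dots> = (\<Sum>\<epsilon>\<in>A. \<Sum>\<epsilon>'\<in>A. of_bool ((\<epsilon>, \<epsilon>') \<in> Q) * (1 / 2 ^ n / 2 ^ n))"
    by (simp add: sum.cartesian_product case_prod_unfold)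
  also have "\<dots> = ravg {..<n} (\<lambda>\<epsilon>. ravg {..<n} (\<lambda>\<epsilon>'. of_bool ((\<epsilon>, \<epsilon>') \<in> Q)))"
    by (simp only: ravg_def A_def sum_divide_distrib card_lessThan times_divide_eq_right mult_1_right)
  finally show ?thesis by (simp add: Q_def)
qed

theorem theorem1p2:
  fixes \<eta> :: real
  assumes "0 < \<eta>" and "\<eta> < 1"
  shows "\<exists>C\<^sub>1>0. \<exists>C\<^sub>2>0.
    \<forall>(n::nat) (m::nat) (p::nat) (\<delta>::real) (E :: real Matrix.vec set) (\<Omega> :: nat set).
      0 < \<delta> \<longrightarrow> \<delta> < 1 \<longrightarrow>
      E \<subseteq> carrier_vec n \<longrightarrow> finite E \<longrightarrow> card E = p \<longrightarrow>
      1 \<le> m \<longrightarrow> m \<le> n \<longrightarrow>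
      real m \<ge> C\<^sub>1 / \<delta>\<^sup>2 * ln (C\<^sub>2 * real p) * (ln (ln (C\<^sub>2 * real p)))\<^sup>2 * (ln (real n))\<^sup>2 \<longrightarrow>
      \<Omega> \<subseteq> {..<n} \<longrightarrow> card \<Omega> = m \<longrightarrow>
      measure_pmf.prob (pair_pmf (rademacher_vec n) (rademacher_vec n))
        {(\<epsilon>, \<epsilon>'). \<forall>x\<in>E.
           let \<Phi> = partial_circulant \<Omega> (map_vec complex_of_real \<epsilon>);
               y = \<Phi> *\<^sub>v map_vec complex_of_real (diag_of_vec \<epsilon>' *\<^sub>v x)
           in (1 - \<delta>) * (vec_l2norm x)\<^sup>2 \<le> (vec_l2norm y)\<^sup>2 \<and>
              (vec_l2norm y)\<^sup>2 \<le> (1 + \<delta>) * (vec_l2norm x)\<^sup>2}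
      > 1 - \<eta>"
proof (intro exI conjI allI impI)
  \<comment> \<open>The first constant absorbs \<open>384 / \<eta>\<close> and the numerical factors of the chaining bound, squared.\<close>
  show "0 < (50000000 / \<eta>)\<^sup>2" "0 < 27 / \<eta>" using assms by auto
  fix n m p :: nat and \<delta> :: real and E :: "real Matrix.vec set" and \<Omega> :: "nat set"
  assume \<delta>: "0 < \<delta>" "\<delta> < 1" and E: "E \<subseteq> carrier_vec n" "finite E" "card E = p"
    and m: "1 \<le> m" "m \<le> n"
    and bound: "real m \<ge> (50000000 / \<eta>)\<^sup>2 / \<delta>\<^sup>2 * ln (27 / \<eta> * real p)
      * (ln (ln (27 / \<eta> * real p)))\<^sup>2 * (ln (real n))\<^sup>2"
    and \<Omega>: "\<Omega> \<subseteq> {..<n}" "card \<Omega> = m"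
  have \<Omega>0: "\<Omega> \<noteq> {}" using \<Omega>(2) m by auto
  define F where "F x k = (if k < n then x $ k else 0)" for x :: "real Matrix.vec" and k
  define bad where "bad \<epsilon> \<epsilon>' f \<longleftrightarrow> \<bar>(\<Sum>j\<in>\<Omega>. (cconv n (\<lambda>k. \<epsilon>' k * f k) \<epsilon> j)\<^sup>2) / card \<Omega> - (L2_set f {..<n})\<^sup>2\<bar>
        > \<delta> * (L2_set f {..<n})\<^sup>2" for \<epsilon> \<epsilon>' f
  define good where "good v v' \<longleftrightarrow> (\<forall>x\<in>E.
           let \<Phi> = partial_circulant \<Omega> (map_vec complex_of_real v);
               y = \<Phi> *\<^sub>v map_vec complex_of_real (diag_of_vec v' *\<^sub>v x)
           in (1 - \<delta>) * (vec_l2norm x)\<^sup>2 \<le> (vec_l2norm y)\<^sup>2 \<and>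
              (vec_l2norm y)\<^sup>2 \<le> (1 + \<delta>) * (vec_l2norm x)\<^sup>2)" for v v'
  have good_iff: "good (Matrix.vec n \<epsilon>) (Matrix.vec n \<epsilon>') \<longleftrightarrow> \<not> (\<exists>f\<in>F ` E. bad \<epsilon> \<epsilon>' f)" for \<epsilon> \<epsilon>'
  proof -
    have "(let \<Phi> = partial_circulant \<Omega> (map_vec complex_of_real (Matrix.vec n \<epsilon>));
               y = \<Phi> *\<^sub>v map_vec complex_of_real (diag_of_vec (Matrix.vec n \<epsilon>') *\<^sub>v x)
           in (1 - \<delta>) * (vec_l2norm x)\<^sup>2 \<le> (vec_l2norm y)\<^sup>2 \<and>
              (vec_l2norm y)\<^sup>2 \<le> (1 + \<delta>) * (vec_l2norm x)\<^sup>2) \<longleftrightarrow> \<not> bad \<epsilon> \<epsilon>' (F x)" if "x \<in> E" for x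
    proof -
      have x: "x \<in> carrier_vec n" using that E by auto
      have "Matrix.vec n (\<lambda>k. \<epsilon>' k * x $ k) = Matrix.vec n (\<lambda>k. \<epsilon>' k * F x k)" by (auto simp: F_def)
      moreover have "L2_set (\<lambda>k. x $ k) {..<n} = L2_set (F x) {..<n}" by (intro L2_set_cong) (auto simp: F_def)
      ultimately show ?thesis
        unfolding Let_def diag_of_vec_mult[OF x] vec_l2norm_real[OF x] bad_def
        by (simp only: partial_circulant_norm[OF \<Omega>(1)]) (auto simp: abs_less_iff algebra_simps not_less abs_le_iff)
    qed
    then show ?thesis unfolding good_def by simp
  qed
  have "ravg {..<n} (\<lambda>\<epsilon>. ravg {..<n} (\<lambda>\<epsilon>'. of_bool (\<exists>f\<in>F ` E. bad \<epsilon> \<epsilon>' f))) < \<eta>"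
  proof -
    consider "p = 0" | "p \<ge> 1" "n = 1" | "p \<ge> 1" "n \<ge> 2" using m by linarith
    then show ?thesis
    proof cases
      case 1
      then show ?thesis using E assms by simp
    next
      \<comment> \<open>The estimates below are relative to \<open>ln n\<close>, which vanishes for \<open>n = 1\<close>;
        a one by one matrix with a sign as its entry is an isometry.\<close>
      case 2
      have "\<not> bad \<epsilon> \<epsilon>' f" if "\<epsilon> \<in> sign_vecs {..<n}" "\<epsilon>' \<in> sign_vecs {..<n}" for \<epsilon> \<epsilon>' f
      proof -
        have "bform n (gram n \<Omega> \<epsilon>) (\<lambda>k. \<epsilon>' k * f k) (\<lambda>k. \<epsilon>' k * f k) = 0"
          using 2 by (simp add: bform_def gram_def)
        moreover have "L2_set (\<lambda>k. \<epsilon>' k * f k) {..<n} = L2_set f {..<n}"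
          unfolding L2_set_def using sign_vecs_sq[OF that(2)] by (simp add: power_mult_distrib)
        ultimately have "(\<Sum>j\<in>\<Omega>. (cconv n (\<lambda>k. \<epsilon>' k * f k) \<epsilon> j)\<^sup>2) / card \<Omega> - (L2_set f {..<n})\<^sup>2 = 0"
          using bform_gram[OF \<Omega>(1) \<Omega>0 that(1), of "\<lambda>k. \<epsilon>' k * f k"] by simp
        then show ?thesis unfolding bad_def using \<delta> by (simp add: not_less)
      qed
      then have "ravg {..<n} (\<lambda>\<epsilon>. ravg {..<n} (\<lambda>\<epsilon>'. of_bool (\<exists>f\<in>F ` E. bad \<epsilon> \<epsilon>' f)))
          = ravg {..<n} (\<lambda>\<epsilon>. ravg {..<n} (\<lambda>\<epsilon>'. 0))"
        by (intro ravg_cong) simp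
      then show ?thesis using assms by simp
    next
      case 3
      obtain s K where sK: "s \<ge> 1" "K > 0" "8 * s \<le> 2 ^ K"
        "real p * (4 * exp (- (2 * real s / 9))) < \<eta> / 2"
        "1024 * real K * sqrt (real (2 * s)) * ln (4 * real n) \<le> \<delta> * \<eta> / 384 * sqrt m"
        using parameters_exist[OF \<delta>(1) assms 3 bound] by metis
      have "real (card (F ` E)) \<le> real p" using card_image_le[OF E(2), of F] E(3) by simp
      then have "card (F ` E) * (4 * exp (- (2 * real s / 9))) \<le> real p * (4 * exp (- (2 * real s / 9)))"
        by (intro mult_right_mono) auto
      also note sK(4)
      finally show ?thesis unfolding bad_def
        using sK(5) \<Omega>(2) E(2)
        by (intro failure_probability_less[OF \<Omega>(1) \<Omega>0 \<delta> assms sK(1,2,3)]) (auto simp: F_def)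
    qed
  qed
  moreover have "measure_pmf.prob (pair_pmf (rademacher_vec n) (rademacher_vec n)) {(v, v'). good v v'}
      = 1 - ravg {..<n} (\<lambda>\<epsilon>. ravg {..<n} (\<lambda>\<epsilon>'. of_bool (\<exists>f\<in>F ` E. bad \<epsilon> \<epsilon>' f)))"
  proof -
    have "ravg {..<n} (\<lambda>\<epsilon>. ravg {..<n} (\<lambda>\<epsilon>'. of_bool (good (Matrix.vec n \<epsilon>) (Matrix.vec n \<epsilon>'))))
        = ravg {..<n} (\<lambda>\<epsilon>. ravg {..<n} (\<lambda>\<epsilon>'. 1 - of_bool (\<exists>f\<in>F ` E. bad \<epsilon> \<epsilon>' f)))"
      unfolding good_iff by (intro ravg_cong) simp
    then show ?thesis unfolding prob_rademacher_pair ravg_diff by simp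
  qed
  ultimately show "1 - \<eta> < measure_pmf.prob (pair_pmf (rademacher_vec n) (rademacher_vec n))
        {(\<epsilon>, \<epsilon>'). \<forall>x\<in>E.
           let \<Phi> = partial_circulant \<Omega> (map_vec complex_of_real \<epsilon>);
               y = \<Phi> *\<^sub>v map_vec complex_of_real (diag_of_vec \<epsilon>' *\<^sub>v x)
           in (1 - \<delta>) * (vec_l2norm x)\<^sup>2 \<le> (vec_l2norm y)\<^sup>2 \<and>
              (vec_l2norm y)\<^sup>2 \<le> (1 + \<delta>) * (vec_l2norm x)\<^sup>2}"
    unfolding good_def[symmetric] by linarith
qed

end
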